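(* Let $\gamma\in[0,1)$ and suppose $(\sigma_{t,x})_{(t,x)\in\mathbb N\times\mathbb X}$ is normalized, i.e. $\sigma_{t,x}(\delta_0)=0$ for all $(t,x)\in\mathbb N\times\mathbb X$. Assume that for every $t\in\mathbb N$: (i) $(x,a)\mapsto P(t,x,a,\cdot)$ is weakly continuous, i.e. $\int f\,dP(t,x^n,a^n,\cdot)\to\int f\,dP(t,x^0,a^0,\cdot)$ for all $f\in C_b(\mathbb X)$ whenever $x^n\to x^0$ in $\mathbb X$ and $a^n\to a^0$ in $\mathbb A$; (ii) $\bigcup_{x\in\mathbb X}\mathcal A_t(x)$ is compact and $\mathcal A_t$ is upper hemi-continuous (for every $x$ and every open $U_{\mathbb A}\supseteq\mathcal A_t(x)$ there is an open $U_{\mathbb X}\ni x$ with $\mathcal A_t(z)\subseteq U_{\mathbb A}$ for all $z\in U_{\mathbb X}$); (iii) for every compact $K\subset\mathbb R$, every $(\mu^n)_{n\in\mathbb N}\subset\mathcal P(K)$ converging weakly to $\mu^0\in\mathcal P(K)$ and every $x^n\to x^0$ in $\mathbb X$, $\liminf_{n\to\infty}\sigma_{t,x^n}(\mu^n)\ge\sigma_{t,x^0}(\mu^0)$; (iv) $C_t$ is lower semi-continuous and $\|C_t\|_\infty\le b$, where $b>0$ does not depend on $t$. Then for every $(\mathfrak X,\mathfrak A)\in\Psi$ (whose actions may be history-dependent), $$\inf_{(\mathfrak X^{\mathfrak p},\mathfrak A^{\mathfrak p})\in\Psi}\varsigma^{\mathfrak X^{\mathfrak p}}_{0,\infty}(\mathfrak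 C^{\mathfrak p})\le\varsigma^{\mathfrak X}_{0,\infty}(\mathfrak C),$$ where the infimum is over all Markovian policies $\mathfrak p\in\Pi$.
   Context: Spaces. $\mathbb N=\{1,2,\dots\}$, $\mathbb N_0=\{0\}\cup\mathbb N$. $\mathbb X$ (states) and $\mathbb A$ (actions) are complete separable metric spaces with Borel $\sigma$-algebras. $\Lambda$ is the set of Borel probability measures on $\mathbb A$ with the weak topology and its Borel $\sigma$-algebra. For closed $F\subseteq\mathbb R$, $\mathcal P(F)$ is the set of Borel probability measures on $F$ with the weak topology; $\mathcal P_b(\mathbb R)$, $\mathcal P_b(\mathbb R^2)$ are the Borel probability measures with bounded support. $\gamma$ is a fixed discount factor. Probability setting. $(\Omega,\mathscr H,\mathbb P)$ is a complete atomless probability space with filtrations $(\mathscr F_t)_{t\in\mathbb N}$, $(\mathscr G_t)_{t\in\mathbb N}$, $\mathscr F_t\subseteq\mathscr G_t\subseteq\mathscr H$, $\mathscr F_1$ containing all $\mathbb P$-null sets; $\mathscr F_0=\mathscr G_0=\{\emptyset,\Omega\}$ and $\mathscr U_t:=\mathscr G_{t-1}\vee\mathscr F_t$. $L^\infty(\Omega,\mathscr H,\mathbb P)$ carries the essential supremum norm. For bounded real $Y$, $P^{Y|\mathscr U}$ denotes a regular conditional distribution of $Y$ given $\mathscr U$, in a version supported in $[-\|Y\|_\infty,\|Y\|_\infty]$ for every $\omega$; $\mathcal L(Y)$ is the law of $Y$. Risk measures. A law-invariant convex risk measure (at the level of distributions) is a map $\sigma:\mathcal P_b(\mathbb R)\to(-\infty,\infty]$,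 not identically $+\infty$, with: (1) $\sigma(\mu*\delta_c)=\sigma(\mu)+c$ for $c\in\mathbb R$; (2) $\mu((-\infty,r])\ge\mu'((-\infty,r])$ for all $r$ implies $\sigma(\mu)\le\sigma(\mu')$; (3) for $\zeta\in\mathcal P_b(\mathbb R^2)$ with first and second marginals $\zeta_0,\zeta_1$, and $\theta\in[0,1]$, if $\zeta_\theta$ is the image of $\zeta$ under $(r_0,r_1)\mapsto(1-\theta)r_0+\theta r_1$, then $\sigma(\zeta_\theta)\le(1-\theta)\sigma(\zeta_0)+\theta\sigma(\zeta_1)$. Fix such $\sigma_0$ and $(\sigma_{t,x})_{(t,x)\in\mathbb N\times\mathbb X}$; it is assumed that for every $t$ and compact $K\subset\mathbb R$, $(x,\mu)\mapsto\sigma_{t,x}(\mu)$ is Borel measurable on $\mathbb X\times\mathcal P(K)$, and that $|\sigma_{t,x}(\delta_0)|\le b_t$ for all $x$, for some $b_t\ge0$. Dynamic risk measure. For an $\mathbb X$-valued $(\mathscr F_t)$-adapted process $\mathfrak X=(X_t)_{t\in\mathbb N}$ and $\mathfrak Z=(Z_t)_{t\in\mathbb N_0}\subset L^\infty(\Omega,\mathscr H,\mathbb P)$ with $\sup_t\|Z_t\|_\infty<\infty$: $\varsigma^{\mathfrak X}_{T,x,T}(\mathfrak Z):=\sigma_{T,x}(P^{Z_T|\mathscr U_T})$; for $0<t<T$, $\varsigma^{\mathfrak X}_{t,x,T}(\mathfrak Z):=\sigma_{t,x}(P^{W_t^T|\mathscr U_t})$ with $W_t^T:=Z_t+\gamma\,\varsigma^{\mathfrak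 X}_{t+1,X_{t+1},T}(\mathfrak Z)$; $\varsigma^{\mathfrak X}_{0,T}(\mathfrak Z):=\sigma_0(\mathcal L(Z_0+\gamma\,\varsigma^{\mathfrak X}_{1,X_1,T}(\mathfrak Z)))$; and $\varsigma^{\mathfrak X}_{0,\infty}(\mathfrak Z):=\lim_{T\to\infty}\varsigma^{\mathfrak X}_{0,T}(\mathfrak Z)$ (the limit exists when $\gamma<1$ and $(\sigma_{t,x})$ is normalized). Actions and policies. For $t\in\mathbb N$, $\mathcal A_t:\mathbb X\to2^{\mathbb A}$ is nonempty closed-valued and weakly measurable ($\{x:\mathcal A_t(x)\cap U\ne\emptyset\}\in\mathcal B(\mathbb X)$ for open $U$). $\varpi_t(x):=\{\lambda\in\Lambda:\lambda(\mathcal A_t(x))=1\}$; $\Pi_t$ is the set of measurable $\pi_t:\mathbb X\to\Lambda$ with $\pi_t(x)\in\varpi_t(x)$ for all $x$; $\Pi$ is the set of Markovian policies $\mathfrak p=(\pi_t)_{t\in\mathbb N}$, $\pi_t\in\Pi_t$. Controlled processes. $P$ is a transition kernel: $P(t,x,a,\cdot)$ is a Borel probability on $\mathbb X$, and $(x,a)\mapsto P(t,x,a,B)$ is measurable for $B\in\mathcal B(\mathbb X)$. $\xi_1$ is a Borel probability on $\mathbb X$. $\Psi$ is a set of pairs $(\mathfrak X,\mathfrak A)$, $\mathfrak X=(X_t)_{t\in\mathbb N}$ $\mathbb X$-valued and $(\mathscr F_t)$-adapted, $\mathfrak A=(A_t)_{t\in\mathbb N}$ $\mathbb A$-valued and $(\mathscr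 G_t)$-adapted, such that $X_1\sim\xi_1$, $\mathbb P(X_{t+1}\in B|\mathscr G_t)=P(t,X_t,A_t,B)$ a.s., and $\mathbb P(A_t\in\mathcal A_t(X_t),\ t\in\mathbb N)=1$. It is assumed that for each $\mathfrak p=(\pi_t)\in\Pi$ there is a pair in $\Psi$, written $(\mathfrak X^{\mathfrak p},\mathfrak A^{\mathfrak p})$, with $\mathbb P(A_t\in B|\mathscr U_t)=\mathbb P(A_t\in B|\sigma(X_t))=[\pi_t(X_t)](B)$ a.s. for all $t$, $B\in\mathcal B(\mathbb A)$. Costs. $C_t:\mathbb X\times\mathbb A\times\mathbb X\to\mathbb R$ is Borel measurable for $t\in\mathbb N$, $C_0\equiv0$; $\mathfrak C:=(C_t(X_t,A_t,X_{t+1}))_{t\in\mathbb N_0}$ (zero entry at $t=0$), and $\mathfrak C^{\mathfrak p}$ is the same for $(\mathfrak X^{\mathfrak p},\mathfrak A^{\mathfrak p})$. *)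

theory Defs
  imports "HOL-Probability.Probability"
begin

text \<open>
  Time runs through \<open>{1, 2, ...}\<close>; every family indexed by \<open>nat\<close> is constrained only at indices
  \<open>t \<ge> 1\<close> unless index \<open>0\<close> is mentioned.
\<close>

section \<open>Borel probability measures and the weak topology\<close>

definition bounded_cont :: "('b::topological_space \<Rightarrow> real) set" where
  "bounded_cont = {f. continuous_on UNIV f \<and> bounded (range f)}"

text \<open>A Borel probability measure on a closed set \<open>S\<close> is represented by its extension to the
  ambient type, that is, by a Borel probability measure giving mass 1 to \<open>S\<close>.\<close>

definition prob_on :: "'b::topological_space set \<Rightarrow> 'b measure set" where
  "prob_on S = {\<mu>. prob_space \<mu> \<and> sets \<mu> = sets borel \<and> emeasure \<mu> S = 1}"

definition prob_bdd :: "'b::metric_space measure set" where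
  "prob_bdd = {\<mu>. \<exists>S. closed S \<and> bounded S \<and> \<mu> \<in> prob_on S}"

definition weak_topology :: "'b::topological_space set \<Rightarrow> 'b measure topology" where
  "weak_topology S = topology_generated_by
     {{\<mu> \<in> prob_on S. (\<integral>x. f x \<partial>\<mu>) \<in> V} | f V. f \<in> bounded_cont \<and> open V}"

definition borel_of :: "'b topology \<Rightarrow> 'b measure" where
  "borel_of T = sigma (topspace T) {V. openin T V}"

definition weakly_converges :: "(nat \<Rightarrow> 'b::topological_space measure) \<Rightarrow> 'b measure \<Rightarrow> bool" where
  "weakly_converges \<mu> \<nu> \<longleftrightarrow>
     (\<forall>f\<in>bounded_cont. (\<lambda>n. \<integral>x. f x \<partial>\<mu> n) \<longlonglongrightarrow> (\<integral>x. f x \<partial>\<nu>))"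

section \<open>Law-invariant convex risk measures\<close>

definition risk_measure :: "(real measure \<Rightarrow> ereal) \<Rightarrow> bool" where
  "risk_measure \<sigma> \<longleftrightarrow>
     (\<forall>\<mu>\<in>prob_bdd. \<sigma> \<mu> \<noteq> -\<infinity>) \<and>
     (\<exists>\<mu>\<in>prob_bdd. \<sigma> \<mu> \<noteq> \<infinity>) \<and>
     (\<forall>\<mu>\<in>prob_bdd. \<forall>c. \<sigma> (convolution \<mu> (return borel c)) = \<sigma> \<mu> + ereal c) \<and>
     (\<forall>\<mu>\<in>prob_bdd. \<forall>\<mu>'\<in>prob_bdd.
        (\<forall>r. measure \<mu> {..r} \<ge> measure \<mu>' {..r}) \<longrightarrow> \<sigma> \<mu> \<le> \<sigma> \<mu>') \<and>
     (\<forall>\<zeta>\<in>prob_bdd. \<forall>\<theta>\<in>{0..1}.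
        \<sigma> (distr \<zeta> borel (\<lambda>(r0, r1). (1 - \<theta>) * r0 + \<theta> * r1))
          \<le> ereal (1 - \<theta>) * \<sigma> (distr \<zeta> borel fst) + ereal \<theta> * \<sigma> (distr \<zeta> borel snd))"

section \<open>The probability space and conditional distributions\<close>

definition atomless :: "'w measure \<Rightarrow> bool" where
  "atomless M \<longleftrightarrow> (\<forall>E\<in>sets M. measure M E > 0 \<longrightarrow>
     (\<exists>D\<in>sets M. D \<subseteq> E \<and> 0 < measure M D \<and> measure M D < measure M E))"

definition joint_filtration :: "(nat \<Rightarrow> 'w measure) \<Rightarrow> (nat \<Rightarrow> 'w measure) \<Rightarrow> nat \<Rightarrow> 'w measure" where
  "joint_filtration F G t = sigma (space (F t)) (sets (G (t - 1)) \<union> sets (F t))"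

definition cond_probability :: "'w measure \<Rightarrow> 'w measure \<Rightarrow> 'w set \<Rightarrow> 'w \<Rightarrow> real" where
  "cond_probability M U E = real_cond_exp M U (indicator E)"

definition Linf_norm :: "'w measure \<Rightarrow> ('w \<Rightarrow> real) \<Rightarrow> ereal" where
  "Linf_norm M Y = esssup M (\<lambda>\<omega>. ereal \<bar>Y \<omega>\<bar>)"

definition is_cond_distr ::
  "'w measure \<Rightarrow> 'w measure \<Rightarrow> ('w \<Rightarrow> real) \<Rightarrow> ('w \<Rightarrow> real measure) \<Rightarrow> bool" where
  "is_cond_distr M U Y \<kappa> \<longleftrightarrow>
     (\<forall>\<omega>\<in>space M. \<kappa> \<omega> \<in> prob_on {y. ereal \<bar>y\<bar> \<le> Linf_norm M Y}) \<and>
     (\<forall>B\<in>sets borel. (\<lambda>\<omega>. measure (\<kappa> \<omega>) B) \<in> borel_measurable U) \<and>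
     (\<forall>B\<in>sets borel. AE \<omega> in M.
        measure (\<kappa> \<omega>) B = cond_probability M U {\<omega>'\<in>space M. Y \<omega>' \<in> B} \<omega>)"

text \<open>An arbitrary version is chosen; two versions agree, as measures, almost everywhere.\<close>

definition cond_distr :: "'w measure \<Rightarrow> 'w measure \<Rightarrow> ('w \<Rightarrow> real) \<Rightarrow> 'w \<Rightarrow> real measure" where
  "cond_distr M U Y = (SOME \<kappa>. is_cond_distr M U Y \<kappa>)"

section \<open>The dynamic risk measure\<close>

text \<open>
  The values of risk measures with \<open>\<sigma> \<delta>\<^sub>0\<close> finite are finite on measures of bounded
  support, by monotonicity and translation, so \<^const>\<open>real_of_ereal\<close> below only changes the type.
  The term \<open>dyn_risk \<dots> t T x\<close> is meaningful for \<open>1 \<le> t \<le> T\<close>.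
\<close>

context
  fixes M :: "'w measure" and F G :: "nat \<Rightarrow> 'w measure"
    and \<sigma> :: "nat \<Rightarrow> 'x \<Rightarrow> real measure \<Rightarrow> ereal" and \<gamma> :: real
    and X :: "nat \<Rightarrow> 'w \<Rightarrow> 'x" and Z :: "nat \<Rightarrow> 'w \<Rightarrow> real"
begin

function dyn_risk :: "nat \<Rightarrow> nat \<Rightarrow> 'x \<Rightarrow> 'w \<Rightarrow> ereal" where
  "dyn_risk t T x \<omega> = \<sigma> t x (cond_distr M (joint_filtration F G t)
     (if t < T
      then (\<lambda>\<omega>'. Z t \<omega>' + \<gamma> * real_of_ereal (dyn_risk (Suc t) T (X (Suc t) \<omega>') \<omega>'))
      else Z t) \<omega>)"
  by pat_completeness auto
termination
  by (relation "Wellfounded.measure (\<lambda>(t, T, x, \<omega>). T - t)") auto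

declare dyn_risk.simps [simp del]

definition dyn_risk0 :: "(real measure \<Rightarrow> ereal) \<Rightarrow> nat \<Rightarrow> ereal" where
  "dyn_risk0 \<sigma>0 T =
     \<sigma>0 (distr M borel (\<lambda>\<omega>. Z 0 \<omega> + \<gamma> * real_of_ereal (dyn_risk 1 T (X 1 \<omega>) \<omega>)))"

definition dyn_risk0_inf :: "(real measure \<Rightarrow> ereal) \<Rightarrow> ereal" where
  "dyn_risk0_inf \<sigma>0 = lim (\<lambda>T. dyn_risk0 \<sigma>0 T)"

end

section \<open>Controlled processes, policies and costs\<close>

definition weakly_measurable_corr :: "('x::topological_space \<Rightarrow> 'a::topological_space set) \<Rightarrow> bool" where
  "weakly_measurable_corr \<A> \<longleftrightarrow> (\<forall>V. open V \<longrightarrow> {x. \<A> x \<inter> V \<noteq> {}} \<in> sets borel)"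

definition upper_hemicontinuous_corr :: "('x::topological_space \<Rightarrow> 'a::topological_space set) \<Rightarrow> bool" where
  "upper_hemicontinuous_corr \<A> \<longleftrightarrow>
     (\<forall>x V. open V \<and> \<A> x \<subseteq> V \<longrightarrow> (\<exists>W. open W \<and> x \<in> W \<and> (\<forall>z\<in>W. \<A> z \<subseteq> V)))"

definition lower_semicont :: "('b::topological_space \<Rightarrow> real) \<Rightarrow> bool" where
  "lower_semicont f \<longleftrightarrow> (\<forall>z. ereal (f z) \<le> Liminf (at z) (\<lambda>w. ereal (f w)))"

definition markov_policies ::
  "(nat \<Rightarrow> 'x::topological_space \<Rightarrow> 'a::topological_space set) \<Rightarrow> (nat \<Rightarrow> 'x \<Rightarrow> 'a measure) set" where
  "markov_policies \<A> = {p. \<forall>t\<ge>1.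
     p t \<in> borel \<rightarrow>\<^sub>M borel_of (weak_topology UNIV) \<and> (\<forall>x. emeasure (p t x) (\<A> t x) = 1)}"

definition controlled_process ::
  "'w measure \<Rightarrow> (nat \<Rightarrow> 'w measure) \<Rightarrow> (nat \<Rightarrow> 'w measure) \<Rightarrow>
   (nat \<Rightarrow> 'x::topological_space \<Rightarrow> 'a::topological_space set) \<Rightarrow>
   (nat \<Rightarrow> 'x \<Rightarrow> 'a \<Rightarrow> 'x measure) \<Rightarrow> 'x measure \<Rightarrow>
   (nat \<Rightarrow> 'w \<Rightarrow> 'x) \<Rightarrow> (nat \<Rightarrow> 'w \<Rightarrow> 'a) \<Rightarrow> bool" where
  "controlled_process M F G \<A> P \<xi> X A \<longleftrightarrow>
     (\<forall>t\<ge>1. X t \<in> F t \<rightarrow>\<^sub>M borel) \<and>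
     (\<forall>t\<ge>1. A t \<in> G t \<rightarrow>\<^sub>M borel) \<and>
     distr M borel (X 1) = \<xi> \<and>
     (\<forall>t\<ge>1. \<forall>B\<in>sets borel. AE \<omega> in M.
        cond_probability M (G t) {\<omega>'\<in>space M. X (Suc t) \<omega>' \<in> B} \<omega>
          = measure (P t (X t \<omega>) (A t \<omega>)) B) \<and>
     (AE \<omega> in M. \<forall>t\<ge>1. A t \<omega> \<in> \<A> t (X t \<omega>))"

definition follows_policy ::
  "'w measure \<Rightarrow> (nat \<Rightarrow> 'w measure) \<Rightarrow> (nat \<Rightarrow> 'w measure) \<Rightarrow>
   (nat \<Rightarrow> 'x::topological_space \<Rightarrow> 'a::topological_space measure) \<Rightarrow>
   (nat \<Rightarrow> 'w \<Rightarrow> 'x) \<Rightarrow> (nat \<Rightarrow> 'w \<Rightarrow> 'a) \<Rightarrow> bool" where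
  "follows_policy M F G p X A \<longleftrightarrow>
     (\<forall>t\<ge>1. \<forall>B\<in>sets borel. AE \<omega> in M.
        cond_probability M (joint_filtration F G t) {\<omega>'\<in>space M. A t \<omega>' \<in> B} \<omega>
          = cond_probability M (vimage_algebra (space M) (X t) borel) {\<omega>'\<in>space M. A t \<omega>' \<in> B} \<omega> \<and>
        cond_probability M (vimage_algebra (space M) (X t) borel) {\<omega>'\<in>space M. A t \<omega>' \<in> B} \<omega>
          = measure (p t (X t \<omega>)) B)"

text \<open>With \<open>C 0 = 0\<close> the entry at \<open>t = 0\<close> vanishes whatever the unused \<open>X 0\<close> and \<open>A 0\<close> are.\<close>

definition cost_process ::
  "(nat \<Rightarrow> 'x \<Rightarrow> 'a \<Rightarrow> 'x \<Rightarrow> real) \<Rightarrow> (nat \<Rightarrow> 'w \<Rightarrow> 'x) \<Rightarrow> (nat \<Rightarrow> 'w \<Rightarrow> 'a) \<Rightarrow> nat \<Rightarrow> 'w \<Rightarrow> real" where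
  "cost_process C X A t \<omega> = C t (X t \<omega>) (A t \<omega>) (X (Suc t) \<omega>)"

end

theory Submission
  imports Defs
begin

text \<open>
  Markov policies suffice because the problem with a finite horizon can be solved by dynamic
  programming, and because discounting makes the horizon irrelevant up to an arbitrarily small
  error.

  Fix a horizon \<open>T\<close>. Going backwards in time, the value at a state is the least stage risk over all
  laws of the action at that state, where the stage risk evaluates the current cost plus the
  discounted value at the successor. For an arbitrary controlled process, the action has a
  conditional law given the information at time \<open>t\<close>, and this law is one of the competitors in the
  minimisation; by monotonicity of the risk measures the risk to go is at least the value at the
  current state (\<open>risk_to_go_ge_val\<close>). A process that follows a minimising Markov policy attains
  the value (\<open>risk_to_go_le_val\<close>). The value at time 1 is a function of the initial state, whose
  law is the same for all processes, so the Markov policy is optimal for the horizon \<open>T\<close>. The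
  minimising policy changes with \<open>T\<close>, but by normalisation and translation invariance the total
  risks for the horizons \<open>T\<close> and infinity differ by at most a constant times \<open>\<gamma> ^ T\<close>
  (\<open>total_risk_truncation\<close>), for every process. Letting \<open>T\<close> grow proves the inequality.

  Two points need work. The first is the existence of minimisers that depend measurably on the
  state. The laws on a compact set of actions form a sequentially compact set for the weak topology
  (\<open>prob_on_compact_weak_compact\<close>). The stage risk is lower semicontinuous jointly in the state and
  the law of the action, although the law of a lower semicontinuous cost is not continuous: limits
  of such laws are stochastically larger than the law at the limit (\<open>stage_risk_lsc\<close>). A measurable
  minimiser is found by minimising in turn a sequence of further criteria that determine the law,
  each successive minimum being a Borel function because of compactness
  (\<open>lexicographic_minimal_selection\<close>). The minimisation ranges over laws and not only over
  single actions, since the risk of a mixture of two laws may be below both of their risks.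

  The second point is conditional laws. They are constructed for bounded real variables from
  conditional probabilities of rays (\<open>regular_cond_law_exists\<close>), and for actions by coding the
  compact action space into the real line. Freezing the known variables (\<open>cond_law_freeze\<close>)
  computes the conditional law of the stage cost from that of the action and the transition kernel
  (\<open>cond_law_two_stage\<close>), and an almost sure inequality between random variables becomes a
  stochastic ordering of conditional laws (\<open>cond_law_stochastic_order\<close>).
\<close>

section \<open>Compact sets coded by real numbers\<close>

text \<open>
  The first digit in which two expansions differ contributes a power of 1/3, and the later digits
  together at most half of that power.
\<close>

lemma ternary_digits_eq_if_close:
  fixes d e :: "nat \<Rightarrow> real"
  assumes d: "\<And>n. d n \<in> {0, 1}" and e: "\<And>n. e n \<in> {0, 1}"
    and close: "\<bar>(\<Sum>n. d n * (1/3) ^ n) - (\<Sum>n. e n * (1/3) ^ n)\<bar> < (1/3) ^ m / 2"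
    and "n \<le> m"
  shows "d n = e n"
proof (rule ccontr)
  assume "d n \<noteq> e n"
  define k where "k = (LEAST n. d n \<noteq> e n)"
  have k: "d k \<noteq> e k" and lt: "\<And>i. i < k \<Longrightarrow> d i = e i"
    using \<open>d n \<noteq> e n\<close> LeastI[of "\<lambda>n. d n \<noteq> e n"] not_less_Least unfolding k_def by auto
  have "k \<le> m"
    using Least_le[of "\<lambda>n. d n \<noteq> e n", OF \<open>d n \<noteq> e n\<close>] \<open>n \<le> m\<close> unfolding k_def by simp
  define u where "u n = (d n - e n) * (1/3) ^ n" for n
  have b: "\<bar>d n - e n\<bar> \<le> 1" for n
    using d[of n] e[of n] by auto
  have geo: "summable (\<lambda>n. (1/3::real) ^ n)"
    by (rule summable_geometric) simp
  have sd: "summable (\<lambda>n. d n * (1/3) ^ n)" and se: "summable (\<lambda>n. e n * (1/3) ^ n)"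
    using d e by (auto intro!: summable_comparison_test'[OF geo, of 0] simp: abs_mult)
      (metis abs_1 abs_zero insertE mult_left_le_one_le order_refl singletonD zero_le_one
        abs_ge_zero mult.commute mult_cancel_right2 mult_zero_left power_one_over zero_le_divide_1_iff
        zero_le_numeral zero_le_power divide_nonneg_nonneg)+
  have su: "summable u" unfolding u_def left_diff_distrib by (intro summable_diff sd se)
  have eq: "(\<Sum>n. d n * (1/3) ^ n) - (\<Sum>n. e n * (1/3) ^ n) = (\<Sum>n. u n)"
    unfolding u_def left_diff_distrib by (rule suminf_diff[OF sd se])
  have "(\<Sum>n. u n) = (\<Sum>n. u (n + Suc k)) + (\<Sum>n<Suc k. u n)"
    by (rule suminf_split_initial_segment[OF su])
  also have "(\<Sum>n<Suc k. u n) = u k" using lt by (simp add: u_def)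
  finally have sp: "(\<Sum>n. u n) = (\<Sum>n. u (n + Suc k)) + u k" .
  have "\<bar>\<Sum>n. u (n + Suc k)\<bar> \<le> (\<Sum>n. (1/3) ^ Suc k * (1/3) ^ n)"
  proof -
    have le: "norm (u (n + Suc k)) \<le> (1/3) ^ Suc k * (1/3) ^ n" for n
      using mult_right_mono[OF b[of "n + Suc k"], of "(1/3) ^ (n + Suc k)"]
      by (simp add: u_def abs_mult power_add mult_ac)
    have "summable (\<lambda>n. norm (u (n + Suc k)))"
      by (rule summable_comparison_test'[of "\<lambda>n. (1/3) ^ Suc k * (1/3) ^ n" 0])
         (use le summable_mult[OF geo] in auto)
    then have "norm (\<Sum>n. u (n + Suc k)) \<le> (\<Sum>n. norm (u (n + Suc k)))" by (rule summable_norm)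
    also have "\<dots> \<le> (\<Sum>n. (1/3) ^ Suc k * (1/3) ^ n)"
      using le \<open>summable (\<lambda>n. norm (u (n + Suc k)))\<close> summable_mult[OF geo] by (intro suminf_le) auto
    finally show ?thesis by simp
  qed
  also have "\<dots> = (1/3) ^ k / 2"
    using suminf_mult[OF geo, of "(1/3) ^ Suc k"] suminf_geometric[of "1/3::real"] by simp
  finally have tail: "\<bar>\<Sum>n. u (n + Suc k)\<bar> \<le> (1/3) ^ k / 2" .
  have "\<bar>u k\<bar> = (1/3) ^ k"
    using k d[of k] e[of k] by (auto simp: u_def abs_mult)
  then have "\<bar>\<Sum>n. u n\<bar> \<ge> (1/3) ^ k / 2" using sp tail by linarith
  moreover have "(1/3::real) ^ m \<le> (1/3) ^ k" using \<open>k \<le> m\<close> by (intro power_decreasing) auto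
  ultimately show False using close eq by linarith
qed

text \<open>
  The digits of \<open>s a\<close> record to which balls of a countable family \<open>a\<close> belongs. Finitely many
  balls of small radius cover \<open>K\<close>, so finitely many digits locate a point of \<open>K\<close> up to a given
  error: the inverse of \<open>s\<close> is uniformly continuous and extends to the closure of the set of
  codes. Only this inverse has to be continuous; \<open>s\<close> itself is merely Borel.
\<close>

lemma compact_coded_by_reals:
  fixes K :: "'a::polish_space set"
  assumes "compact K" "K \<noteq> {}"
  obtains s :: "'a \<Rightarrow> real" and S h where
    "s \<in> borel_measurable borel" "h \<in> borel_measurable borel" "closed S" "S \<subseteq> {0..2}"
    "continuous_on S h" "\<And>y. h y \<in> K"
    "\<And>a. a \<in> K \<Longrightarrow> s a \<in> S" "\<And>a. a \<in> K \<Longrightarrow> h (s a) = a"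
proof -
  obtain D :: "'a set" where D: "countable D" "\<And>X. open X \<Longrightarrow> X \<noteq> {} \<Longrightarrow> \<exists>d\<in>D. d \<in> X"
    using countable_dense_exists by blast
  define \<B> where "\<B> = (\<lambda>(d, n). ball d (1 / real (Suc n))) ` (D \<times> UNIV)"
  have "countable \<B>" unfolding \<B>_def using D(1) by auto
  have "D \<noteq> {}" using D(2)[of UNIV] by auto
  then have "\<B> \<noteq> {}" by (auto simp: \<B>_def)
  define B where "B = from_nat_into \<B>"
  have rB: "range B = \<B>" unfolding B_def using \<open>countable \<B>\<close> \<open>\<B> \<noteq> {}\<close> by simp
  have oB: "open (B n)" for n
  proof -
    have "B n \<in> \<B>" using rB by auto
    then show ?thesis by (auto simp: \<B>_def)
  qed
  define s where "s a = (\<Sum>n. indicator (B n) a * (1/3) ^ n :: real)" for a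
  have meas: "s \<in> borel_measurable borel"
  proof -
    have [measurable]: "B n \<in> sets borel" for n using oB by simp
    show ?thesis unfolding s_def by measurable
  qed
  have geo: "summable (\<lambda>n. (1/3::real) ^ n)" by (rule summable_geometric) simp
  have range_s: "s a \<in> {0..2}" for a
  proof -
    have sm: "summable (\<lambda>n. indicator (B n) a * (1/3) ^ n :: real)"
      by (rule summable_comparison_test'[OF geo, of 0]) (auto simp: indicator_def)
    have "s a \<le> (\<Sum>n. (1/3::real) ^ n)"
      unfolding s_def by (intro suminf_le sm geo) (auto simp: indicator_def)
    then have "s a \<le> 2" using suminf_geometric[of "1/3::real"] by simp
    moreover have "0 \<le> s a" unfolding s_def by (intro suminf_nonneg sm) auto
    ultimately show ?thesis by simp
  qed
  have unif: "\<exists>\<delta>>0. \<forall>a\<in>K. \<forall>a'\<in>K. \<bar>s a - s a'\<bar> < \<delta> \<longrightarrow> dist a a' < \<epsilon>" if "\<epsilon> > 0" for \<epsilon>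
  proof -
    have "0 < \<epsilon> / 2" using that by simp
    then obtain m where m: "1 / real (Suc m) < \<epsilon> / 2" by (rule nat_approx_posE)
    let ?N = "{n. \<exists>d. B n = ball d (1 / real (Suc m))}"
    have "K \<subseteq> (\<Union>n\<in>?N. B n)"
    proof
      fix a assume "a \<in> K"
      obtain d where d: "d \<in> D" "d \<in> ball a (1 / real (Suc m))" using D(2)[of "ball a (1 / real (Suc m))"] by auto
      then have "ball d (1 / real (Suc m)) \<in> \<B>" by (auto simp: \<B>_def)
      then obtain n where n: "B n = ball d (1 / real (Suc m))" using rB by (metis imageE)
      then have "n \<in> ?N" by (intro CollectI exI[of _ d])
      moreover have "a \<in> B n" using n d(2) by (simp add: mem_ball dist_commute)
      ultimately show "a \<in> (\<Union>n\<in>?N. B n)" by (rule UN_I)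
    qed
    then obtain N where N: "N \<subseteq> ?N" "finite N" "K \<subseteq> (\<Union>n\<in>N. B n)"
      by (rule compactE_image[OF \<open>compact K\<close> oB])
    define p where "p = Max (insert 0 N)"
    show ?thesis
    proof (intro exI[of _ "(1/3) ^ p / 2"] conjI ballI impI)
      fix a a' assume a: "a \<in> K" "a' \<in> K" "\<bar>s a - s a'\<bar> < (1/3) ^ p / 2"
      obtain n where n: "n \<in> N" "a \<in> B n" using N(3) a(1) by auto
      then have "n \<le> p" unfolding p_def using N(2) by auto
      then have "(indicator (B n) a::real) = indicator (B n) a'"
        by (intro ternary_digits_eq_if_close[of "\<lambda>n. indicator (B n) a" "\<lambda>n. indicator (B n) a'" p])
           (use a(3) in \<open>auto simp: s_def indicator_def\<close>)
      then have "a' \<in> B n" using n(2) by (auto simp: indicator_def split: if_splits)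
      moreover obtain d where "B n = ball d (1 / real (Suc m))" using n(1) N(1) by auto
      ultimately have "dist d a < \<epsilon> / 2" "dist d a' < \<epsilon> / 2" using n(2) m by auto
      then show "dist a a' < \<epsilon>" by (rule dist_triangle_half_r)
    qed simp
  qed
  have inj: "inj_on s K"
  proof (rule inj_onI)
    fix a a' assume a: "a \<in> K" "a' \<in> K" "s a = s a'"
    show "a = a'"
    proof (rule ccontr)
      assume "a \<noteq> a'"
      then obtain \<delta> where "\<delta> > 0" and H: "\<forall>a1\<in>K. \<forall>a2\<in>K. \<bar>s a1 - s a2\<bar> < \<delta> \<longrightarrow> dist a1 a2 < dist a a'"
        using unif[of "dist a a'"] by auto
      have "dist a a' < dist a a'" by (rule H[rule_format]) (use a \<open>\<delta> > 0\<close> in auto)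
      then show False by simp
    qed
  qed
  define d where "d = inv_into K s"
  have d: "d (s a) = a" if "a \<in> K" for a using that inj by (simp add: d_def)
  have "uniformly_continuous_on (s ` K) d"
    unfolding uniformly_continuous_on_def
  proof (intro allI impI)
    fix \<epsilon> :: real assume "\<epsilon> > 0"
    from unif[OF this] show "\<exists>\<delta>>0. \<forall>x\<in>s ` K. \<forall>x'\<in>s ` K. dist x' x < \<delta> \<longrightarrow> dist (d x') (d x) < \<epsilon>"
      by (auto simp: d dist_real_def)
  qed
  then obtain g where g: "uniformly_continuous_on (closure (s ` K)) g" "\<And>x. x \<in> s ` K \<Longrightarrow> d x = g x"
    using uniformly_continuous_on_extension_on_closure by metis
  have cont: "continuous_on (closure (s ` K)) g" using g(1) by (rule uniformly_continuous_imp_continuous)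
  then have gK: "g ` closure (s ` K) \<subseteq> K"
    by (rule image_closure_subset)
       (use compact_imp_closed[OF \<open>compact K\<close>] g(2) d in \<open>auto simp: image_subset_iff\<close>)
  obtain k where "k \<in> K" using \<open>K \<noteq> {}\<close> by auto
  define h where "h y = (if y \<in> closure (s ` K) then g y else k)" for y
  have code: "s a \<in> closure (s ` K)" if "a \<in> K" for a
    by (rule subsetD[OF closure_subset]) (rule imageI[OF that])
  show thesis
  proof (rule that[of s h "closure (s ` K)"])
    show "h \<in> borel_measurable borel"
      unfolding h_def
      by (rule borel_measurable_continuous_on_if[OF borel_closed[OF closed_closure] cont continuous_on_const])
    show "continuous_on (closure (s ` K)) h"
      by (rule continuous_on_eq[OF cont]) (simp add: h_def)
    show "h y \<in> K" for y using gK \<open>k \<in> K\<close> by (auto simp: h_def)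
    show "closure (s ` K) \<subseteq> {0..2}" by (rule closure_minimal) (use range_s in auto)
    show "h (s a) = a" if "a \<in> K" for a
      using g(2)[OF imageI[OF that, of s]] d[OF that] code[OF that] by (simp add: h_def)
  qed (use meas code in auto)
qed

section \<open>Weak convergence on compact sets\<close>

lemma prob_onD:
  assumes "\<mu> \<in> prob_on S"
  shows "prob_space \<mu>" "sets \<mu> = sets borel" "space \<mu> = UNIV"
  using assms sets_eq_imp_space_eq[of \<mu> borel] by (auto simp: prob_on_def)

lemma prob_on_real_distribution: "\<mu> \<in> prob_on S \<Longrightarrow> real_distribution \<mu>"
  using prob_onD[of \<mu> S] by (simp add: real_distribution_def real_distribution_axioms_def)

lemma prob_on_UNIV_iff: "\<mu> \<in> prob_on UNIV \<longleftrightarrow> prob_space \<mu> \<and> sets \<mu> = sets borel"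
  using prob_space.emeasure_space_1[of \<mu>] sets_eq_imp_space_eq[of \<mu> borel]
  by (auto simp: prob_on_def)

lemma space_prob_algebra_borel: "space (prob_algebra borel) = prob_on UNIV"
  by (auto simp: space_prob_algebra prob_on_UNIV_iff)

lemma prob_on_AE:
  assumes "\<mu> \<in> prob_on S"
  shows "AE x in \<mu>. x \<in> S"
  using assms prob_space.AE_prob_1[of \<mu> S] by (auto simp: prob_on_def measure_def)

lemma prob_onI_AE:
  assumes "\<mu> \<in> prob_on UNIV" "S \<in> sets borel" "AE x in \<mu>. x \<in> S"
  shows "\<mu> \<in> prob_on S"
  using prob_space.emeasure_eq_1_AE[OF prob_onD(1)[OF assms(1)], of S] assms(2,3) prob_onD(1,2)[OF assms(1)]
  by (simp add: prob_on_def)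

lemma prob_on_subset_UNIV: "\<mu> \<in> prob_on S \<Longrightarrow> \<mu> \<in> prob_on UNIV"
  by (auto simp: prob_on_UNIV_iff prob_onD)

lemma prob_on_mono:
  assumes "\<mu> \<in> prob_on S" "S \<subseteq> T" "T \<in> sets borel"
  shows "\<mu> \<in> prob_on T"
proof (rule prob_onI_AE[OF prob_on_subset_UNIV[OF assms(1)] assms(3)])
  show "AE x in \<mu>. x \<in> T" using prob_on_AE[OF assms(1)] by eventually_elim (use assms(2) in auto)
qed

lemma bounded_contD:
  assumes "f \<in> bounded_cont"
  shows "f \<in> borel_measurable borel" "\<exists>c\<ge>0. \<forall>x. \<bar>f x\<bar> \<le> c" "continuous_on UNIV f"
proof -
  show "f \<in> borel_measurable borel" "continuous_on UNIV f"
    using assms by (auto simp: bounded_cont_def intro: borel_measurable_continuous_onI)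
  obtain c where "\<forall>x. \<bar>f x\<bar> \<le> c" using assms by (auto simp: bounded_cont_def bounded_iff)
  then show "\<exists>c\<ge>0. \<forall>x. \<bar>f x\<bar> \<le> c" by (intro exI[of _ "max c 0"]) (auto simp: le_max_iff_disj)
qed

lemma bounded_contI:
  "continuous_on UNIV f \<Longrightarrow> (\<And>x. \<bar>f x\<bar> \<le> c) \<Longrightarrow> f \<in> bounded_cont"
  by (auto simp: bounded_cont_def bounded_iff)

lemma integrable_bounded_prob_on:
  fixes f :: "'a::topological_space \<Rightarrow> real"
  assumes "\<mu> \<in> prob_on UNIV" "f \<in> borel_measurable borel" "\<And>x. \<bar>f x\<bar> \<le> c"
  shows "integrable \<mu> f"
proof -
  interpret prob_space \<mu> using assms(1) prob_onD by auto
  show ?thesis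
    using assms(2,3) prob_onD(2)[OF assms(1)]
    by (intro integrable_const_bound[of _ c]) (auto cong: measurable_cong_sets)
qed

text \<open>
  The distance to \<open>S\<close> is a continuous function whose integrals vanish along the sequence, hence
  also at the limit.
\<close>

lemma weak_limit_on_closed:
  fixes S :: "'a::metric_space set"
  assumes "closed S" and \<mu>: "\<mu> \<in> prob_on UNIV" and ev: "\<forall>\<^sub>F n in sequentially. \<mu>s n \<in> prob_on S"
    and lim: "weakly_converges \<mu>s \<mu>"
  shows "\<mu> \<in> prob_on S"
proof -
  have "S \<noteq> {}" using ev by (auto simp: prob_on_def dest: eventually_happens)
  define f where "f x = min 1 (infdist x S)" for x
  have fb: "f \<in> bounded_cont"
    unfolding f_def by (intro bounded_contI[of _ 1] continuous_intros) (auto simp: infdist_nonneg)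
  note [measurable] = bounded_contD(1)[OF fb]
  have "\<forall>\<^sub>F n in sequentially. (\<integral>x. f x \<partial>\<mu>s n) = 0"
  proof (rule eventually_mono[OF ev])
    fix n assume n: "\<mu>s n \<in> prob_on S"
    then have "AE x in \<mu>s n. x \<in> S" by (rule prob_on_AE)
    then have "AE x in \<mu>s n. f x = 0" by eventually_elim (simp add: f_def)
    then show "(\<integral>x. f x \<partial>\<mu>s n) = 0" by (rule integral_eq_zero_AE)
  qed
  then have "(\<lambda>n. \<integral>x. f x \<partial>\<mu>s n) \<longlonglongrightarrow> 0" by (rule tendsto_eventually)
  moreover have "(\<lambda>n. \<integral>x. f x \<partial>\<mu>s n) \<longlonglongrightarrow> (\<integral>x. f x \<partial>\<mu>)"
    using lim fb by (auto simp: weakly_converges_def)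
  ultimately have "(\<integral>x. f x \<partial>\<mu>) = 0" using LIMSEQ_unique by blast
  moreover have "integrable \<mu> f"
    by (rule integrable_bounded_prob_on[OF \<mu>, of _ 1]) (auto simp: f_def infdist_nonneg)
  ultimately have "AE x in \<mu>. f x = 0"
    by (subst (asm) integral_nonneg_eq_0_iff_AE) (auto simp: f_def infdist_nonneg)
  then have "AE x in \<mu>. x \<in> S"
    by eventually_elim
      (use \<open>closed S\<close> \<open>S \<noteq> {}\<close> in \<open>auto simp: f_def in_closed_iff_infdist_zero min_def split: if_splits\<close>)
  then show ?thesis by (rule prob_onI_AE[OF \<mu> borel_closed[OF \<open>closed S\<close>]])
qed

lemma bounded_interval_weak_compact:
  fixes \<mu>s :: "nat \<Rightarrow> real measure"
  assumes \<mu>s: "\<And>n. \<mu>s n \<in> prob_on {-c..c}"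
  obtains r \<mu> where "strict_mono (r::nat \<Rightarrow> nat)" "\<mu> \<in> prob_on UNIV" "weakly_converges (\<mu>s \<circ> r) \<mu>"
proof -
  have rd: "real_distribution (\<mu>s n)" for n using \<mu>s by (rule prob_on_real_distribution)
  have one: "measure (\<mu>s n) {-\<bar>c\<bar> - 1<..\<bar>c\<bar> + 1} = 1" for n
  proof -
    have "\<mu>s n \<in> prob_on {-\<bar>c\<bar> - 1<..\<bar>c\<bar> + 1}"
      by (rule prob_on_mono[OF \<mu>s]) auto
    then show ?thesis by (simp add: prob_on_def measure_def)
  qed
  have "tight \<mu>s"
    unfolding tight_def
  proof (intro conjI allI impI rd)
    fix \<epsilon> :: real assume "\<epsilon> > 0"
    then show "\<exists>a b. a < b \<and> (\<forall>n. 1 - \<epsilon> < measure (\<mu>s n) {a<..b})"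
      using one by (intro exI[of _ "-\<bar>c\<bar> - 1"] exI[of _ "\<bar>c\<bar> + 1"]) auto
  qed
  then obtain r M where r: "strict_mono (r::nat \<Rightarrow> nat)" "real_distribution M"
      "weak_conv_m (\<mu>s \<circ> id \<circ> r) M"
    using tight_imp_convergent_subsubsequence[of \<mu>s id] by (auto simp: strict_mono_id)
  interpret M: real_distribution M by fact
  have "weakly_converges (\<mu>s \<circ> r) M"
    unfolding weakly_converges_def
  proof
    fix f :: "real \<Rightarrow> real" assume f: "f \<in> bounded_cont"
    then obtain B where "\<And>x. norm (f x) \<le> B" using bounded_contD(2)[OF f] by auto
    with f rd r show "(\<lambda>n. \<integral>x. f x \<partial>(\<mu>s \<circ> r) n) \<longlonglongrightarrow> (\<integral>x. f x \<partial>M)"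
      by (intro weak_conv_imp_integral_bdd_continuous_conv[of "\<mu>s \<circ> r" M f B])
         (auto simp: bounded_cont_def continuous_on_eq_continuous_at)
  qed
  moreover have "M \<in> prob_on UNIV"
    using M.prob_space_axioms by (simp add: prob_on_UNIV_iff)
  ultimately show thesis using that r(1) by blast
qed

text \<open>
  Sequential compactness for the weak topology is pulled back from the real line: the code
  \<open>s\<close> carries the measures to a bounded interval, Helly's theorem provides the limit there, and
  continuity of the decoding map \<open>h\<close> carries the limit back.
\<close>

lemma prob_on_compact_weak_compact:
  fixes K :: "'a::polish_space set"
  assumes "compact K" and \<mu>s: "\<And>n. \<mu>s n \<in> prob_on K"
  obtains r \<mu> where "strict_mono (r::nat \<Rightarrow> nat)" "\<mu> \<in> prob_on K" "weakly_converges (\<mu>s \<circ> r) \<mu>"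
proof -
  have "K \<noteq> {}" using \<mu>s[of 0] by (auto simp: prob_on_def)
  then obtain s :: "'a \<Rightarrow> real" and S h where s[measurable]: "s \<in> borel_measurable borel"
    and h[measurable]: "h \<in> borel_measurable borel" and S: "closed S" "S \<subseteq> {0..2}"
    and h_cont: "continuous_on S h" and hK: "\<And>y. h y \<in> K"
    and sK: "\<And>a. a \<in> K \<Longrightarrow> s a \<in> S" and hs: "\<And>a. a \<in> K \<Longrightarrow> h (s a) = a"
    using compact_coded_by_reals[OF \<open>compact K\<close>] by metis
  have K[measurable]: "K \<in> sets borel" using \<open>compact K\<close> by (simp add: compact_imp_closed borel_closed)
  have S_borel[measurable]: "S \<in> sets borel" using S by simp
  define \<nu>s where "\<nu>s n = distr (\<mu>s n) borel s" for n
  have AE_K: "AE a in \<mu>s n. a \<in> K" for n using \<mu>s[of n] by (rule prob_on_AE)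
  have ms: "measurable (\<mu>s n) borel = measurable borel borel" for n
    using prob_onD[OF \<mu>s[of n]] by (simp cong: measurable_cong_sets)
  have \<nu>s: "\<nu>s n \<in> prob_on S" for n
  proof -
    interpret prob_space "\<mu>s n" using prob_onD[OF \<mu>s[of n]] by simp
    have "\<nu>s n \<in> prob_on UNIV"
      unfolding prob_on_UNIV_iff \<nu>s_def using s by (auto intro!: prob_space_distr simp: ms)
    moreover have "AE y in \<nu>s n. y \<in> S"
      unfolding \<nu>s_def using AE_K[of n] sK by (subst AE_distr_iff) (auto simp: ms)
    ultimately show ?thesis using prob_onI_AE[OF _ S_borel] by blast
  qed
  then have "\<nu>s n \<in> prob_on {-2..2}" for n
    using S(2) by (intro prob_on_mono[OF \<nu>s]) force+
  then obtain r \<nu> where r: "strict_mono (r::nat \<Rightarrow> nat)" and \<nu>: "\<nu> \<in> prob_on UNIV"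
    and lim: "weakly_converges (\<nu>s \<circ> r) \<nu>"
    using bounded_interval_weak_compact[of \<nu>s 2] by metis
  have \<nu>S: "\<nu> \<in> prob_on S"
    using \<nu>s by (intro weak_limit_on_closed[OF S(1) \<nu> _ lim]) simp
  then have AE_S: "AE y in \<nu>. y \<in> S" by (rule prob_on_AE)
  have m\<nu>: "measurable \<nu> borel = measurable borel borel"
    using prob_onD[OF \<nu>] by (simp cong: measurable_cong_sets)
  interpret \<nu>: prob_space \<nu> using prob_onD[OF \<nu>] by simp
  define \<mu> where "\<mu> = distr \<nu> borel h"
  have "\<mu> \<in> prob_on K"
  proof -
    have "\<mu> \<in> prob_on UNIV"
      unfolding prob_on_UNIV_iff \<mu>_def using h by (auto intro!: \<nu>.prob_space_distr simp: m\<nu>)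
    moreover have "AE a in \<mu>. a \<in> K"
      unfolding \<mu>_def using hK by (subst AE_distr_iff) (auto simp: m\<nu>)
    ultimately show ?thesis using prob_onI_AE[OF _ K] by blast
  qed
  moreover have "weakly_converges (\<mu>s \<circ> r) \<mu>"
    unfolding weakly_converges_def
  proof
    fix f :: "'a \<Rightarrow> real" assume f: "f \<in> bounded_cont"
    then obtain B where B: "B \<ge> 0" "\<And>x. norm (f x) \<le> B" using bounded_contD(2)[OF f] by auto
    note [measurable] = bounded_contD(1)[OF f]
    have "continuous_on S (f \<circ> h)"
      by (rule continuous_on_compose[OF h_cont continuous_on_subset[OF bounded_contD(3)[OF f]]]) simp
    then obtain F where F: "continuous_on UNIV F" "\<And>y. y \<in> S \<Longrightarrow> F y = (f \<circ> h) y"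
      "\<And>y. y \<in> UNIV \<Longrightarrow> norm (F y) \<le> B"
      using Tietze[of S "f \<circ> h" UNIV B] S(1) B by auto
    have Fb: "F \<in> bounded_cont" using F(1,3) by (intro bounded_contI[of _ B]) auto
    note [measurable] = bounded_contD(1)[OF Fb]
    have "(\<integral>x. f x \<partial>\<mu>s n) = (\<integral>y. F y \<partial>\<nu>s n)" for n
    proof -
      have "(\<integral>y. F y \<partial>\<nu>s n) = (\<integral>a. F (s a) \<partial>\<mu>s n)"
        unfolding \<nu>s_def by (rule integral_distr) (auto simp: ms)
      also have "\<dots> = (\<integral>x. f x \<partial>\<mu>s n)"
        using AE_K[of n] by (intro integral_cong_AE) (auto simp: ms F(2) sK hs)
      finally show ?thesis ..
    qed
    moreover have "(\<integral>x. f x \<partial>\<mu>) = (\<integral>y. F y \<partial>\<nu>)"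
    proof -
      have "(\<integral>x. f x \<partial>\<mu>) = (\<integral>y. f (h y) \<partial>\<nu>)"
        unfolding \<mu>_def by (rule integral_distr) (auto simp: m\<nu>)
      also have "\<dots> = (\<integral>y. F y \<partial>\<nu>)"
      proof (rule integral_cong_AE)
        have "(\<lambda>y. f (h y)) \<in> borel_measurable borel" by measurable
        then show "(\<lambda>y. f (h y)) \<in> borel_measurable \<nu>" "F \<in> borel_measurable \<nu>" by (simp_all add: m\<nu>)
        show "AE y in \<nu>. f (h y) = F y" using AE_S by eventually_elim (simp add: F(2))
      qed
      finally show ?thesis .
    qed
    ultimately show "(\<lambda>n. \<integral>x. f x \<partial>(\<mu>s \<circ> r) n) \<longlonglongrightarrow> (\<integral>x. f x \<partial>\<mu>)"
      using lim Fb by (auto simp: weakly_converges_def)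
  qed
  ultimately show thesis using that r by blast
qed

section \<open>Kernels and the Borel structure of the weak topology\<close>

text \<open>
  Lipschitz functions increasing to the indicator function of an open set. The whole space is
  treated apart because the distance to the empty set is 0 by convention.
\<close>

definition open_ramp :: "'a::metric_space set \<Rightarrow> nat \<Rightarrow> 'a \<Rightarrow> real" where
  "open_ramp U n x = (if U = UNIV then 1 else min 1 (real n * infdist x (- U)))"

lemma open_ramp_bounds: "0 \<le> open_ramp U n x" "open_ramp U n x \<le> 1"
  by (auto simp: open_ramp_def infdist_nonneg)

lemma open_ramp_bounded_cont: "open_ramp U n \<in> bounded_cont"
proof (rule bounded_contI[of _ 1])
  show "continuous_on UNIV (open_ramp U n)"
    by (cases "U = UNIV") (auto simp: open_ramp_def[abs_def] intro!: continuous_intros)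
  show "\<bar>open_ramp U n x\<bar> \<le> 1" for x using open_ramp_bounds[of U n x] by simp
qed

lemma open_ramp_tendsto_indicator:
  assumes "open U"
  shows "(\<lambda>n. open_ramp U n x) \<longlonglongrightarrow> indicator U x"
proof (cases "x \<in> U \<and> U \<noteq> UNIV")
  case True
  then have "infdist x (- U) > 0"
    using infdist_pos_not_in_closed[of "- U" x] assms by (auto simp: closed_def)
  then obtain N where N: "1 < real N * infdist x (- U)" using reals_Archimedean3 by blast
  have "\<forall>n\<ge>N. open_ramp U n x = 1"
  proof (intro allI impI)
    fix n assume "n \<ge> N"
    then have "real N * infdist x (- U) \<le> real n * infdist x (- U)"
      by (intro mult_right_mono) (auto simp: infdist_nonneg)
    with N True show "open_ramp U n x = 1" by (auto simp: open_ramp_def)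
  qed
  then have "\<forall>\<^sub>F n in sequentially. open_ramp U n x = indicator U x"
    using True by (auto simp: eventually_sequentially)
  then show ?thesis by (rule tendsto_eventually)
next
  case False
  then have "open_ramp U n x = indicator U x" for n
    by (auto simp: open_ramp_def indicator_def)
  then show ?thesis by simp
qed

lemma lebesgue_integral_ramp_tendsto:
  assumes \<mu>: "\<mu> \<in> prob_on UNIV" and "open U"
  shows "(\<lambda>n. \<integral>x. open_ramp U n x \<partial>\<mu>) \<longlonglongrightarrow> measure \<mu> U"
proof -
  interpret prob_space \<mu> using prob_onD[OF \<mu>] by simp
  have m: "measurable \<mu> borel = measurable borel borel"
    using prob_onD[OF \<mu>] by (simp cong: measurable_cong_sets)
  have U: "U \<in> sets \<mu>" using prob_onD[OF \<mu>] \<open>open U\<close> by simp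
  have "(\<lambda>n. \<integral>x. open_ramp U n x \<partial>\<mu>) \<longlonglongrightarrow> (\<integral>x. indicator U x \<partial>\<mu>)"
  proof (rule integral_dominated_convergence[where w="\<lambda>_. 1"])
    show "(indicat_real U) \<in> borel_measurable \<mu>" using U by simp
    show "open_ramp U n \<in> borel_measurable \<mu>" for n
      using bounded_contD(1)[OF open_ramp_bounded_cont] by (simp add: m)
    show "AE x in \<mu>. norm (open_ramp U n x) \<le> 1" for n
      using open_ramp_bounds[of U n] by simp
  qed (use open_ramp_tendsto_indicator[OF \<open>open U\<close>] in auto)
  then show ?thesis using U by simp
qed

text \<open>
  A countable family of continuous functions, the ramps of a countable base closed under finite
  intersections, detects both the equality of two measures and the measurability of a kernel.
\<close>

lemma countable_determining_family:
  obtains f :: "nat \<Rightarrow> 'a::polish_space \<Rightarrow> real" where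
    "\<And>i. f i \<in> bounded_cont" "\<And>i x. \<bar>f i x\<bar> \<le> 1"
    "\<And>\<mu> \<nu>. \<lbrakk>\<mu> \<in> prob_on UNIV; \<nu> \<in> prob_on UNIV; \<And>i. (\<integral>x. f i x \<partial>\<mu>) = (\<integral>x. f i x \<partial>\<nu>)\<rbrakk> \<Longrightarrow> \<mu> = \<nu>"
    "\<And>N (\<kappa>::'w \<Rightarrow> 'a measure). \<lbrakk>\<And>w. w \<in> space N \<Longrightarrow> \<kappa> w \<in> prob_on UNIV;
        \<And>i. (\<lambda>w. \<integral>x. f i x \<partial>\<kappa> w) \<in> borel_measurable N\<rbrakk> \<Longrightarrow> \<kappa> \<in> N \<rightarrow>\<^sub>M prob_algebra borel"
proof -
  obtain \<B> :: "'a set set" where \<B>: "countable \<B>" "topological_basis \<B>" "\<And>X. X \<in> \<B> \<Longrightarrow> open X"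
    using ex_countable_basis topological_basis_open by metis
  define \<U> where "\<U> = insert UNIV (Inter ` {F. finite F \<and> F \<subseteq> \<B> \<and> F \<noteq> {}})"
  have "countable \<U>" unfolding \<U>_def using countable_Collect_finite_subset[OF \<B>(1)]
    by (intro countable_insert countable_image) (auto elim: countable_subset[rotated])
  have op: "open U" if "U \<in> \<U>" for U
    using that \<B>(3) by (auto simp: \<U>_def intro!: open_Inter)
  have Int: "Int_stable \<U>"
  proof (rule Int_stableI)
    fix U V assume UV: "U \<in> \<U>" "V \<in> \<U>"
    consider "U = UNIV" | "V = UNIV" | F F' where "U = \<Inter>F" "V = \<Inter>F'" "finite F" "F \<subseteq> \<B>" "F \<noteq> {}"
        "finite F'" "F' \<subseteq> \<B>" "F' \<noteq> {}"
      using UV by (auto simp: \<U>_def)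
    then show "U \<inter> V \<in> \<U>"
    proof cases
      case 3
      then show ?thesis
        by (auto simp: \<U>_def image_iff Inter_Un_distrib intro!: disjI2 exI[of _ "F \<union> F'"])
    qed (use UV in auto)
  qed
  have bor: "sets borel = sigma_sets UNIV \<U>"
  proof -
    have "\<B> \<subseteq> \<U>" by (auto simp: \<U>_def image_iff intro!: exI[of _ "{_}"])
    then have "sets borel \<subseteq> sigma_sets UNIV \<U>"
      by (subst borel_eq_countable_basis[OF \<B>(1,2)]) (simp add: sigma_sets_mono')
    moreover have "sigma_sets UNIV \<U> \<subseteq> sets borel"
    proof -
      have "\<U> \<subseteq> sets borel" using op by auto
      then show ?thesis using sets.sigma_sets_subset[of \<U> borel] by simp
    qed
    ultimately show ?thesis by auto
  qed
  have "UNIV \<in> \<U>" by (simp add: \<U>_def)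
  define u where "u = from_nat_into (\<U> \<times> (UNIV::nat set))"
  have ru: "range u = \<U> \<times> UNIV"
    unfolding u_def using \<open>countable \<U>\<close> \<open>UNIV \<in> \<U>\<close> by (intro range_from_nat_into) auto
  define f where "f i = open_ramp (fst (u i)) (snd (u i))" for i
  have fx: "\<exists>i. f i = open_ramp U n" if "U \<in> \<U>" for U n
  proof -
    have "(U, n) \<in> range u" using ru that by auto
    then obtain i where "u i = (U, n)" by (metis imageE)
    then show ?thesis by (intro exI[of _ i]) (simp add: f_def)
  qed
  show thesis
  proof (rule that[of f])
    show "f i \<in> bounded_cont" for i by (simp add: f_def open_ramp_bounded_cont)
    show "\<bar>f i x\<bar> \<le> 1" for i x using open_ramp_bounds[of "fst (u i)" "snd (u i)" x] by (simp add: f_def)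
  next
    fix \<mu> \<nu> :: "'a measure"
    assume \<mu>: "\<mu> \<in> prob_on UNIV" and \<nu>: "\<nu> \<in> prob_on UNIV"
      and eq: "\<And>i. (\<integral>x. f i x \<partial>\<mu>) = (\<integral>x. f i x \<partial>\<nu>)"
    interpret \<mu>: prob_space \<mu> using prob_onD[OF \<mu>] by simp
    interpret \<nu>: prob_space \<nu> using prob_onD[OF \<nu>] by simp
    show "\<mu> = \<nu>"
    proof (rule measure_eqI_generator_eq[OF Int, of UNIV _ _ "\<lambda>_. UNIV"])
      fix U assume U: "U \<in> \<U>"
      have "(\<lambda>n. \<integral>x. open_ramp U n x \<partial>\<mu>) = (\<lambda>n. \<integral>x. open_ramp U n x \<partial>\<nu>)"
        using fx[OF U] eq by metis
      then have "measure \<mu> U = measure \<nu> U"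
        using lebesgue_integral_ramp_tendsto[OF \<mu> op[OF U]] lebesgue_integral_ramp_tendsto[OF \<nu> op[OF U]]
        by (simp add: LIMSEQ_unique)
      then show "emeasure \<mu> U = emeasure \<nu> U"
        by (simp add: \<mu>.emeasure_eq_measure \<nu>.emeasure_eq_measure)
    qed (use \<open>UNIV \<in> \<U>\<close> bor prob_onD[OF \<mu>] prob_onD[OF \<nu>] in auto)
  next
    fix N and \<kappa> :: "'w \<Rightarrow> 'a measure"
    assume \<kappa>: "\<And>w. w \<in> space N \<Longrightarrow> \<kappa> w \<in> prob_on UNIV"
      and meas: "\<And>i. (\<lambda>w. \<integral>x. f i x \<partial>\<kappa> w) \<in> borel_measurable N"
    show "\<kappa> \<in> N \<rightarrow>\<^sub>M prob_algebra borel"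
    proof (rule measurable_prob_algebra_generated[OF bor Int])
      fix U assume U: "U \<in> \<U>"
      have "(\<lambda>w. measure (\<kappa> w) U) \<in> borel_measurable N"
      proof (rule borel_measurable_LIMSEQ_real)
        show "(\<lambda>n. \<integral>x. open_ramp U n x \<partial>\<kappa> w) \<longlonglongrightarrow> measure (\<kappa> w) U" if "w \<in> space N" for w
          using lebesgue_integral_ramp_tendsto[OF \<kappa>[OF that] op[OF U]] .
        show "(\<lambda>w. \<integral>x. open_ramp U n x \<partial>\<kappa> w) \<in> borel_measurable N" for n
          using fx[OF U, of n] meas by metis
      qed
      moreover have "emeasure (\<kappa> w) U = ennreal (measure (\<kappa> w) U)" if "w \<in> space N" for w
      proof -
        interpret prob_space "\<kappa> w" using prob_onD[OF \<kappa>[OF that]] by simp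
        show ?thesis by (rule emeasure_eq_measure)
      qed
      ultimately show "(\<lambda>w. emeasure (\<kappa> w) U) \<in> borel_measurable N"
        by (simp cong: measurable_cong)
    qed (use prob_onD[OF \<kappa>] in auto)
  qed
qed

lemma topspace_weak_topology: "topspace (weak_topology S) = prob_on S"
proof
  show "topspace (weak_topology S) \<subseteq> prob_on S"
    unfolding weak_topology_def topology_generated_by_topspace by auto
  have "prob_on S = {\<mu> \<in> prob_on S. (\<integral>x. 0 \<partial>\<mu>) \<in> (UNIV::real set)}" by simp
  moreover have "(\<lambda>_. 0) \<in> bounded_cont" by (auto intro: bounded_contI[of _ 0])
  ultimately show "prob_on S \<subseteq> topspace (weak_topology S)"
    unfolding weak_topology_def topology_generated_by_topspace by blast
qed

text \<open>
  The sets with this property contain the subbase and are closed under finite intersections and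
  arbitrary unions.
\<close>

lemma openin_weak_topology_sequentially:
  assumes "openin (weak_topology S) W" "weakly_converges \<mu>s \<mu>" "\<mu> \<in> W" "\<And>n. \<mu>s n \<in> prob_on S"
  shows "\<forall>\<^sub>F n in sequentially. \<mu>s n \<in> W"
proof -
  have "generate_topology_on {{\<mu> \<in> prob_on S. (\<integral>x. f x \<partial>\<mu>) \<in> V} | f V. f \<in> bounded_cont \<and> open V} W"
    using assms(1) by (simp add: weak_topology_def openin_topology_generated_by_iff)
  then show ?thesis using assms(3)
  proof induction
    case (Int a b)
    then show ?case by (auto intro: eventually_conj elim: eventually_elim2)
  next
    case (UN k)
    then obtain U where U: "U \<in> k" "\<mu> \<in> U" by auto
    from UN(2)[OF this] show ?case by eventually_elim (use U in auto)
  next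
    case (Basis s)
    then obtain f V where s: "s = {\<mu> \<in> prob_on S. (\<integral>x. f x \<partial>\<mu>) \<in> V}" "f \<in> bounded_cont" "open V"
      by auto
    then have "(\<lambda>n. \<integral>x. f x \<partial>\<mu>s n) \<longlonglongrightarrow> (\<integral>x. f x \<partial>\<mu>)"
      using assms(2) by (auto simp: weakly_converges_def)
    then have "\<forall>\<^sub>F n in sequentially. (\<integral>x. f x \<partial>\<mu>s n) \<in> V"
      by (rule topological_tendstoD) (use s Basis in auto)
    then show ?case by eventually_elim (use s assms(4) in auto)
  qed simp
qed

text \<open>
  The integrals against a determining family embed the measures on \<open>K\<close> into a space of sequences;
  by compactness this embedding maps weakly closed sets to closed sets, so that a weakly open set
  has a Borel preimage although it may be an uncountable union of subbasic sets.
\<close>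

lemma kernel_measurable_weak_topology:
  fixes K :: "'a::polish_space set"
  assumes "compact K" "K \<subseteq> S" "S \<in> sets borel" and \<kappa>: "\<kappa> \<in> N \<rightarrow>\<^sub>M prob_algebra borel"
    and on: "\<And>w. w \<in> space N \<Longrightarrow> \<kappa> w \<in> prob_on K"
  shows "\<kappa> \<in> N \<rightarrow>\<^sub>M borel_of (weak_topology S)"
proof -
  obtain f :: "nat \<Rightarrow> 'a \<Rightarrow> real" where f: "\<And>i. f i \<in> bounded_cont" and
    det: "\<And>\<mu> \<nu>. \<lbrakk>\<mu> \<in> prob_on UNIV; \<nu> \<in> prob_on UNIV; \<And>i. (\<integral>x. f i x \<partial>\<mu>) = (\<integral>x. f i x \<partial>\<nu>)\<rbrakk> \<Longrightarrow> \<mu> = \<nu>"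
    using countable_determining_family by metis
  define \<Phi> where "\<Phi> \<nu> = (\<lambda>i. \<integral>x. f i x \<partial>\<nu>)" for \<nu>
  have on_S: "\<nu> \<in> prob_on S" if "\<nu> \<in> prob_on K" for \<nu>
    using prob_on_mono[OF that assms(2,3)] .
  have \<Phi>\<kappa>: "(\<lambda>w. \<Phi> (\<kappa> w)) \<in> borel_measurable N"
  proof (rule measurable_coordinatewise_then_product)
    fix i
    note [measurable] = bounded_contD(1)[OF f] measurable_prob_algebraD[OF \<kappa>]
    show "(\<lambda>w. \<Phi> (\<kappa> w) i) \<in> borel_measurable N"
      unfolding \<Phi>_def by (rule measurable_compose[OF measurable_prob_algebraD[OF \<kappa>]
        integral_measurable_subprob_algebra]) simp
  qed
  show ?thesis
    unfolding borel_of_def topspace_weak_topology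
  proof (rule measurable_measure_of)
    show "{V. openin (weak_topology S) V} \<subseteq> Pow (prob_on S)"
      using openin_subset by (auto simp: topspace_weak_topology[symmetric])
    show "\<kappa> \<in> space N \<rightarrow> prob_on S" using on on_S by auto
    fix W assume "W \<in> {V. openin (weak_topology S) V}"
    then have W: "openin (weak_topology S) W" by simp
    have "closed (\<Phi> ` (prob_on K - W))"
      unfolding closed_sequential_limits
    proof (intro allI impI, elim conjE)
      fix ys y assume "\<forall>n::nat. ys n \<in> \<Phi> ` (prob_on K - W)" and y: "ys \<longlonglongrightarrow> y"
      then obtain \<nu>s where \<nu>s: "\<And>n. \<nu>s n \<in> prob_on K" "\<And>n. \<nu>s n \<notin> W" "\<And>n. ys n = \<Phi> (\<nu>s n)"
        by (auto simp: image_iff Bex_def) metis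
      obtain r \<nu> where r: "strict_mono (r::nat \<Rightarrow> nat)" and \<nu>: "\<nu> \<in> prob_on K" and
        lim: "weakly_converges (\<nu>s \<circ> r) \<nu>"
        using prob_on_compact_weak_compact[OF \<open>compact K\<close>, of \<nu>s] \<nu>s(1) by metis
      have "\<nu> \<notin> W"
        using openin_weak_topology_sequentially[OF W lim] \<nu>s(1,2) on_S
        by (auto dest: eventually_happens)
      moreover have "y i = \<Phi> \<nu> i" for i
      proof -
        have "(\<lambda>n. ys n i) \<longlonglongrightarrow> y i"
          by (rule continuous_on_tendsto_compose[OF continuous_on_product_coordinates y]) auto
        then have "((\<lambda>n. ys n i) \<circ> r) \<longlonglongrightarrow> y i" using r by (rule LIMSEQ_subseq_LIMSEQ)
        moreover have "((\<lambda>n. ys n i) \<circ> r) \<longlonglongrightarrow> \<Phi> \<nu> i"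
          using lim f by (auto simp: weakly_converges_def \<nu>s(3) \<Phi>_def o_def)
        ultimately show ?thesis using LIMSEQ_unique by blast
      qed
      ultimately show "y \<in> \<Phi> ` (prob_on K - W)" using \<nu> by (intro image_eqI[of _ _ \<nu>]) auto
    qed
    moreover have "\<kappa> -` W \<inter> space N = (\<lambda>w. \<Phi> (\<kappa> w)) -` (- \<Phi> ` (prob_on K - W)) \<inter> space N"
    proof -
      have "\<mu> = \<nu>" if "\<Phi> \<mu> = \<Phi> \<nu>" "\<mu> \<in> prob_on K" "\<nu> \<in> prob_on K" for \<mu> \<nu>
        using det[OF prob_on_subset_UNIV prob_on_subset_UNIV] that by (auto simp: \<Phi>_def fun_eq_iff)
      then show ?thesis using on by fastforce
    qed
    ultimately show "\<kappa> -` W \<inter> space N \<in> sets N"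
      using measurable_sets[OF \<Phi>\<kappa>, of "- \<Phi> ` (prob_on K - W)"] by auto
  qed
qed

section \<open>Law-invariant risk measures\<close>

lemma return_prob_on: "c \<in> S \<Longrightarrow> S \<in> sets borel \<Longrightarrow> return borel c \<in> prob_on S"
  by (auto simp: prob_on_def prob_space_return)

lemma prob_bddI: "\<mu> \<in> prob_on {-B..B::real} \<Longrightarrow> \<mu> \<in> prob_bdd"
  unfolding prob_bdd_def by (auto intro!: exI[of _ "{-B..B}"])

lemma prob_bdd_interval:
  assumes "\<mu> \<in> prob_bdd"
  obtains B :: real where "\<mu> \<in> prob_on {-B..B}"
proof -
  obtain S where S: "bounded S" "\<mu> \<in> prob_on S" using assms by (auto simp: prob_bdd_def)
  then obtain B where "\<forall>x\<in>S. \<bar>x\<bar> \<le> B" by (auto simp: bounded_iff)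
  then have "S \<subseteq> {-B..B}" by (auto simp: abs_le_iff)
  then show thesis using that prob_on_mono[OF S(2), of "{-B..B}"] by auto
qed

lemma distr_prob_on:
  assumes "\<mu> \<in> prob_on S" "f \<in> borel_measurable borel" "\<And>x. x \<in> S \<Longrightarrow> f x \<in> T" "T \<in> sets borel"
  shows "distr \<mu> borel f \<in> prob_on T"
proof -
  have m: "f \<in> measurable \<mu> borel" using assms(2) prob_onD(2)[OF assms(1)] by (simp cong: measurable_cong_sets)
  interpret prob_space \<mu> using prob_onD[OF assms(1)] by simp
  show ?thesis
  proof (rule prob_onI_AE[OF _ assms(4)])
    show "distr \<mu> borel f \<in> prob_on UNIV" using m by (auto simp: prob_on_UNIV_iff intro: prob_space_distr)
    show "AE x in distr \<mu> borel f. x \<in> T"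
      using prob_on_AE[OF assms(1)] assms(3,4) m
      by (subst AE_distr_iff) (auto elim: eventually_mono)
  qed
qed

lemma convolution_return:
  fixes \<mu> :: "real measure"
  assumes "\<mu> \<in> prob_on UNIV"
  shows "convolution \<mu> (return borel c) = distr \<mu> borel (\<lambda>x. x + c)"
proof (rule measure_eqI)
  interpret prob_space \<mu> using prob_onD[OF assms] by simp
  interpret r: prob_space "return borel c" by (simp add: prob_space_return)
  have [measurable_cong]: "sets \<mu> = sets borel" using prob_onD[OF assms] by simp
  fix A :: "real set" assume "A \<in> sets (convolution \<mu> (return borel c))"
  then have A[measurable]: "A \<in> sets borel" by simp
  have "emeasure (convolution \<mu> (return borel c)) A = (\<integral>\<^sup>+x. \<integral>\<^sup>+y. indicator A (x + y) \<partial>return borel c \<partial>\<mu>)"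
    using nn_integral_convolution[of \<mu> "return borel c" "indicator A"] finite_measure_axioms
      r.finite_measure_axioms prob_onD[OF assms] by simp
  also have "\<dots> = (\<integral>\<^sup>+x. indicator A (x + c) \<partial>\<mu>)"
    by (subst nn_integral_return) auto
  also have "\<dots> = emeasure (distr \<mu> borel (\<lambda>x. x + c)) A"
    by (subst nn_integral_distr[of _ _ borel "indicator A", symmetric]) auto
  finally show "emeasure (convolution \<mu> (return borel c)) A = emeasure (distr \<mu> borel (\<lambda>x. x + c)) A" .
qed simp

lemma measure_shift_atMost:
  assumes "\<mu> \<in> prob_on UNIV"
  shows "measure (distr \<mu> borel (\<lambda>x. x + c)) {..r} = measure \<mu> {..r - (c::real)}"
proof -
  have [measurable_cong]: "sets \<mu> = sets borel" using prob_onD[OF assms] by simp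
  have "(\<lambda>x. x + c) -` {..r} \<inter> space \<mu> = {..r - c}" using prob_onD[OF assms] by auto
  then show ?thesis by (subst measure_distr) auto
qed

context
  fixes \<sigma> :: "real measure \<Rightarrow> ereal"
  assumes \<sigma>: "risk_measure \<sigma>"
begin

lemma risk_mono:
  assumes "\<mu> \<in> prob_bdd" "\<nu> \<in> prob_bdd" "\<And>r. measure \<nu> {..r} \<le> measure \<mu> {..r}"
  shows "\<sigma> \<mu> \<le> \<sigma> \<nu>"
  using \<sigma> assms by (auto simp: risk_measure_def)

lemma risk_translate:
  assumes "\<mu> \<in> prob_bdd"
  shows "\<sigma> (distr \<mu> borel (\<lambda>x. x + c)) = \<sigma> \<mu> + ereal c"
proof -
  have "\<mu> \<in> prob_on UNIV" using assms by (auto simp: prob_bdd_def intro: prob_on_subset_UNIV)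
  then show ?thesis using \<sigma> assms by (auto simp: risk_measure_def convolution_return[symmetric])
qed

lemma return_prob_bdd: "return borel (c::real) \<in> prob_bdd"
  by (rule prob_bddI[of _ "\<bar>c\<bar>"], rule return_prob_on) auto

lemma risk_return: "\<sigma> (return borel c) = \<sigma> (return borel 0) + ereal c"
proof -
  have "distr (return borel 0) borel (\<lambda>x. x + c) = return borel c"
    by (subst distr_return) auto
  then show ?thesis using risk_translate[OF return_prob_bdd, of 0 c] by simp
qed

text \<open>
  Monotonicity and translation invariance in the form in which they apply to random variables
  that differ by at most a constant.
\<close>

lemma risk_shift_mono:
  assumes "\<mu> \<in> prob_bdd" "\<nu> \<in> prob_bdd" "\<And>r. measure \<nu> {..r} \<le> measure \<mu> {..r + c}"
  shows "\<sigma> \<mu> \<le> \<sigma> \<nu> + ereal c"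
proof -
  obtain B where B: "\<nu> \<in> prob_on {-B..B}" using prob_bdd_interval[OF assms(2)] .
  have "distr \<nu> borel (\<lambda>x. x + c) \<in> prob_on {- (\<bar>B\<bar> + \<bar>c\<bar>)..\<bar>B\<bar> + \<bar>c\<bar>}"
    by (rule distr_prob_on[OF B]) auto
  then have "distr \<nu> borel (\<lambda>x. x + c) \<in> prob_bdd" by (rule prob_bddI)
  then have "\<sigma> \<mu> \<le> \<sigma> (distr \<nu> borel (\<lambda>x. x + c))"
    using assms(3)[of "_ - c"]
    by (intro risk_mono assms(1)) (auto simp: measure_shift_atMost[OF prob_on_subset_UNIV[OF B]])
  then show ?thesis by (simp add: risk_translate[OF assms(2)])
qed

text \<open>
  A law on \<open>{-B..B}\<close> lies between two translated unit masses in the stochastic order. Hence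
  finiteness at a single law implies finiteness at all laws of bounded support.
\<close>

lemma risk_bounds:
  assumes "\<mu> \<in> prob_on {-B..B}"
  shows "\<sigma> (return borel 0) + ereal (- B) \<le> \<sigma> \<mu>" "\<sigma> \<mu> \<le> \<sigma> (return borel 0) + ereal B"
proof -
  note bdd = prob_bddI[OF assms]
  interpret prob_space \<mu> using prob_onD[OF assms] by simp
  have AE: "AE x in \<mu>. x \<in> {-B..B}" using prob_on_AE[OF assms] .
  have "{..r} \<in> sets \<mu>" for r using prob_onD[OF assms] by simp
  have "measure \<mu> {..r} \<le> measure (return borel (- B)) {..r}" for r
  proof (cases "r < -B")
    case True
    have "measure \<mu> {..r} = 0"
      by (rule measure_eq_0_null_sets) (use AE True prob_onD[OF assms] in \<open>auto simp: AE_iff_null_sets elim!: eventually_mono\<close>)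
    then show ?thesis by simp
  qed (simp add: measure_return)
  then have "\<sigma> (return borel (- B)) \<le> \<sigma> \<mu>" by (intro risk_mono return_prob_bdd bdd)
  then show "\<sigma> (return borel 0) + ereal (- B) \<le> \<sigma> \<mu>" by (simp only: risk_return[of "- B"])
  have "measure (return borel B) {..r} \<le> measure \<mu> {..r}" for r
  proof (cases "B \<le> r")
    case True
    have "measure \<mu> {..r} = 1"
    proof (subst AE_in_set_eq_1[symmetric])
      show "AE x in \<mu>. x \<in> {..r}" using AE by eventually_elim (use True in auto)
    qed (use prob_onD[OF assms] in simp)
    then show ?thesis by (simp add: measure_return)
  qed (simp add: measure_return)
  then have "\<sigma> \<mu> \<le> \<sigma> (return borel B)" by (intro risk_mono return_prob_bdd bdd)
  then show "\<sigma> \<mu> \<le> \<sigma> (return borel 0) + ereal B" by (simp only: risk_return[of B])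
qed

lemma risk_finite:
  assumes "\<mu> \<in> prob_bdd"
  shows "\<bar>\<sigma> \<mu>\<bar> \<noteq> \<infinity>"
proof -
  obtain \<nu> where \<nu>: "\<nu> \<in> prob_bdd" "\<sigma> \<nu> \<noteq> \<infinity>" using \<sigma> by (auto simp: risk_measure_def)
  obtain B where "\<nu> \<in> prob_on {-B..B}" using prob_bdd_interval[OF \<nu>(1)] .
  from risk_bounds(1)[OF this] \<nu>(2) have "\<sigma> (return borel 0) \<noteq> \<infinity>" by auto
  moreover obtain B where "\<mu> \<in> prob_on {-B..B}" using prob_bdd_interval[OF assms] .
  note risk_bounds(2)[OF this]
  moreover have "\<sigma> \<mu> \<noteq> -\<infinity>" using \<sigma> assms by (auto simp: risk_measure_def)
  ultimately show ?thesis by (cases "\<sigma> (return borel 0)"; cases "\<sigma> \<mu>") auto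
qed

end

section \<open>Conditional laws\<close>

locale prob_subalgebra = prob_space M for M :: "'w measure" +
  fixes U :: "'w measure"
  assumes sub: "subalgebra M U"
begin

sublocale finite_measure_subalgebra M U
  by unfold_locales (rule sub)

abbreviation "UR \<equiv> restr_to_subalg M U"

lemma sets_U_M: "E \<in> sets U \<Longrightarrow> E \<in> sets M" and space_U: "space U = space M"
  using sub by (auto simp: subalgebra_def)

definition cond_law :: "('w \<Rightarrow> 'y::topological_space) \<Rightarrow> ('w \<Rightarrow> 'y measure) \<Rightarrow> bool" where
  "cond_law Y \<kappa> \<longleftrightarrow> \<kappa> \<in> U \<rightarrow>\<^sub>M prob_algebra borel \<and>
     (\<forall>B\<in>sets borel. AE \<omega> in M. cond_probability M U {\<omega>'\<in>space M. Y \<omega>' \<in> B} \<omega> = measure (\<kappa> \<omega>) B)"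

lemma kernel_prob_on:
  assumes "\<kappa> \<in> U \<rightarrow>\<^sub>M prob_algebra borel" "\<omega> \<in> space M"
  shows "\<kappa> \<omega> \<in> prob_on UNIV"
  using measurable_space[OF assms(1), of \<omega>] assms(2) by (simp add: space_U space_prob_algebra_borel)

lemma kernel_emeasure:
  assumes "\<kappa> \<in> U \<rightarrow>\<^sub>M prob_algebra borel" "\<omega> \<in> space M"
  shows "emeasure (\<kappa> \<omega>) B = ennreal (measure (\<kappa> \<omega>) B)"
proof -
  interpret k: prob_space "\<kappa> \<omega>" using kernel_prob_on[OF assms] prob_onD by auto
  show ?thesis by (rule k.emeasure_eq_measure)
qed

lemma kernel_measure_le_1:
  assumes "\<kappa> \<in> U \<rightarrow>\<^sub>M prob_algebra borel" "\<omega> \<in> space M"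
  shows "measure (\<kappa> \<omega>) B \<le> 1"
proof -
  interpret k: prob_space "\<kappa> \<omega>" using kernel_prob_on[OF assms] prob_onD by auto
  show ?thesis by (rule k.prob_le_1)
qed

lemma kernel_integrable:
  assumes "\<kappa> \<in> U \<rightarrow>\<^sub>M prob_algebra borel" "B \<in> sets borel"
  shows "integrable M (\<lambda>\<omega>. measure (\<kappa> \<omega>) B)" "(\<lambda>\<omega>. measure (\<kappa> \<omega>) B) \<in> borel_measurable U"
proof -
  show m: "(\<lambda>\<omega>. measure (\<kappa> \<omega>) B) \<in> borel_measurable U"
    using measurable_compose[OF assms(1) measurable_measure_prob_algebra[OF assms(2)]] .
  show "integrable M (\<lambda>\<omega>. measure (\<kappa> \<omega>) B)"
    using kernel_measure_le_1[OF assms(1)] measurable_from_subalg[OF sub m]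
    by (intro integrable_const_bound[of _ 1]) auto
qed

lemma nn_set_integral_kernel:
  assumes \<kappa>: "\<kappa> \<in> U \<rightarrow>\<^sub>M prob_algebra borel" and B: "B \<in> sets borel" and E: "E \<in> sets U"
  shows "(\<integral>\<^sup>+\<omega>. indicator E \<omega> * emeasure (\<kappa> \<omega>) B \<partial>M) = ennreal (\<integral>\<omega>\<in>E. measure (\<kappa> \<omega>) B \<partial>M)"
proof -
  have "(\<integral>\<^sup>+\<omega>. indicator E \<omega> * emeasure (\<kappa> \<omega>) B \<partial>M) = (\<integral>\<^sup>+\<omega>. ennreal (indicator E \<omega> * measure (\<kappa> \<omega>) B) \<partial>M)"
    by (intro nn_integral_cong) (auto simp: kernel_emeasure[OF \<kappa>] indicator_def)
  also have "\<dots> = ennreal (\<integral>\<omega>. indicator E \<omega> * measure (\<kappa> \<omega>) B \<partial>M)"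
    using integrable_mult_indicator[OF sets_U_M[OF E] kernel_integrable(1)[OF \<kappa> B]]
    by (intro nn_integral_eq_integral) auto
  finally show ?thesis by (simp add: set_lebesgue_integral_def)
qed

text \<open>
  Integration over the events of \<open>U\<close> removes the exceptional null sets: the right-hand side is an
  identity between finite measures in \<open>B\<close>, which may be proved on a generator.
\<close>

lemma cond_law_iff:
  fixes Y :: "'w \<Rightarrow> 'y::topological_space"
  assumes Y: "Y \<in> M \<rightarrow>\<^sub>M borel" and \<kappa>: "\<kappa> \<in> U \<rightarrow>\<^sub>M prob_algebra borel"
  shows "cond_law Y \<kappa> \<longleftrightarrow> (\<forall>B\<in>sets borel. \<forall>E\<in>sets U.
    emeasure M (E \<inter> {\<omega>\<in>space M. Y \<omega> \<in> B}) = (\<integral>\<^sup>+\<omega>. indicator E \<omega> * emeasure (\<kappa> \<omega>) B \<partial>M))" (is "_ = ?R")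
proof -
  have ev[measurable]: "{\<omega>\<in>space M. Y \<omega> \<in> B} \<in> sets M" if "B \<in> sets borel" for B
    using measurable_sets[OF Y that] by (simp add: vimage_def Int_def conj_commute)
  have int: "integrable M (indicat_real {\<omega>\<in>space M. Y \<omega> \<in> B})" if "B \<in> sets borel" for B
    using ev[OF that] by (simp add: less_top[symmetric])
  have lhs: "emeasure M (E \<inter> {\<omega>\<in>space M. Y \<omega> \<in> B})
      = ennreal (\<integral>\<omega>\<in>E. indicat_real {\<omega>\<in>space M. Y \<omega> \<in> B} \<omega> \<partial>M)"
    if B: "B \<in> sets borel" and E: "E \<in> sets U" for B E
  proof -
    have "(\<integral>\<omega>\<in>E. indicat_real {\<omega>\<in>space M. Y \<omega> \<in> B} \<omega> \<partial>M)
        = (\<integral>\<omega>. indicat_real (E \<inter> {\<omega>\<in>space M. Y \<omega> \<in> B}) \<omega> \<partial>M)"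
      unfolding set_lebesgue_integral_def by (intro Bochner_Integration.integral_cong) (auto simp: indicator_def)
    also have "\<dots> = measure M (E \<inter> {\<omega>\<in>space M. Y \<omega> \<in> B})"
      using ev[OF B] sets_U_M[OF E] by simp
    finally show ?thesis by (simp add: emeasure_eq_measure)
  qed
  have nn: "0 \<le> (\<integral>\<omega>\<in>E. f \<omega> \<partial>M)" if "\<And>\<omega>. 0 \<le> f \<omega>" for E and f :: "'w \<Rightarrow> real"
    unfolding set_lebesgue_integral_def using that by (intro integral_nonneg_AE) auto
  show ?thesis
  proof
    assume cl: "cond_law Y \<kappa>"
    show ?R
    proof (intro ballI)
      fix B :: "'y set" and E assume B: "B \<in> sets borel" and E: "E \<in> sets U"
      have "(\<integral>\<omega>\<in>E. indicat_real {\<omega>\<in>space M. Y \<omega> \<in> B} \<omega> \<partial>M) =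
          (\<integral>\<omega>\<in>E. real_cond_exp M U (indicat_real {\<omega>\<in>space M. Y \<omega> \<in> B}) \<omega> \<partial>M)"
        by (rule real_cond_exp_intA[OF int[OF B] E])
      also have "\<dots> = (\<integral>\<omega>\<in>E. measure (\<kappa> \<omega>) B \<partial>M)"
        using cl B sets_U_M[OF E] measurable_from_subalg[OF sub kernel_integrable(2)[OF \<kappa> B]]
        by (intro set_lebesgue_integral_cong_AE) (auto simp: cond_law_def cond_probability_def elim: eventually_mono)
      finally show "emeasure M (E \<inter> {\<omega>\<in>space M. Y \<omega> \<in> B}) = (\<integral>\<^sup>+\<omega>. indicator E \<omega> * emeasure (\<kappa> \<omega>) B \<partial>M)"
        by (simp add: lhs[OF B E] nn_set_integral_kernel[OF \<kappa> B E])
    qed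
  next
    assume R: ?R
    show "cond_law Y \<kappa>"
      unfolding cond_law_def cond_probability_def
    proof (intro conjI \<kappa> ballI)
      fix B :: "'y set" assume B: "B \<in> sets borel"
      show "AE \<omega> in M. real_cond_exp M U (indicat_real {\<omega>' \<in> space M. Y \<omega>' \<in> B}) \<omega> = measure (\<kappa> \<omega>) B"
      proof (rule real_cond_exp_charact)
        fix E assume E: "E \<in> sets U"
        show "(\<integral>\<omega>\<in>E. indicat_real {\<omega>\<in>space M. Y \<omega> \<in> B} \<omega> \<partial>M) = (\<integral>\<omega>\<in>E. measure (\<kappa> \<omega>) B \<partial>M)"
          using R B E lhs[OF B E] nn_set_integral_kernel[OF \<kappa> B E] nn[of "indicat_real {\<omega>\<in>space M. Y \<omega> \<in> B}" E]
            nn[of "\<lambda>\<omega>. measure (\<kappa> \<omega>) B" E] by (simp add: ennreal_inj)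
      qed (use int[OF B] kernel_integrable[OF \<kappa> B] in auto)
    qed
  qed
qed

text \<open>
  Freezing: conditionally on \<open>U\<close>, the argument that is \<open>U\<close>-measurable may be treated as a
  constant. The identity holds for rectangles by \<open>cond_law_iff\<close>, hence for the two measures
  on the product.
\<close>

lemma cond_law_freeze:
  fixes Y :: "'w \<Rightarrow> 'y::topological_space"
  assumes Y[measurable]: "Y \<in> M \<rightarrow>\<^sub>M borel" and cl: "cond_law Y \<kappa>"
    and f[measurable]: "(\<lambda>(\<omega>, y). f \<omega> y) \<in> borel_measurable (U \<Otimes>\<^sub>M borel)"
  shows "(\<integral>\<^sup>+\<omega>. f \<omega> (Y \<omega>) \<partial>M) = (\<integral>\<^sup>+\<omega>. \<integral>\<^sup>+y. f \<omega> y \<partial>\<kappa> \<omega> \<partial>M)"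
proof -
  have \<kappa>: "\<kappa> \<in> U \<rightarrow>\<^sub>M prob_algebra borel" using cl by (simp add: cond_law_def)
  have \<kappa>R: "\<kappa> \<in> UR \<rightarrow>\<^sub>M subprob_algebra borel"
    by (rule measurable_in_subalg[OF sub measurable_prob_algebraD[OF \<kappa>]])
  have [measurable_cong]: "sets UR = sets U" by (rule sets_restr_to_subalg[OF sub])
  have idU[measurable]: "(\<lambda>\<omega>. \<omega>) \<in> M \<rightarrow>\<^sub>M U" using measurable_from_subalg[OF sub, of "\<lambda>\<omega>. \<omega>" U] by simp
  have sUR: "space UR = space M" by (rule space_restr_to_subalg)
  define \<mu> where "\<mu> = distr M (U \<Otimes>\<^sub>M borel) (\<lambda>\<omega>. (\<omega>, Y \<omega>))"
  define \<eta> where "\<eta> \<omega> = distr (\<kappa> \<omega>) (U \<Otimes>\<^sub>M borel) (\<lambda>y. (\<omega>, y))" for \<omega>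
  have \<eta>: "\<eta> \<in> UR \<rightarrow>\<^sub>M subprob_algebra (U \<Otimes>\<^sub>M borel)"
    unfolding \<eta>_def by (rule measurable_distr2[OF _ \<kappa>R]) measurable
  define \<nu> where "\<nu> = UR \<bind> \<eta>"
  have ne: "space UR \<noteq> {}" using not_empty by (simp add: sUR)
  have s\<nu>: "sets \<nu> = sets (U \<Otimes>\<^sub>M borel)"
    unfolding \<nu>_def by (rule sets_bind[OF sets_kernel[OF \<eta>] ne])
  have \<kappa>m: "measurable (\<kappa> \<omega>) N = measurable borel N" if "\<omega> \<in> space M" for \<omega> and N :: "'z measure"
    using prob_onD[OF kernel_prob_on[OF \<kappa> that]] by (simp cong: measurable_cong_sets)
  have pair[measurable]: "(\<lambda>y. (\<omega>, y)) \<in> borel \<rightarrow>\<^sub>M U \<Otimes>\<^sub>M borel" if "\<omega> \<in> space M" for \<omega>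
    using that by (intro measurable_Pair1') (simp add: space_U)
  have "\<mu> = \<nu>"
  proof (rule measure_eqI_generator_eq[OF Int_stable_pair_measure_generator[of U borel],
        where \<Omega>="space U \<times> space borel" and A="\<lambda>_. space U \<times> space borel"])
    show "sets \<mu> = sigma_sets (space U \<times> space borel) {a \<times> b |a b. a \<in> sets U \<and> b \<in> sets borel}"
      "sets \<nu> = sigma_sets (space U \<times> space borel) {a \<times> b |a b. a \<in> sets U \<and> b \<in> sets borel}"
      by (simp_all add: \<mu>_def s\<nu> sets_pair_measure)
    fix X :: "('w \<times> 'y) set" assume "X \<in> {a \<times> b |a b. a \<in> sets U \<and> b \<in> sets borel}"
    then obtain E B where X: "X = E \<times> B" and E[measurable]: "E \<in> sets U" and B[measurable]: "B \<in> sets borel"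
      by auto
    have "emeasure \<mu> X = emeasure M (E \<inter> {\<omega>\<in>space M. Y \<omega> \<in> B})"
      unfolding \<mu>_def X by (subst emeasure_distr) (auto intro!: arg_cong[where f="emeasure M"])
    also have "\<dots> = (\<integral>\<^sup>+\<omega>. indicator E \<omega> * emeasure (\<kappa> \<omega>) B \<partial>M)"
      using cl cond_law_iff[OF Y \<kappa>] B E by auto
    also have "\<dots> = (\<integral>\<^sup>+\<omega>. indicator E \<omega> * emeasure (\<kappa> \<omega>) B \<partial>UR)"
      using measurable_compose[OF measurable_prob_algebraD[OF \<kappa>] measurable_emeasure_subprob_algebra[OF B]]
      by (intro nn_integral_subalgebra2[OF sub, symmetric]) auto
    also have "\<dots> = (\<integral>\<^sup>+\<omega>. emeasure (\<eta> \<omega>) X \<partial>UR)"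
    proof (intro nn_integral_cong)
      fix \<omega> assume "\<omega> \<in> space UR"
      then have \<omega>: "\<omega> \<in> space M" by (simp add: sUR)
      have "emeasure (\<eta> \<omega>) X = emeasure (\<kappa> \<omega>) ((\<lambda>y. (\<omega>, y)) -` X \<inter> space (\<kappa> \<omega>))"
        unfolding \<eta>_def X by (rule emeasure_distr) (use pair[OF \<omega>] in \<open>auto simp: \<kappa>m[OF \<omega>]\<close>)
      also have "(\<lambda>y. (\<omega>, y)) -` X \<inter> space (\<kappa> \<omega>) = (if \<omega> \<in> E then B else {})"
        using prob_onD[OF kernel_prob_on[OF \<kappa> \<omega>]] by (auto simp: X)
      finally show "indicator E \<omega> * emeasure (\<kappa> \<omega>) B = emeasure (\<eta> \<omega>) X" by (auto simp: indicator_def)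
    qed
    also have "\<dots> = emeasure \<nu> X"
      unfolding \<nu>_def X by (rule emeasure_bind[OF ne \<eta>, symmetric]) auto
    finally show "emeasure \<mu> X = emeasure \<nu> X" .
  next
    have "prob_space \<mu>" unfolding \<mu>_def by (rule prob_space_distr) measurable
    then show "emeasure \<mu> (space U \<times> space borel) \<noteq> \<infinity>" for i :: nat
      by (simp add: finite_measure.emeasure_finite prob_space.finite_measure)
  next
    show "{a \<times> b |a b. a \<in> sets U \<and> b \<in> sets borel} \<subseteq> Pow (space U \<times> space borel)"
      by (rule pair_measure_closed)
    have "space U \<times> space borel \<in> {a \<times> b |a b. a \<in> sets U \<and> b \<in> sets borel}"
      using sets.top[of U] sets.top[of borel] by blast
    then show "range (\<lambda>_::nat. space U \<times> space borel) \<subseteq> {a \<times> b |a b. a \<in> sets U \<and> b \<in> sets borel}"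
      by auto
  qed simp
  have "(\<integral>\<^sup>+\<omega>. f \<omega> (Y \<omega>) \<partial>M) = (\<integral>\<^sup>+z. (case z of (\<omega>, y) \<Rightarrow> f \<omega> y) \<partial>\<mu>)"
    unfolding \<mu>_def by (subst nn_integral_distr) auto
  also have "\<dots> = (\<integral>\<^sup>+\<omega>. \<integral>\<^sup>+z. (case z of (\<omega>, y) \<Rightarrow> f \<omega> y) \<partial>\<eta> \<omega> \<partial>UR)"
    unfolding \<open>\<mu> = \<nu>\<close> \<nu>_def by (rule nn_integral_bind[OF f \<eta>])
  also have "\<dots> = (\<integral>\<^sup>+\<omega>. \<integral>\<^sup>+y. f \<omega> y \<partial>\<kappa> \<omega> \<partial>UR)"
  proof (intro nn_integral_cong)
    fix \<omega> assume "\<omega> \<in> space UR"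
    then have \<omega>: "\<omega> \<in> space M" by (simp add: sUR)
    show "(\<integral>\<^sup>+z. (case z of (\<omega>, y) \<Rightarrow> f \<omega> y) \<partial>\<eta> \<omega>) = (\<integral>\<^sup>+y. f \<omega> y \<partial>\<kappa> \<omega>)"
      unfolding \<eta>_def by (subst nn_integral_distr) (use pair[OF \<omega>] f in \<open>auto simp: \<kappa>m[OF \<omega>]\<close>)
  qed
  also have "\<dots> = (\<integral>\<^sup>+\<omega>. \<integral>\<^sup>+y. f \<omega> y \<partial>\<kappa> \<omega> \<partial>M)"
    by (rule nn_integral_subalgebra2[OF sub
          nn_integral_measurable_subprob_algebra2[OF f measurable_prob_algebraD[OF \<kappa>]]])
  finally show ?thesis .
qed

lemma cond_lawD:
  assumes "cond_law Y \<kappa>" "B \<in> sets borel"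
  shows "AE \<omega> in M. real_cond_exp M U (indicator {\<omega>'\<in>space M. Y \<omega>' \<in> B}) \<omega> = measure (\<kappa> \<omega>) B"
  using assms unfolding cond_law_def cond_probability_def by blast

text \<open>
  A random variable built from a \<open>U\<close>-measurable state, an action with a conditional law given
  \<open>U\<close> and a successor with a conditional law given a larger algebra: freezing twice composes
  the two kernels.
\<close>

lemma cond_law_two_stage:
  fixes X :: "'w \<Rightarrow> 'x::second_countable_topology" and A :: "'w \<Rightarrow> 'a::second_countable_topology"
    and Y :: "'w \<Rightarrow> 'y::second_countable_topology" and h :: "'x \<Rightarrow> 'a \<Rightarrow> 'y \<Rightarrow> real"
  assumes G: "prob_subalgebra M G" and UG: "sets U \<subseteq> sets G"
    and X: "X \<in> U \<rightarrow>\<^sub>M borel" and A: "A \<in> G \<rightarrow>\<^sub>M borel" and Y: "Y \<in> M \<rightarrow>\<^sub>M borel"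
    and clA: "cond_law A \<kappa>"
    and Q: "(\<lambda>(x, a). Q x a) \<in> borel \<Otimes>\<^sub>M borel \<rightarrow>\<^sub>M prob_algebra borel"
    and clY: "prob_subalgebra.cond_law M G Y (\<lambda>\<omega>. Q (X \<omega>) (A \<omega>))"
    and h: "(\<lambda>(x, a, y). h x a y) \<in> borel_measurable borel"
  shows "cond_law (\<lambda>\<omega>. h (X \<omega>) (A \<omega>) (Y \<omega>)) (\<lambda>\<omega>. \<kappa> \<omega> \<bind> (\<lambda>a. distr (Q (X \<omega>) a) borel (h (X \<omega>) a)))"
proof -
  interpret G: prob_subalgebra M G by fact
  have \<kappa>: "\<kappa> \<in> U \<rightarrow>\<^sub>M prob_algebra borel" using clA by (simp add: cond_law_def)
  have "subalgebra G U" using UG by (simp add: subalgebra_def space_U G.space_U)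
  note XG[measurable] = measurable_from_subalg[OF this X]
  note [measurable] = X A Y Q \<kappa> measurable_from_subalg[OF sub X] measurable_from_subalg[OF G.sub A]
  have AM: "A \<in> M \<rightarrow>\<^sub>M borel" by measurable
  have h'[measurable (raw)]: "(\<lambda>z. h (f z) (g z) (k z)) \<in> borel_measurable N"
    if [measurable]: "f \<in> N \<rightarrow>\<^sub>M borel" "g \<in> N \<rightarrow>\<^sub>M borel" "k \<in> N \<rightarrow>\<^sub>M borel" for f g k and N :: "'z measure"
  proof -
    have "(\<lambda>z. (f z, g z, k z)) \<in> N \<rightarrow>\<^sub>M borel"
      by (subst borel_prod[symmetric], subst borel_prod[symmetric]) measurable
    from measurable_compose[OF this h] show ?thesis by simp
  qed
  define L where "L x a = distr (Q x a) borel (h x a)" for x a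
  have L[measurable]: "(\<lambda>(x, a). L x a) \<in> borel \<Otimes>\<^sub>M borel \<rightarrow>\<^sub>M prob_algebra borel"
    unfolding L_def by measurable
  have ker: "(\<lambda>\<omega>. \<kappa> \<omega> \<bind> L (X \<omega>)) \<in> U \<rightarrow>\<^sub>M prob_algebra borel" by measurable
  have hM[measurable]: "(\<lambda>\<omega>. h (X \<omega>) (A \<omega>) (Y \<omega>)) \<in> M \<rightarrow>\<^sub>M borel" by measurable
  show ?thesis
    unfolding L_def[symmetric]
  proof (subst cond_law_iff[OF hM ker], intro ballI)
    fix B :: "real set" and E assume B[measurable]: "B \<in> sets borel" and E[measurable]: "E \<in> sets U"
    have EG[measurable]: "E \<in> sets G" using E UG by auto
    have EM: "E \<in> sets M" using E sets_U_M by auto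
    have "emeasure M (E \<inter> {\<omega> \<in> space M. h (X \<omega>) (A \<omega>) (Y \<omega>) \<in> B})
        = (\<integral>\<^sup>+\<omega>. indicator (E \<inter> {\<omega> \<in> space M. h (X \<omega>) (A \<omega>) (Y \<omega>) \<in> B}) \<omega> \<partial>M)"
    proof (rule nn_integral_indicator[symmetric])
      have "{\<omega> \<in> space M. h (X \<omega>) (A \<omega>) (Y \<omega>) \<in> B} \<in> sets M" by measurable
      with EM show "E \<inter> {\<omega> \<in> space M. h (X \<omega>) (A \<omega>) (Y \<omega>) \<in> B} \<in> sets M" by (rule sets.Int)
    qed
    also have "\<dots> = (\<integral>\<^sup>+\<omega>. indicator E \<omega> * indicator B (h (X \<omega>) (A \<omega>) (Y \<omega>)) \<partial>M)"
      by (intro nn_integral_cong) (auto simp: indicator_def)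
    also have "\<dots> = (\<integral>\<^sup>+\<omega>. \<integral>\<^sup>+y. indicator E \<omega> * indicator B (h (X \<omega>) (A \<omega>) y) \<partial>Q (X \<omega>) (A \<omega>) \<partial>M)"
      by (rule G.cond_law_freeze[OF Y clY, of "\<lambda>\<omega> y. indicator E \<omega> * indicator B (h (X \<omega>) (A \<omega>) y)"]) measurable
    also have "\<dots> = (\<integral>\<^sup>+\<omega>. indicator E \<omega> * emeasure (L (X \<omega>) (A \<omega>)) B \<partial>M)"
    proof (intro nn_integral_cong)
      fix \<omega>
      have q: "Q (X \<omega>) (A \<omega>) \<in> space (prob_algebra borel)"
        using measurable_space[OF Q, of "(X \<omega>, A \<omega>)"] by (simp add: space_pair_measure)
      then have [measurable_cong]: "sets (Q (X \<omega>) (A \<omega>)) = sets borel" by (simp add: space_prob_algebra)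
      have [measurable]: "h (X \<omega>) (A \<omega>) \<in> borel_measurable borel"
        by measurable
      have "(\<integral>\<^sup>+y. indicator B (h (X \<omega>) (A \<omega>) y) \<partial>Q (X \<omega>) (A \<omega>)) = emeasure (L (X \<omega>) (A \<omega>)) B"
        unfolding L_def by (subst nn_integral_distr[of _ _ borel "indicator B", symmetric]) auto
      then show "(\<integral>\<^sup>+y. indicator E \<omega> * indicator B (h (X \<omega>) (A \<omega>) y) \<partial>Q (X \<omega>) (A \<omega>))
          = indicator E \<omega> * emeasure (L (X \<omega>) (A \<omega>)) B"
        by (subst nn_integral_cmult) auto
    qed
    also have "\<dots> = (\<integral>\<^sup>+\<omega>. \<integral>\<^sup>+a. indicator E \<omega> * emeasure (L (X \<omega>) a) B \<partial>\<kappa> \<omega> \<partial>M)"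
    proof (rule cond_law_freeze[OF AM clA, of "\<lambda>\<omega> a. indicator E \<omega> * emeasure (L (X \<omega>) a) B"])
      have "(\<lambda>(x, a). emeasure (L x a) B) \<in> borel_measurable (borel \<Otimes>\<^sub>M borel)"
        using measurable_compose[OF measurable_prob_algebraD[OF L] measurable_emeasure_subprob_algebra[OF B]]
        by (simp add: split_beta')
      note [measurable] = this
      show "(\<lambda>(\<omega>, a). indicator E \<omega> * emeasure (L (X \<omega>) a) B) \<in> borel_measurable (U \<Otimes>\<^sub>M borel)"
        by measurable
    qed
    also have "\<dots> = (\<integral>\<^sup>+\<omega>. indicator E \<omega> * emeasure (\<kappa> \<omega> \<bind> L (X \<omega>)) B \<partial>M)"
    proof (intro nn_integral_cong)
      fix \<omega> assume \<omega>: "\<omega> \<in> space M"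
      have sk[measurable_cong]: "sets (\<kappa> \<omega>) = sets borel" and ne: "space (\<kappa> \<omega>) \<noteq> {}"
        using prob_onD[OF kernel_prob_on[OF \<kappa> \<omega>]] by auto
      have L1: "L (X \<omega>) \<in> borel \<rightarrow>\<^sub>M subprob_algebra borel"
        by (rule measurable_prob_algebraD) measurable
      then have L2: "L (X \<omega>) \<in> \<kappa> \<omega> \<rightarrow>\<^sub>M subprob_algebra borel" using sk by (simp cong: measurable_cong_sets)
      have "(\<lambda>a. emeasure (L (X \<omega>) a) B) \<in> borel_measurable (\<kappa> \<omega>)"
        using measurable_compose[OF L2 measurable_emeasure_subprob_algebra[OF B]] .
      then show "(\<integral>\<^sup>+a. indicator E \<omega> * emeasure (L (X \<omega>) a) B \<partial>\<kappa> \<omega>)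
          = indicator E \<omega> * emeasure (\<kappa> \<omega> \<bind> L (X \<omega>)) B"
        by (subst nn_integral_cmult) (auto simp: emeasure_bind[OF ne L2 B])
    qed
    finally show "emeasure M (E \<inter> {\<omega> \<in> space M. h (X \<omega>) (A \<omega>) (Y \<omega>) \<in> B})
        = (\<integral>\<^sup>+\<omega>. indicator E \<omega> * emeasure (\<kappa> \<omega> \<bind> L (X \<omega>)) B \<partial>M)" .
  qed
qed

text \<open>
  For each threshold the inequality holds off a null set; rational thresholds give one null set,
  and right-continuity of distribution functions extends the inequality to all thresholds.
\<close>

lemma cond_law_stochastic_order:
  fixes Y Z :: "'w \<Rightarrow> real"
  assumes Y[measurable]: "Y \<in> borel_measurable M" and Z[measurable]: "Z \<in> borel_measurable M"
    and \<kappa>: "cond_law Y \<kappa>" and \<eta>: "cond_law Z \<eta>" and le: "AE \<omega> in M. Y \<omega> \<le> Z \<omega> + c"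
  shows "AE \<omega> in M. \<forall>r. measure (\<eta> \<omega>) {..r} \<le> measure (\<kappa> \<omega>) {..r + c}"
proof -
  have "AE \<omega> in M. measure (\<eta> \<omega>) {..q} \<le> measure (\<kappa> \<omega>) {..q + c}" for q
  proof -
    have "AE \<omega> in M. real_cond_exp M U (indicator {\<omega>'\<in>space M. Z \<omega>' \<in> {..q}}) \<omega>
        \<le> real_cond_exp M U (indicator {\<omega>'\<in>space M. Y \<omega>' \<in> {..q + c}}) \<omega>"
    proof (rule real_cond_exp_mono)
      show "AE \<omega> in M. indicat_real {\<omega>'\<in>space M. Z \<omega>' \<in> {..q}} \<omega> \<le> indicat_real {\<omega>'\<in>space M. Y \<omega>' \<in> {..q + c}} \<omega>"
        using le by eventually_elim (auto simp: indicator_def)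
    qed (auto simp: less_top[symmetric])
    moreover have "AE \<omega> in M. real_cond_exp M U (indicator {\<omega>'\<in>space M. Z \<omega>' \<in> {..q}}) \<omega> = measure (\<eta> \<omega>) {..q}"
      "AE \<omega> in M. real_cond_exp M U (indicator {\<omega>'\<in>space M. Y \<omega>' \<in> {..q + c}}) \<omega> = measure (\<kappa> \<omega>) {..q + c}"
      by (rule cond_lawD[OF \<eta>], simp) (rule cond_lawD[OF \<kappa>], simp)
    ultimately show ?thesis by eventually_elim simp
  qed
  then have "AE \<omega> in M. \<forall>q::rat. measure (\<eta> \<omega>) {..of_rat q} \<le> measure (\<kappa> \<omega>) {..of_rat q + c}"
    by (subst AE_all_countable) auto
  then show ?thesis
  proof (rule AE_mp, intro AE_I2 impI allI)
    fix \<omega> r assume \<omega>: "\<omega> \<in> space M"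
      and q: "\<forall>q::rat. measure (\<eta> \<omega>) {..of_rat q} \<le> measure (\<kappa> \<omega>) {..of_rat q + c}"
    have \<kappa>\<omega>: "\<kappa> \<omega> \<in> prob_on UNIV" and \<eta>\<omega>: "\<eta> \<omega> \<in> prob_on UNIV"
      using \<kappa> \<eta> \<omega> kernel_prob_on by (auto simp: cond_law_def)
    interpret k: real_distribution "\<kappa> \<omega>" by (rule prob_on_real_distribution[OF \<kappa>\<omega>])
    interpret e: real_distribution "\<eta> \<omega>" by (rule prob_on_real_distribution[OF \<eta>\<omega>])
    have le': "measure (\<eta> \<omega>) {..r} \<le> measure (\<kappa> \<omega>) {..s}" if "r + c < s" for s
    proof -
      have "r < s - c" using that by simp
      then obtain p where p: "r < of_rat p" "of_rat p < s - c" using of_rat_dense by blast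
      have "measure (\<eta> \<omega>) {..r} \<le> measure (\<eta> \<omega>) {..of_rat p}" using p by (intro e.finite_measure_mono) auto
      also have "\<dots> \<le> measure (\<kappa> \<omega>) {..of_rat p + c}" using q by blast
      also have "\<dots> \<le> measure (\<kappa> \<omega>) {..s}" using p by (intro k.finite_measure_mono) auto
      finally show ?thesis .
    qed
    show "measure (\<eta> \<omega>) {..r} \<le> measure (\<kappa> \<omega>) {..r + c}"
    proof (rule tendsto_lowerbound)
      show "(cdf (\<kappa> \<omega>) \<longlongrightarrow> measure (\<kappa> \<omega>) {..r + c}) (at_right (r + c))"
        using k.cdf_is_right_cont[of "r + c"] by (simp add: continuous_within cdf_def)
      show "\<forall>\<^sub>F s in at_right (r + c). measure (\<eta> \<omega>) {..r} \<le> cdf (\<kappa> \<omega>) s"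
        using le' by (auto simp: eventually_at_filter cdf_def)
    qed simp
  qed
qed

text \<open>
  The conditional probabilities of the rays with rational end point form a distribution function off a null set, and its
  right-continuous regularisation determines the kernel. On the exceptional null set the
  distribution function of the unit mass at 0 is used.
\<close>

lemma regular_cond_law_exists:
  fixes Y :: "'w \<Rightarrow> real"
  assumes Y[measurable]: "Y \<in> borel_measurable M" and bound: "AE \<omega> in M. \<bar>Y \<omega>\<bar> \<le> c" and "0 \<le> c"
  obtains \<kappa> where "cond_law Y \<kappa>" "\<And>\<omega>. \<omega> \<in> space M \<Longrightarrow> \<kappa> \<omega> \<in> prob_on {-c..c}"
proof -
  define J where "J q = indicat_real {\<omega>\<in>space M. Y \<omega> \<le> q}" for q
  have intJ: "integrable M (J q)" for q unfolding J_def by (auto simp: less_top[symmetric])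
  define G where "G q = real_cond_exp M U (J (of_rat q))" for q :: rat
  have G[measurable]: "G q \<in> borel_measurable U" for q by (simp add: G_def)
  define good where "good \<omega> \<longleftrightarrow> (\<forall>q q'. q \<le> q' \<longrightarrow> G q \<omega> \<le> G q' \<omega>) \<and>
    (\<forall>q. of_rat q < -c \<longrightarrow> G q \<omega> = 0) \<and> (\<forall>q. c \<le> of_rat q \<longrightarrow> G q \<omega> = 1)" for \<omega>
  have good[measurable]: "Measurable.pred U good" unfolding good_def by measurable
  have const: "AE \<omega> in M. real_cond_exp M U (\<lambda>_. k) \<omega> = k" for k
    by (rule real_cond_exp_F_meas) auto
  have AE_good: "AE \<omega> in M. good \<omega>"
    unfolding good_def AE_conj_iff AE_all_countable
  proof (intro conjI allI impI)
    fix q q' :: rat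
    show "AE \<omega> in M. q \<le> q' \<longrightarrow> G q \<omega> \<le> G q' \<omega>"
    proof (cases "q \<le> q'")
      case True
      then have "(of_rat q :: real) \<le> of_rat q'" by (simp add: of_rat_less_eq)
      then have "AE \<omega> in M. G q \<omega> \<le> G q' \<omega>"
        unfolding G_def by (intro real_cond_exp_mono intJ) (auto simp: J_def indicator_def)
      then show ?thesis by eventually_elim simp
    qed simp
  next
    fix q :: rat
    show "AE \<omega> in M. of_rat q < -c \<longrightarrow> G q \<omega> = 0"
    proof (cases "of_rat q < -c")
      case True
      have "AE \<omega> in M. J (of_rat q) \<omega> = 0" using bound by eventually_elim (use True in \<open>auto simp: J_def indicator_def\<close>)
      then have "AE \<omega> in M. G q \<omega> = real_cond_exp M U (\<lambda>_. 0) \<omega>"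
        unfolding G_def by (rule real_cond_exp_cong) (use intJ in auto)
      then show ?thesis using const[of 0] by eventually_elim simp
    qed simp
    show "AE \<omega> in M. c \<le> of_rat q \<longrightarrow> G q \<omega> = 1"
    proof (cases "c \<le> of_rat q")
      case True
      have "AE \<omega> in M. J (of_rat q) \<omega> = 1"
        using bound AE_space by eventually_elim (use True in \<open>auto simp: J_def indicator_def\<close>)
      then have "AE \<omega> in M. G q \<omega> = real_cond_exp M U (\<lambda>_. 1) \<omega>"
        unfolding G_def by (rule real_cond_exp_cong) (use intJ in auto)
      then show ?thesis using const[of 1] by eventually_elim simp
    qed simp
  qed
  \<comment> \<open>The distribution function of the unit mass at 0 replaces \<open>G\<close> off the good set.\<close>
  define H where "H q \<omega> = (if good \<omega> then G q \<omega> else indicator {0..} q)" for q \<omega>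
  have H[measurable]: "H q \<in> borel_measurable U" for q unfolding H_def by measurable
  have H_mono: "q \<le> q' \<Longrightarrow> H q \<omega> \<le> H q' \<omega>" for q q' \<omega>
    by (auto simp: H_def good_def indicator_def)
  have H0: "of_rat q < -c \<Longrightarrow> H q \<omega> = 0" and H1: "c \<le> of_rat q \<Longrightarrow> H q \<omega> = 1" for q \<omega>
    using \<open>0 \<le> c\<close> of_rat_less_0_iff[of q, where ?'a=real] zero_le_of_rat_iff[of q, where ?'a=real]
    by (auto simp: H_def good_def indicator_def simp del: of_rat_less_0_iff zero_le_of_rat_iff)
  have H_ge: "0 \<le> H q \<omega>" for q \<omega>
  proof -
    define m where "m = min (-c) (of_rat q)"
    obtain p :: rat where "of_rat p < m" using of_rat_dense[of "m - 1" m] by auto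
    then have p: "of_rat p < min (-c) (of_rat q)" by (simp add: m_def)
    then have "p \<le> q" by (simp add: of_rat_less)
    with H_mono[OF this, of \<omega>] H0[of p \<omega>] p show ?thesis by simp
  qed
  define F where "F \<omega> r = (INF q\<in>{q. r < of_rat q}. H q \<omega>)" for \<omega> and r :: real
  have ne: "{q. r < of_rat q} \<noteq> {}" for r :: real using of_rat_dense[of r "r + 1"] by auto
  have bdd: "bdd_below ((\<lambda>q. H q \<omega>) ` S)" for \<omega> S using H_ge by (intro bdd_belowI[of _ 0]) auto
  have F_le: "F \<omega> r \<le> H q \<omega>" if "r < of_rat q" for \<omega> r q
    unfolding F_def using that by (intro cINF_lower bdd) auto
  have F_less: "\<exists>q. r < of_rat q \<and> H q \<omega> < z" if "F \<omega> r < z" for \<omega> r z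
    using that cINF_less_iff[OF ne bdd] unfolding F_def by auto
  have F_mono: "F \<omega> r \<le> F \<omega> s" if "r \<le> s" for \<omega> r s
    unfolding F_def using that ne[of s] by (intro cINF_superset_mono bdd) auto
  have F_cont: "continuous (at_right r) (F \<omega>)" for \<omega> r
    unfolding continuous_within
  proof (rule order_tendstoI)
    fix a assume "a < F \<omega> r"
    then show "\<forall>\<^sub>F s in at_right r. a < F \<omega> s"
      unfolding eventually_at_filter
      by (intro always_eventually) (auto intro: less_le_trans[OF _ F_mono] less_imp_le)
  next
    fix a assume "F \<omega> r < a"
    then obtain q where q: "r < of_rat q" "H q \<omega> < a" using F_less by blast
    have "\<forall>\<^sub>F s in at_right r. s < of_rat q"
      using q(1) by (auto simp: eventually_at_right)
    then show "\<forall>\<^sub>F s in at_right r. F \<omega> s < a"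
      by eventually_elim (use F_le q(2) in \<open>auto intro: le_less_trans\<close>)
  qed
  have F0: "F \<omega> r = 0" if "r < -c" for \<omega> r
  proof -
    obtain q :: rat where q: "r < of_rat q" "of_rat q < -c" using of_rat_dense[OF \<open>r < -c\<close>] by auto
    then have "F \<omega> r \<le> 0" using F_le[OF q(1), of \<omega>] H0[OF q(2)] by simp
    moreover have "0 \<le> F \<omega> r" unfolding F_def using ne H_ge by (intro cINF_greatest) auto
    ultimately show ?thesis by simp
  qed
  have F1: "F \<omega> r = 1" if "c \<le> r" for \<omega> r
  proof -
    have "(\<lambda>q. H q \<omega>) ` {q. r < of_rat q} = {1}" using ne[of r] H1 that by (force simp: image_iff)
    then show ?thesis by (simp add: F_def)
  qed
  have F_bot: "(F \<omega> \<longlongrightarrow> 0) at_bot" for \<omega>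
    by (rule tendsto_eventually) (use F0 in \<open>auto simp: eventually_at_bot_linorder intro!: exI[of _ "-c - 1"]\<close>)
  have F_top: "(F \<omega> \<longlongrightarrow> 1) at_top" for \<omega>
    by (rule tendsto_eventually) (use F1 in \<open>auto simp: eventually_at_top_linorder\<close>)
  define \<kappa> where "\<kappa> \<omega> = interval_measure (F \<omega>)" for \<omega>
  have rd: "real_distribution (\<kappa> \<omega>)" for \<omega>
    unfolding \<kappa>_def by (rule real_distribution_interval_measure[OF F_mono F_cont F_bot F_top])
  have Iic: "emeasure (\<kappa> \<omega>) {..r} = ennreal (F \<omega> r)" "measure (\<kappa> \<omega>) {..r} = F \<omega> r" for \<omega> r
    unfolding \<kappa>_def using emeasure_interval_measure_Iic[where F="F \<omega>" and x=r, OF F_mono F_cont F_bot]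
      measure_interval_measure_Iic[where F="F \<omega>" and x=r, OF F_mono F_cont F_bot] by simp_all
  have F_meas[measurable]: "(\<lambda>\<omega>. F \<omega> r) \<in> borel_measurable U" for r
    unfolding F_def by (intro borel_measurable_cINF) (auto simp: bdd)
  have \<kappa>U: "\<kappa> \<in> U \<rightarrow>\<^sub>M prob_algebra borel"
  proof (rule measurable_prob_algebra_generated[where \<Omega>=UNIV and G="range (\<lambda>r::real. {..r})"])
    show "sets borel = sigma_sets UNIV (range (\<lambda>r::real. {..r}))"
      by (subst borel_eq_atMost) simp
    show "Int_stable (range (\<lambda>r::real. {..r}))" by (auto simp: Int_stable_def)
    show "prob_space (\<kappa> \<omega>)" "sets (\<kappa> \<omega>) = sets borel" for \<omega>
      using rd[of \<omega>] by (auto simp: real_distribution_def real_distribution_axioms_def)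
    fix A assume "A \<in> range (\<lambda>r::real. {..r})"
    then show "(\<lambda>\<omega>. emeasure (\<kappa> \<omega>) A) \<in> borel_measurable U" by (auto simp: Iic)
  qed auto
  have on: "\<kappa> \<omega> \<in> prob_on {-c..c}" for \<omega>
  proof -
    interpret k: real_distribution "\<kappa> \<omega>" by (rule rd)
    have "AE y in \<kappa> \<omega>. y \<in> {..c}" using Iic(2)[of \<omega> c] F1[of c \<omega>] by (intro k.AE_prob_1) simp
    moreover have "AE y in \<kappa> \<omega>. \<not> y < -c"
    proof -
      have "(cdf (\<kappa> \<omega>) \<longlongrightarrow> 0) (at_left (-c))"
        by (rule tendsto_eventually) (auto simp: eventually_at_filter cdf_def Iic(2) F0)
      then have "measure (\<kappa> \<omega>) {..<-c} = 0"
        using k.cdf_at_left[of "-c"] tendsto_unique[OF _ k.cdf_at_left[of "-c"]] by auto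
      then show ?thesis by (subst (asm) k.prob_eq_0) auto
    qed
    ultimately have "AE y in \<kappa> \<omega>. y \<in> {-c..c}" by eventually_elim auto
    then show ?thesis
      by (rule prob_onI_AE[rotated 2]) (use k.prob_space_axioms in \<open>simp_all add: prob_on_UNIV_iff\<close>)
  qed
  have ray: "emeasure M (E \<inter> {\<omega>\<in>space M. Y \<omega> \<in> {..r}}) = (\<integral>\<^sup>+\<omega>. indicator E \<omega> * emeasure (\<kappa> \<omega>) {..r} \<partial>M)"
    if E: "E \<in> sets U" for E r
  proof -
    note [measurable] = sets_U_M[OF E]
    have GE: "(\<integral>\<omega>\<in>E. H q \<omega> \<partial>M) = measure M (E \<inter> {\<omega>\<in>space M. Y \<omega> \<le> of_rat q})" for q
    proof -
      have "(\<integral>\<omega>\<in>E. H q \<omega> \<partial>M) = (\<integral>\<omega>\<in>E. G q \<omega> \<partial>M)"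
      proof (rule set_lebesgue_integral_cong_AE)
        show "AE \<omega>\<in>E in M. H q \<omega> = G q \<omega>" using AE_good by eventually_elim (simp add: H_def)
      qed (use measurable_from_subalg[OF sub H] measurable_from_subalg[OF sub G] in auto)
      also have "\<dots> = (\<integral>\<omega>\<in>E. J (of_rat q) \<omega> \<partial>M)"
        unfolding G_def by (rule real_cond_exp_intA[OF intJ E, symmetric])
      also have "\<dots> = (\<integral>\<omega>. indicat_real (E \<inter> {\<omega>\<in>space M. Y \<omega> \<le> of_rat q}) \<omega> \<partial>M)"
        unfolding set_lebesgue_integral_def J_def
        by (intro Bochner_Integration.integral_cong) (auto simp: indicator_def)
      finally show ?thesis by simp
    qed
    obtain u :: "nat \<Rightarrow> rat" where u: "\<And>n. r < of_rat (u n)" "(\<lambda>n. of_rat (u n)) \<longlonglongrightarrow> r"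
    proof -
      have "\<exists>q. r < of_rat q \<and> of_rat q < r + 1 / real (Suc n)" for n
        using of_rat_dense[of r "r + 1 / real (Suc n)"] by simp
      then obtain u where u: "\<And>n. r < of_rat (u n)" "\<And>n. of_rat (u n) < r + 1 / real (Suc n)" by metis
      have lim: "(\<lambda>n. r + 1 / real (Suc n)) \<longlonglongrightarrow> r"
        using tendsto_add[OF tendsto_const LIMSEQ_Suc[OF lim_1_over_n], of r] by simp
      have "(\<lambda>n. of_rat (u n)) \<longlonglongrightarrow> r"
      proof (rule tendsto_sandwich[OF _ _ tendsto_const lim])
        show "\<forall>\<^sub>F n in sequentially. r \<le> of_rat (u n)"
          "\<forall>\<^sub>F n in sequentially. of_rat (u n) \<le> r + 1 / real (Suc n)"
          using less_imp_le[OF u(1)] less_imp_le[OF u(2)] by (simp_all only: eventually_True)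
      qed
      with u(1) that show thesis by blast
    qed
    have limH: "(\<lambda>n. H (u n) \<omega>) \<longlonglongrightarrow> F \<omega> r" for \<omega>
    proof (rule order_tendstoI)
      fix a assume "a < F \<omega> r"
      show "\<forall>\<^sub>F n in sequentially. a < H (u n) \<omega>"
        by (intro always_eventually allI less_le_trans[OF \<open>a < F \<omega> r\<close> F_le[OF u(1)]])
    next
      fix a assume "F \<omega> r < a"
      then obtain q where q: "r < of_rat q" "H q \<omega> < a" using F_less by blast
      from order_tendstoD(2)[OF u(2) q(1)] show "\<forall>\<^sub>F n in sequentially. H (u n) \<omega> < a"
      proof eventually_elim
        case (elim n)
        then have "u n \<le> q" by (simp add: of_rat_less)
        with H_mono[OF this, of \<omega>] q(2) show ?case by simp
      qed
    qed
    have H_le1: "H q \<omega> \<le> 1" for q \<omega>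
    proof -
      define m where "m = max c (of_rat q)"
      obtain p :: rat where "m < of_rat p" using of_rat_dense[of m "m + 1"] by auto
      then have p: "max c (of_rat q) < of_rat p" by (simp add: m_def)
      then have "q \<le> p" by (simp add: of_rat_less)
      with H_mono[OF this, of \<omega>] H1[of p \<omega>] p show ?thesis by simp
    qed
    have "(\<lambda>n. \<integral>\<omega>\<in>E. H (u n) \<omega> \<partial>M) \<longlonglongrightarrow> (\<integral>\<omega>\<in>E. F \<omega> r \<partial>M)"
      unfolding set_lebesgue_integral_def
    proof (rule integral_dominated_convergence[where w="\<lambda>_. 1"])
      show "AE \<omega> in M. norm (indicat_real E \<omega> *\<^sub>R H (u n) \<omega>) \<le> 1" for n
        using H_ge H_le1 by (auto simp: indicator_def)
      show "AE \<omega> in M. (\<lambda>n. indicat_real E \<omega> *\<^sub>R H (u n) \<omega>) \<longlonglongrightarrow> indicat_real E \<omega> *\<^sub>R F \<omega> r"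
        using limH by (auto intro!: tendsto_intros)
    qed (use measurable_from_subalg[OF sub H] measurable_from_subalg[OF sub F_meas] in auto)
    moreover have "(\<lambda>n. \<integral>\<omega>\<in>E. H (u n) \<omega> \<partial>M) \<longlonglongrightarrow> (\<integral>\<omega>\<in>E. J r \<omega> \<partial>M)"
    proof -
      have "(\<lambda>n. \<integral>\<omega>\<in>E. J (of_rat (u n)) \<omega> \<partial>M) \<longlonglongrightarrow> (\<integral>\<omega>\<in>E. J r \<omega> \<partial>M)"
        unfolding set_lebesgue_integral_def
      proof (rule integral_dominated_convergence[where w="\<lambda>_. 1"])
        show "AE \<omega> in M. (\<lambda>n. indicat_real E \<omega> *\<^sub>R J (of_rat (u n)) \<omega>) \<longlonglongrightarrow> indicat_real E \<omega> *\<^sub>R J r \<omega>"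
        proof (intro AE_I2 tendsto_scaleR tendsto_const)
          fix \<omega>
          show "(\<lambda>n. J (of_rat (u n)) \<omega>) \<longlonglongrightarrow> J r \<omega>"
          proof (cases "Y \<omega> \<le> r")
            case True
            then have "J (of_rat (u n)) \<omega> = J r \<omega>" for n
              using u(1)[of n] by (auto simp: J_def indicator_def)
            then show ?thesis by simp
          next
            case False
            then have "\<forall>\<^sub>F n in sequentially. of_rat (u n) < Y \<omega>" using u(2) by (intro order_tendstoD(2)) auto
            then have "\<forall>\<^sub>F n in sequentially. J (of_rat (u n)) \<omega> = J r \<omega>"
              by eventually_elim (use False in \<open>auto simp: J_def indicator_def\<close>)
            then show ?thesis by (rule tendsto_eventually)
          qed
        qed
      qed (auto simp: J_def indicator_def)
      moreover have "(\<integral>\<omega>\<in>E. J (of_rat (u n)) \<omega> \<partial>M) = (\<integral>\<omega>\<in>E. H (u n) \<omega> \<partial>M)" for n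
      proof -
        have "(\<integral>\<omega>\<in>E. J (of_rat (u n)) \<omega> \<partial>M) = (\<integral>\<omega>. indicat_real (E \<inter> {\<omega>\<in>space M. Y \<omega> \<le> of_rat (u n)}) \<omega> \<partial>M)"
          unfolding set_lebesgue_integral_def J_def
          by (intro Bochner_Integration.integral_cong) (auto simp: indicator_def)
        then show ?thesis by (simp add: GE)
      qed
      ultimately show ?thesis by simp
    qed
    ultimately have "(\<integral>\<omega>\<in>E. F \<omega> r \<partial>M) = (\<integral>\<omega>\<in>E. J r \<omega> \<partial>M)" using LIMSEQ_unique by blast
    also have "\<dots> = (\<integral>\<omega>. indicat_real (E \<inter> {\<omega>\<in>space M. Y \<omega> \<in> {..r}}) \<omega> \<partial>M)"
      unfolding set_lebesgue_integral_def J_def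
      by (intro Bochner_Integration.integral_cong) (auto simp: indicator_def)
    also have "\<dots> = measure M (E \<inter> {\<omega>\<in>space M. Y \<omega> \<in> {..r}})" by simp
    finally show ?thesis
      using nn_set_integral_kernel[OF \<kappa>U _ E, of "{..r}"] by (simp add: Iic emeasure_eq_measure)
  qed
  have "cond_law Y \<kappa>"
  proof (subst cond_law_iff[OF Y \<kappa>U], intro ballI)
    fix B :: "real set" and E assume B: "B \<in> sets borel" and E: "E \<in> sets U"
    note [measurable] = sets_U_M[OF E] E
    define \<mu> where "\<mu> = distr (density M (indicator E)) borel Y"
    define \<nu> where "\<nu> = density UR (indicator E) \<bind> \<kappa>"
    have [measurable_cong]: "sets UR = sets U" by (rule sets_restr_to_subalg[OF sub])
    have ne: "space (density UR (indicator E)) \<noteq> {}" using not_empty by (simp add: space_restr_to_subalg)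
    have \<kappa>S: "\<kappa> \<in> density UR (indicator E) \<rightarrow>\<^sub>M subprob_algebra borel"
      using measurable_in_subalg[OF sub measurable_prob_algebraD[OF \<kappa>U]] by simp
    have e\<mu>: "emeasure \<mu> S = emeasure M (E \<inter> {\<omega>\<in>space M. Y \<omega> \<in> S})" if [measurable]: "S \<in> sets borel" for S
      unfolding \<mu>_def
      by (subst emeasure_distr, simp, simp, subst emeasure_density)
         (auto simp: nn_integral_indicator[symmetric] indicator_inter_arith[symmetric]
           simp del: nn_integral_indicator intro!: nn_integral_cong split: split_indicator)
    have e\<nu>: "emeasure \<nu> S = (\<integral>\<^sup>+\<omega>. indicator E \<omega> * emeasure (\<kappa> \<omega>) S \<partial>M)" if S[measurable]: "S \<in> sets borel" for S
    proof -
      have [measurable]: "(\<lambda>\<omega>. emeasure (\<kappa> \<omega>) S) \<in> borel_measurable U"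
        using measurable_compose[OF measurable_prob_algebraD[OF \<kappa>U] measurable_emeasure_subprob_algebra[OF S]] .
      have "emeasure \<nu> S = (\<integral>\<^sup>+\<omega>. emeasure (\<kappa> \<omega>) S \<partial>density UR (indicator E))"
        unfolding \<nu>_def by (rule emeasure_bind[OF ne \<kappa>S S])
      also have "\<dots> = (\<integral>\<^sup>+\<omega>. indicator E \<omega> * emeasure (\<kappa> \<omega>) S \<partial>UR)"
        by (rule nn_integral_density) measurable
      also have "\<dots> = (\<integral>\<^sup>+\<omega>. indicator E \<omega> * emeasure (\<kappa> \<omega>) S \<partial>M)"
        by (rule nn_integral_subalgebra2[OF sub]) measurable
      finally show ?thesis .
    qed
    have "\<mu> = \<nu>"
    proof (rule measure_eqI_generator_eq[where E="range (\<lambda>r::real. {..r})" and \<Omega>=UNIV and A="\<lambda>n::nat. {..real n}"])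
      show "Int_stable (range (\<lambda>r::real. {..r}))" by (auto simp: Int_stable_def)
      have "sets borel = sigma_sets UNIV (range (\<lambda>r::real. {..r}))" by (subst borel_eq_atMost) simp
      moreover have "sets \<nu> = sets borel" unfolding \<nu>_def by (rule sets_bind[OF sets_kernel[OF \<kappa>S] ne])
      ultimately show "sets \<mu> = sigma_sets UNIV (range (\<lambda>r::real. {..r}))"
        "sets \<nu> = sigma_sets UNIV (range (\<lambda>r::real. {..r}))" by (simp_all add: \<mu>_def)
      show "(\<Union>n::nat. {..real n}) = UNIV" by (auto simp: real_arch_simple)
      show "emeasure \<mu> {..real n} \<noteq> \<infinity>" for n by (simp add: e\<mu>)
      fix S assume "S \<in> range (\<lambda>r::real. {..r})"
      then show "emeasure \<mu> S = emeasure \<nu> S"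
        by (elim rangeE) (simp only: e\<mu>[OF atMost_borel] e\<nu>[OF atMost_borel] ray[OF E])
    qed auto
    then show "emeasure M (E \<inter> {\<omega>\<in>space M. Y \<omega> \<in> B}) = (\<integral>\<^sup>+\<omega>. indicator E \<omega> * emeasure (\<kappa> \<omega>) B \<partial>M)"
      using e\<mu>[OF B] e\<nu>[OF B] by simp
  qed
  with on that show thesis by blast
qed

text \<open>
  The essential supremum norm is at most \<open>c\<close>, so that the support condition on the chosen version
  is satisfiable and implies the stated one.
\<close>

lemma cond_distr_regular:
  fixes Y :: "'w \<Rightarrow> real"
  assumes Y[measurable]: "Y \<in> borel_measurable M" and bound: "AE \<omega> in M. \<bar>Y \<omega>\<bar> \<le> c"
  shows "cond_law Y (cond_distr M U Y)" "\<And>\<omega>. \<omega> \<in> space M \<Longrightarrow> cond_distr M U Y \<omega> \<in> prob_on {-c..c}"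
proof -
  have le: "Linf_norm M Y \<le> ereal c"
    unfolding Linf_norm_def by (rule esssup_I) (use bound in auto)
  have AE: "AE \<omega> in M. ereal \<bar>Y \<omega>\<bar> \<le> Linf_norm M Y"
    unfolding Linf_norm_def by (rule esssup_AE)
  then have "AE \<omega> in M. 0 \<le> Linf_norm M Y" by eventually_elim (rule order_trans[rotated], auto)
  then have "0 \<le> Linf_norm M Y" by simp
  with le obtain l where l: "Linf_norm M Y = ereal l" "0 \<le> l" "l \<le> c"
    by (cases "Linf_norm M Y") auto
  have set_eq: "{y. ereal \<bar>y\<bar> \<le> Linf_norm M Y} = {-l..l}" by (auto simp: l)
  have "AE \<omega> in M. \<bar>Y \<omega>\<bar> \<le> l" using AE by (simp add: l)
  then obtain \<kappa> where \<kappa>: "cond_law Y \<kappa>" "\<And>\<omega>. \<omega> \<in> space M \<Longrightarrow> \<kappa> \<omega> \<in> prob_on {-l..l}"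
    using regular_cond_law_exists[OF Y _ l(2)] by blast
  have \<kappa>U: "\<kappa> \<in> U \<rightarrow>\<^sub>M prob_algebra borel" using \<kappa>(1) by (simp add: cond_law_def)
  have "is_cond_distr M U Y \<kappa>"
    unfolding is_cond_distr_def set_eq
  proof (intro conjI ballI)
    fix B :: "real set" assume B: "B \<in> sets borel"
    show "(\<lambda>\<omega>. measure (\<kappa> \<omega>) B) \<in> borel_measurable U" by (rule kernel_integrable(2)[OF \<kappa>U B])
    show "AE \<omega> in M. measure (\<kappa> \<omega>) B = cond_probability M U {\<omega>'\<in>space M. Y \<omega>' \<in> B} \<omega>"
      using \<kappa>(1) B by (auto simp: cond_law_def elim: eventually_mono)
  qed (use \<kappa>(2) in auto)
  then have cd: "is_cond_distr M U Y (cond_distr M U Y)"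
    unfolding cond_distr_def by (rule someI[of "is_cond_distr M U Y"])
  have on: "cond_distr M U Y \<omega> \<in> prob_on {-l..l}" if "\<omega> \<in> space M" for \<omega>
    using cd that unfolding is_cond_distr_def set_eq by blast
  show "cond_distr M U Y \<omega> \<in> prob_on {-c..c}" if "\<omega> \<in> space M" for \<omega>
    using prob_on_mono[OF on[OF that], of "{-c..c}"] l(3) by auto
  have "cond_distr M U Y \<in> U \<rightarrow>\<^sub>M prob_algebra borel"
  proof (intro measurable_prob_algebraI measurable_subprob_algebra)
    fix \<omega> assume "\<omega> \<in> space U"
    then have "\<omega> \<in> space M" by (simp add: space_U)
    from prob_onD[OF on[OF this]]
    show "prob_space (cond_distr M U Y \<omega>)" "subprob_space (cond_distr M U Y \<omega>)"
      "sets (cond_distr M U Y \<omega>) = sets borel" by (auto intro: prob_space_imp_subprob_space)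
  next
    fix B :: "real set" assume B: "B \<in> sets borel"
    have "(\<lambda>\<omega>. ennreal (measure (cond_distr M U Y \<omega>) B)) \<in> borel_measurable U"
      using cd B by (auto simp: is_cond_distr_def)
    moreover have "emeasure (cond_distr M U Y \<omega>) B = ennreal (measure (cond_distr M U Y \<omega>) B)"
      if "\<omega> \<in> space U" for \<omega>
    proof -
      interpret k: prob_space "cond_distr M U Y \<omega>" using prob_onD[OF on] that by (simp add: space_U)
      show ?thesis by (rule k.emeasure_eq_measure)
    qed
    ultimately show "(\<lambda>\<omega>. emeasure (cond_distr M U Y \<omega>) B) \<in> borel_measurable U"
      by (simp cong: measurable_cong)
  qed
  then show "cond_law Y (cond_distr M U Y)"
    using cd by (auto simp: cond_law_def is_cond_distr_def elim: eventually_mono)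
qed

text \<open>
  The conditional law of the real code of \<open>A\<close>, decoded.
\<close>

lemma cond_law_compact_exists:
  fixes A :: "'w \<Rightarrow> 'a::polish_space"
  assumes A[measurable]: "A \<in> M \<rightarrow>\<^sub>M borel" and "compact K" and AK: "AE \<omega> in M. A \<omega> \<in> K"
  obtains \<kappa> where "cond_law A \<kappa>" "\<And>\<omega>. \<omega> \<in> space M \<Longrightarrow> \<kappa> \<omega> \<in> prob_on K"
proof -
  have "K \<noteq> {}"
  proof
    assume "K = {}"
    then have "AE \<omega> in M. False" using AK by simp
    then show False by simp
  qed
  then obtain s :: "'a \<Rightarrow> real" and S h where s[measurable]: "s \<in> borel_measurable borel"
    and h[measurable]: "h \<in> borel_measurable borel" and S: "closed S" "S \<subseteq> {0..2}"
    and hK: "\<And>y. h y \<in> K" and sK: "\<And>a. a \<in> K \<Longrightarrow> s a \<in> S" and hs: "\<And>a. a \<in> K \<Longrightarrow> h (s a) = a"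
    using compact_coded_by_reals[OF \<open>compact K\<close>] by metis
  define Y where "Y \<omega> = s (A \<omega>)" for \<omega>
  have Y[measurable]: "Y \<in> borel_measurable M" unfolding Y_def by measurable
  have "AE \<omega> in M. \<bar>Y \<omega>\<bar> \<le> 2"
    using AK by eventually_elim (use sK S(2) in \<open>force simp: Y_def\<close>)
  then obtain \<eta> where \<eta>: "cond_law Y \<eta>"
    using regular_cond_law_exists[OF Y, of 2] by auto
  have \<eta>U: "\<eta> \<in> U \<rightarrow>\<^sub>M prob_algebra borel" using \<eta> by (simp add: cond_law_def)
  define \<kappa> where "\<kappa> \<omega> = distr (\<eta> \<omega>) borel h" for \<omega>
  have \<kappa>U: "\<kappa> \<in> U \<rightarrow>\<^sub>M prob_algebra borel"
    unfolding \<kappa>_def by (rule measurable_compose[OF \<eta>U measurable_distr_prob_space[OF h]])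
  have "cond_law A \<kappa>"
  proof (subst cond_law_iff[OF A \<kappa>U], intro ballI)
    fix B :: "'a set" and E assume B[measurable]: "B \<in> sets borel" and E: "E \<in> sets U"
    have hB: "h -` B \<in> sets borel" using measurable_sets[OF h B] by simp
    have [measurable]: "E \<in> sets M" by (rule sets_U_M[OF E])
    have "emeasure M (E \<inter> {\<omega>\<in>space M. A \<omega> \<in> B}) = emeasure M (E \<inter> {\<omega>\<in>space M. Y \<omega> \<in> h -` B})"
    proof (rule emeasure_eq_AE)
      show "AE \<omega> in M. \<omega> \<in> E \<inter> {\<omega>\<in>space M. A \<omega> \<in> B} \<longleftrightarrow> \<omega> \<in> E \<inter> {\<omega>\<in>space M. Y \<omega> \<in> h -` B}"
        using AK by eventually_elim (simp add: Y_def hs)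
      show "E \<inter> {\<omega>\<in>space M. A \<omega> \<in> B} \<in> sets M" by (intro sets.Int) measurable
      show "E \<inter> {\<omega>\<in>space M. Y \<omega> \<in> h -` B} \<in> sets M"
        using hB by (intro sets.Int) measurable
    qed
    also have "\<dots> = (\<integral>\<^sup>+\<omega>. indicator E \<omega> * emeasure (\<eta> \<omega>) (h -` B) \<partial>M)"
      using \<eta> cond_law_iff[OF Y \<eta>U] hB E by blast
    also have "\<dots> = (\<integral>\<^sup>+\<omega>. indicator E \<omega> * emeasure (\<kappa> \<omega>) B \<partial>M)"
    proof (intro nn_integral_cong)
      fix \<omega> assume "\<omega> \<in> space M"
      from prob_onD[OF kernel_prob_on[OF \<eta>U this]]
      have "emeasure (\<kappa> \<omega>) B = emeasure (\<eta> \<omega>) (h -` B)"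
        unfolding \<kappa>_def by (subst emeasure_distr) (simp_all cong: measurable_cong_sets)
      then show "indicator E \<omega> * emeasure (\<eta> \<omega>) (h -` B) = indicator E \<omega> * emeasure (\<kappa> \<omega>) B" by simp
    qed
    finally show "emeasure M (E \<inter> {\<omega>\<in>space M. A \<omega> \<in> B}) = (\<integral>\<^sup>+\<omega>. indicator E \<omega> * emeasure (\<kappa> \<omega>) B \<partial>M)" .
  qed
  moreover have "\<kappa> \<omega> \<in> prob_on K" if "\<omega> \<in> space M" for \<omega>
    unfolding \<kappa>_def
    by (rule distr_prob_on[OF kernel_prob_on[OF \<eta>U that] h hK])
       (simp add: compact_imp_closed[OF \<open>compact K\<close>])
  ultimately show thesis using that by blast
qed

text \<open>
  The exceptional null set is common to all risk measures. This matters because the risk measure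
  of a stage is selected by the current state, hence depends on \<open>\<omega>\<close>.
\<close>

lemma cond_distr_risk_shift:
  fixes Y :: "'w \<Rightarrow> real"
  assumes Y: "Y \<in> borel_measurable M" "AE \<omega> in M. \<bar>Y \<omega>\<bar> \<le> B"
    and Z: "Z \<in> borel_measurable M" "cond_law Z \<eta>" "\<forall>\<omega>\<in>space M. \<eta> \<omega> \<in> prob_on {-B'..B'}"
  shows "(AE \<omega> in M. Y \<omega> \<le> Z \<omega> + c) \<Longrightarrow>
      AE \<omega> in M. \<forall>\<sigma>. risk_measure \<sigma> \<longrightarrow> \<sigma> (cond_distr M U Y \<omega>) \<le> \<sigma> (\<eta> \<omega>) + ereal c"
    and "(AE \<omega> in M. Z \<omega> \<le> Y \<omega> + c) \<Longrightarrow>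
      AE \<omega> in M. \<forall>\<sigma>. risk_measure \<sigma> \<longrightarrow> \<sigma> (\<eta> \<omega>) \<le> \<sigma> (cond_distr M U Y \<omega>) + ereal c"
proof -
  note cd = cond_distr_regular[OF Y]
  have bdd: "cond_distr M U Y \<omega> \<in> prob_bdd" "\<eta> \<omega> \<in> prob_bdd" if "\<omega> \<in> space M" for \<omega>
    using prob_bddI cd(2) Z(3) that by blast+
  show "AE \<omega> in M. \<forall>\<sigma>. risk_measure \<sigma> \<longrightarrow> \<sigma> (cond_distr M U Y \<omega>) \<le> \<sigma> (\<eta> \<omega>) + ereal c"
    if "AE \<omega> in M. Y \<omega> \<le> Z \<omega> + c"
    using cond_law_stochastic_order[OF Y(1) Z(1) cd(1) Z(2) that] AE_space
    by eventually_elim (use bdd risk_shift_mono in blast)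
  show "AE \<omega> in M. \<forall>\<sigma>. risk_measure \<sigma> \<longrightarrow> \<sigma> (\<eta> \<omega>) \<le> \<sigma> (cond_distr M U Y \<omega>) + ereal c"
    if "AE \<omega> in M. Z \<omega> \<le> Y \<omega> + c"
    using cond_law_stochastic_order[OF Z(1) Y(1) Z(2) cd(1) that] AE_space
    by eventually_elim (use bdd risk_shift_mono in blast)
qed

end

section \<open>Measurable selection of minimisers\<close>

lemma le_of_liminf_le:
  fixes u :: "nat \<Rightarrow> real"
  assumes "ereal a \<le> liminf (\<lambda>n. ereal (u n))" "\<forall>\<^sub>F n in sequentially. u n \<le> s n" "s \<longlonglongrightarrow> c"
  shows "a \<le> c"
proof -
  have "ereal a \<le> liminf (\<lambda>n. ereal (u n))" by fact
  also have "\<dots> \<le> liminf (\<lambda>n. ereal (s n))" using assms(2) by (intro Liminf_mono) (auto elim: eventually_mono)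
  also have "\<dots> = ereal c" using assms(3) by (intro lim_imp_Liminf) auto
  finally show ?thesis by simp
qed

text \<open>
  Minimise the criteria one after the other, each among the minimisers of the preceding ones.
  Feasibility of prescribed upper bounds is a closed condition on the state and the bounds, by
  compactness; hence each successive minimum is a Borel function of the state, although the set
  of minimisers itself need not depend on the state semicontinuously. A point that attains all
  minima exists, again by compactness.
\<close>

lemma lexicographic_minimal_selection:
  fixes D :: "'x::polish_space \<Rightarrow> 'l set" and \<phi> :: "nat \<Rightarrow> 'x \<Rightarrow> 'l \<Rightarrow> real"
  assumes ne: "\<And>x. D x \<noteq> {}" and lower: "\<And>i x l. l \<in> D x \<Longrightarrow> b \<le> \<phi> i x l"
    and cpt: "\<And>xs x ls. \<lbrakk>xs \<longlonglongrightarrow> x; \<And>n. ls n \<in> D (xs n)\<rbrakk> \<Longrightarrow> \<exists>r l. strict_mono (r::nat \<Rightarrow> nat) \<and> l \<in> D x \<and>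
      (\<forall>i. ereal (\<phi> i x l) \<le> liminf (\<lambda>n. ereal (\<phi> i (xs (r n)) (ls (r n)))))"
  obtains d where "\<And>x. d x \<in> D x" "\<And>x l. l \<in> D x \<Longrightarrow> \<phi> 0 x (d x) \<le> \<phi> 0 x l"
    "\<And>i. (\<lambda>x. \<phi> i x (d x)) \<in> borel_measurable borel" "\<And>r. closed {x. \<phi> 0 x (d x) \<le> r}"
proof -
  define feas where "feas k c x = {l \<in> D x. \<forall>i<k. \<phi> i x l \<le> c i}" for k and c :: "nat \<Rightarrow> real" and x
  have feas_closed: "closed {(x, c). feas k c x \<noteq> {}}" for k
    unfolding closed_sequential_limits
  proof (intro allI impI, elim conjE)
    fix zs and z :: "'x \<times> (nat \<Rightarrow> real)"
    assume zs: "\<forall>n. zs n \<in> {(x, c). feas k c x \<noteq> {}}" and lim: "zs \<longlonglongrightarrow> z"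
    define xs where "xs n = fst (zs n)" for n
    define cs where "cs n = snd (zs n)" for n
    have "\<exists>l. l \<in> feas k (cs n) (xs n)" for n using zs[rule_format, of n] by (auto simp: xs_def cs_def split_beta)
    then obtain ls where ls: "\<And>n. ls n \<in> feas k (cs n) (xs n)" by metis
    have "xs \<longlonglongrightarrow> fst z" unfolding xs_def by (rule tendsto_fst[OF lim])
    then obtain r l where r: "strict_mono (r::nat \<Rightarrow> nat)" "l \<in> D (fst z)"
        "\<And>i. ereal (\<phi> i (fst z) l) \<le> liminf (\<lambda>n. ereal (\<phi> i (xs (r n)) (ls (r n))))"
      using cpt[of xs "fst z" ls] ls by (auto simp: feas_def)
    have "\<phi> i (fst z) l \<le> snd z i" if "i < k" for i
    proof (rule le_of_liminf_le[OF r(3)])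
      show "\<forall>\<^sub>F n in sequentially. \<phi> i (xs (r n)) (ls (r n)) \<le> cs (r n) i"
        using ls that by (auto simp: feas_def)
      have "cs \<longlonglongrightarrow> snd z" unfolding cs_def by (rule tendsto_snd[OF lim])
      then have "(\<lambda>n. cs n i) \<longlonglongrightarrow> snd z i"
        by (rule continuous_on_tendsto_compose[OF continuous_on_product_coordinates]) auto
      from LIMSEQ_subseq_LIMSEQ[OF this r(1)] show "(\<lambda>n. cs (r n) i) \<longlonglongrightarrow> snd z i" by (simp add: o_def)
    qed
    then have "l \<in> feas k (snd z) (fst z)" using r(2) by (auto simp: feas_def)
    then show "z \<in> {(x, c). feas k c x \<noteq> {}}" by (auto simp: split_beta)
  qed
  \<comment> \<open>\<open>v k x\<close> lists the first \<open>k\<close> successive minima, padded with zeros.\<close>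
  define v :: "nat \<Rightarrow> 'x \<Rightarrow> nat \<Rightarrow> real" where
    "v = rec_nat (\<lambda>x _. 0) (\<lambda>k vk x. (vk x)(k := Inf (\<phi> k x ` feas k (vk x) x)))"
  have v_Suc: "v (Suc k) x = (v k x)(k := Inf (\<phi> k x ` feas k (v k x) x))" for k x by (simp add: v_def)
  define c where "c x k = Inf (\<phi> k x ` feas k (v k x) x)" for x k
  have v_c: "i < k \<Longrightarrow> v k x i = c x i" for i k x
    by (induction k) (auto simp: v_Suc c_def less_Suc_eq)
  have feas_v: "feas k (v k x) x = feas k (c x) x" for k x by (auto simp: feas_def v_c)
  have c_eq: "c x k = Inf (\<phi> k x ` feas k (c x) x)" for x k by (subst c_def) (simp only: feas_v)
  have bdd: "bdd_below (\<phi> k x ` feas j a x)" for k x j a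
    by (rule bdd_belowI[of _ b]) (auto simp: feas_def lower)
  have attain: "feas k (c x) x \<noteq> {}" for k x
  proof (induction k)
    case 0
    then show ?case using ne[of x] by (auto simp: feas_def)
  next
    case (Suc k)
    have "\<exists>l. l \<in> feas k (c x) x \<and> \<phi> k x l < c x k + 1 / real (Suc n)" for n
    proof -
      have "Inf (\<phi> k x ` feas k (c x) x) < c x k + 1 / real (Suc n)" by (simp add: c_eq[symmetric])
      then show ?thesis using Suc bdd by (subst (asm) cInf_less_iff) auto
    qed
    then obtain ls where ls: "\<And>n. ls n \<in> feas k (c x) x" "\<And>n. \<phi> k x (ls n) < c x k + 1 / real (Suc n)" by metis
    obtain r l where r: "strict_mono (r::nat \<Rightarrow> nat)" "l \<in> D x"
        "\<And>i. ereal (\<phi> i x l) \<le> liminf (\<lambda>n. ereal (\<phi> i x (ls (r n))))"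
      using cpt[of "\<lambda>_. x" x ls] ls(1) by (auto simp: feas_def)
    have "\<phi> i x l \<le> c x i" if "i < k" for i
      by (rule le_of_liminf_le[OF r(3) _ tendsto_const]) (use ls(1) that in \<open>auto simp: feas_def\<close>)
    moreover have "\<phi> k x l \<le> c x k"
    proof (rule le_of_liminf_le[OF r(3)])
      show "\<forall>\<^sub>F n in sequentially. \<phi> k x (ls (r n)) \<le> c x k + 1 / real (Suc (r n))"
        using less_imp_le[OF ls(2)] by (intro always_eventually) auto
      have "(\<lambda>n. c x k + 1 / real (Suc n)) \<longlonglongrightarrow> c x k"
        using tendsto_add[OF tendsto_const LIMSEQ_Suc[OF lim_1_over_n], of "c x k"] by simp
      from LIMSEQ_subseq_LIMSEQ[OF this r(1)]
      show "(\<lambda>n. c x k + 1 / real (Suc (r n))) \<longlonglongrightarrow> c x k" by (simp add: o_def)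
    qed
    ultimately have "l \<in> feas (Suc k) (c x) x" using r(2) by (auto simp: feas_def less_Suc_eq)
    then show ?case by auto
  qed
  have "\<exists>l. l \<in> D x \<and> (\<forall>i. \<phi> i x l = c x i)" for x
  proof -
    have "\<forall>k. \<exists>l. l \<in> feas k (c x) x" using attain by auto
    then obtain ls where ls: "\<And>k. ls k \<in> feas k (c x) x" by metis
    obtain r l where r: "strict_mono (r::nat \<Rightarrow> nat)" "l \<in> D x"
        "\<And>i. ereal (\<phi> i x l) \<le> liminf (\<lambda>n. ereal (\<phi> i x (ls (r n))))"
      using cpt[of "\<lambda>_. x" x ls] ls(1) by (auto simp: feas_def)
    have le: "\<phi> i x l \<le> c x i" for i
    proof (rule le_of_liminf_le[OF r(3) _ tendsto_const])
      have "\<forall>\<^sub>F n in sequentially. i < r n"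
        using filterlim_subseq[OF r(1)] eventually_gt_at_top[of i] by (auto simp: filterlim_iff)
      then show "\<forall>\<^sub>F n in sequentially. \<phi> i x (ls (r n)) \<le> c x i"
        by eventually_elim (use ls in \<open>auto simp: feas_def\<close>)
    qed
    have "c x i \<le> \<phi> i x l" for i
      unfolding c_eq[of x i] using le r(2) by (intro cINF_lower bdd) (auto simp: feas_def)
    with le r(2) show ?thesis by (intro exI[of _ l]) (auto intro: antisym)
  qed
  then obtain d where d: "\<And>x. d x \<in> D x" "\<And>x i. \<phi> i x (d x) = c x i" by metis
  have sublevel: "c x k \<le> r \<longleftrightarrow> feas (Suc k) ((v k x)(k := r)) x \<noteq> {}" for x k r
  proof
    assume "c x k \<le> r"
    moreover obtain l where "l \<in> feas (Suc k) (c x) x" using attain[of "Suc k" x] by auto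
    ultimately have "l \<in> feas (Suc k) ((v k x)(k := r)) x"
      by (auto simp: feas_def v_c less_Suc_eq intro: order_trans)
    then show "feas (Suc k) ((v k x)(k := r)) x \<noteq> {}" by auto
  next
    assume "feas (Suc k) ((v k x)(k := r)) x \<noteq> {}"
    then obtain l where "l \<in> feas (Suc k) ((v k x)(k := r)) x" by auto
    then have lD: "l \<in> D x" and le: "\<And>i. i < Suc k \<Longrightarrow> \<phi> i x l \<le> ((v k x)(k := r)) i"
      by (auto simp: feas_def)
    have "\<phi> i x l \<le> c x i" if "i < k" for i
      using le[of i] v_c[OF that, of x] that by simp
    with lD le[of k] have l: "l \<in> feas k (c x) x" "\<phi> k x l \<le> r" by (simp_all add: feas_def)
    have "c x k \<le> \<phi> k x l" unfolding c_eq[of x k] by (rule cINF_lower[OF bdd l(1)])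
    then show "c x k \<le> r" using l(2) by simp
  qed
  have coord: "(\<lambda>x. f x i) \<in> borel_measurable borel" if "f \<in> borel_measurable borel" for f :: "'x \<Rightarrow> nat \<Rightarrow> real" and i
    using that by (rule measurable_product_then_coordinatewise)
  have c_meas': "(\<lambda>x. c x k) \<in> borel_measurable borel" if [measurable]: "v k \<in> borel_measurable borel" for k
  proof (subst borel_measurable_iff_le, intro allI)
    fix r :: real
    have "(\<lambda>x. (v k x)(k := r)) \<in> borel_measurable borel"
    proof (rule measurable_coordinatewise_then_product)
      show "(\<lambda>x. ((v k x)(k := r)) i) \<in> borel_measurable borel" for i
        using coord[OF that, of i] by (cases "i = k") auto
    qed
    then have "(\<lambda>x. (x, (v k x)(k := r))) \<in> borel \<rightarrow>\<^sub>M borel"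
      by (subst borel_prod[symmetric]) measurable
    from measurable_sets[OF this borel_closed[OF feas_closed[of "Suc k"]]]
    show "{x \<in> space borel. c x k \<le> r} \<in> sets borel" by (simp add: sublevel vimage_def)
  qed
  have v_meas: "v k \<in> borel_measurable borel" for k
  proof (induction k)
    case 0
    have "v 0 = (\<lambda>x _. 0)" by (simp add: v_def)
    then show ?case by simp
  next
    case (Suc k)
    show ?case
    proof (rule measurable_coordinatewise_then_product)
      show "(\<lambda>x. v (Suc k) x i) \<in> borel_measurable borel" for i
        using coord[OF Suc, of i] c_meas'[OF Suc] by (cases "i = k") (auto simp: v_Suc c_def)
    qed
  qed
  show thesis
  proof (rule that[of d])
    show "d x \<in> D x" for x by (rule d(1))
    show "(\<lambda>x. \<phi> i x (d x)) \<in> borel_measurable borel" for i using c_meas'[OF v_meas, of i] by (simp add: d(2))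
    show "\<phi> 0 x (d x) \<le> \<phi> 0 x l" if "l \<in> D x" for x l
      unfolding d(2) c_eq[of x 0] by (rule cINF_lower[OF bdd]) (simp add: feas_def that)
    show "closed {x. \<phi> 0 x (d x) \<le> r}" for r
    proof -
      have "{x. \<phi> 0 x (d x) \<le> r} = (\<lambda>x. (x, \<lambda>_. r)) -` {(x, c). feas (Suc 0) c x \<noteq> {}}"
        by (auto simp: d(2) sublevel feas_def)
      also have "closed \<dots>"
        by (intro closed_vimage feas_closed continuous_intros)
      finally show ?thesis .
    qed
  qed
qed

section \<open>One stage of the control problem\<close>

text \<open>
  Convergence is required for the ramps of \<open>V\<close> only: they are uniformly continuous, which is what
  the estimates below can use.
\<close>

lemma portmanteau_open:
  fixes V :: "'z::metric_space set"
  assumes "open V" and \<mu>: "\<mu> \<in> prob_on UNIV" and \<mu>s: "\<And>n. \<mu>s n \<in> prob_on UNIV"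
    and lim: "\<And>k. (\<lambda>n. \<integral>z. open_ramp V k z \<partial>\<mu>s n) \<longlonglongrightarrow> (\<integral>z. open_ramp V k z \<partial>\<mu>)"
    and "t < measure \<mu> V"
  shows "\<forall>\<^sub>F n in sequentially. t < measure (\<mu>s n) V"
proof -
  have "\<forall>\<^sub>F k in sequentially. t < (\<integral>z. open_ramp V k z \<partial>\<mu>)"
    using lebesgue_integral_ramp_tendsto[OF \<mu> \<open>open V\<close>] \<open>t < measure \<mu> V\<close> by (rule order_tendstoD(1))
  then obtain k where "t < (\<integral>z. open_ramp V k z \<partial>\<mu>)" by (auto dest: eventually_happens)
  from order_tendstoD(1)[OF lim this] show ?thesis
  proof eventually_elim
    case (elim n)
    have "(\<integral>z. open_ramp V k z \<partial>\<mu>s n) \<le> (\<integral>z. indicat_real V z \<partial>\<mu>s n)"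
    proof (rule integral_mono)
      show "integrable (\<mu>s n) (open_ramp V k)"
        by (rule integrable_bounded_prob_on[OF \<mu>s bounded_contD(1)[OF open_ramp_bounded_cont], where c=1])
           (use open_ramp_bounds[of V k] in \<open>auto simp: abs_le_iff intro: order_trans[of _ 0]\<close>)
      show "integrable (\<mu>s n) (indicat_real V)"
        by (rule integrable_bounded_prob_on[OF \<mu>s, where c=1]) (use \<open>open V\<close> in \<open>auto simp: indicator_def\<close>)
      show "open_ramp V k z \<le> indicat_real V z" for z
      proof (cases "z \<in> V")
        case False
        then show ?thesis by (auto simp: open_ramp_def)
      qed (use open_ramp_bounds in auto)
    qed
    also have "\<dots> = measure (\<mu>s n) V" using prob_onD[OF \<mu>s[of n]] \<open>open V\<close> by simp
    finally show ?case using elim by simp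
  qed
qed

lemma open_ramp_uniformly_continuous: "uniformly_continuous_on UNIV (open_ramp V k)"
proof (cases "V = UNIV")
  case False
  have "dist (open_ramp V k x) (open_ramp V k y) \<le> real k * dist x y" for x y
  proof -
    have "dist (open_ramp V k x) (open_ramp V k y) \<le> \<bar>real k * infdist x (- V) - real k * infdist y (- V)\<bar>"
      using False by (simp add: open_ramp_def dist_real_def min_def)
    also have "\<dots> = real k * \<bar>infdist x (- V) - infdist y (- V)\<bar>"
      by (simp add: abs_mult right_diff_distrib[symmetric])
    also have "\<dots> \<le> real k * dist x y" by (intro mult_left_mono infdist_triangle_abs) simp
    finally show ?thesis .
  qed
  then have "k-lipschitz_on UNIV (open_ramp V k)" by (intro lipschitz_onI) auto
  then show ?thesis by (rule lipschitz_on_uniformly_continuous)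
qed (simp add: open_ramp_def[abs_def] uniformly_continuous_on_const)

lemma compact_range_with_limit:
  fixes f :: "nat \<Rightarrow> 'z::topological_space"
  assumes "f \<longlonglongrightarrow> l"
  shows "compact (insert l (range f))"
  unfolding compact_eq_Heine_Borel
proof (intro allI impI, elim conjE)
  fix C assume C: "\<forall>V\<in>C. open V" "insert l (range f) \<subseteq> \<Union>C"
  then obtain V where V: "V \<in> C" "l \<in> V" by auto
  have "\<forall>\<^sub>F n in sequentially. f n \<in> V"
    by (rule topological_tendstoD[OF assms]) (use V C(1) in auto)
  then obtain N where N: "\<And>n. n \<ge> N \<Longrightarrow> f n \<in> V" by (auto simp: eventually_sequentially)
  have "\<forall>n. \<exists>W. W \<in> C \<and> f n \<in> W" using C(2) by auto
  then obtain W where W: "\<And>n. W n \<in> C" "\<And>n. f n \<in> W n" by metis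
  show "\<exists>C'\<subseteq>C. finite C' \<and> insert l (range f) \<subseteq> \<Union>C'"
  proof (intro exI[of _ "insert V (W ` {..<N})"] conjI)
    show "insert l (range f) \<subseteq> \<Union>(insert V (W ` {..<N}))"
    proof
      fix z assume "z \<in> insert l (range f)"
      then consider "z = l" | n where "z = f n" "n \<ge> N" | n where "z = f n" "n < N" by (auto simp: not_less[symmetric])
      then show "z \<in> \<Union>(insert V (W ` {..<N}))"
        by cases (use V N W in auto)
    qed
  qed (use V W in auto)
qed

text \<open>
  The joint law of state, action and successor when the state is \<open>x\<close> and the action has law
  \<open>\<mu>\<close>. Unlike the law of the cost, it depends weakly continuously on
  \<open>x\<close> and \<open>\<mu>\<close>, for laws \<open>\<mu>\<close> on a compact set.
\<close>

definition stage_joint :: "('x::polish_space \<Rightarrow> 'a::polish_space \<Rightarrow> 'x measure) \<Rightarrow> 'x \<Rightarrow> 'a measure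
    \<Rightarrow> ('x \<times> 'a \<times> 'x) measure" where
  "stage_joint Q x \<mu> = \<mu> \<bind> (\<lambda>a. distr (Q x a) borel (\<lambda>y. (x, a, y)))"

definition stage_law :: "('x::polish_space \<Rightarrow> 'a::polish_space \<Rightarrow> 'x measure) \<Rightarrow> ('x \<Rightarrow> 'a \<Rightarrow> 'x \<Rightarrow> real)
    \<Rightarrow> 'x \<Rightarrow> 'a measure \<Rightarrow> real measure" where
  "stage_law Q h x \<mu> = \<mu> \<bind> (\<lambda>a. distr (Q x a) borel (h x a))"

locale weak_kernel =
  fixes Q :: "'x::polish_space \<Rightarrow> 'a::polish_space \<Rightarrow> 'x measure"
  assumes Q: "(\<lambda>(x, a). Q x a) \<in> borel \<Otimes>\<^sub>M borel \<rightarrow>\<^sub>M prob_algebra borel"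
    and Q_weak: "\<And>xs x0 as a0. xs \<longlonglongrightarrow> x0 \<Longrightarrow> as \<longlonglongrightarrow> a0 \<Longrightarrow>
      weakly_converges (\<lambda>n. Q (xs n) (as n)) (Q x0 a0)"
begin

lemma Q_prob: "Q x a \<in> prob_on UNIV"
  using measurable_space[OF Q, of "(x, a)"] by (simp add: space_pair_measure space_prob_algebra_borel)

lemma Q_sets [simp]: "measurable (Q x a) N = measurable borel N" "space (Q x a) = UNIV"
  using prob_onD[OF Q_prob[of x a]] by (simp_all cong: measurable_cong_sets)

lemma triple_measurable: "(\<lambda>y. (x, a, y)) \<in> borel \<rightarrow>\<^sub>M borel"
  by (intro borel_measurable_continuous_onI continuous_intros)

lemma stage_joint_kernel: "(\<lambda>a. distr (Q x a) borel (\<lambda>y. (x, a, y))) \<in> borel \<rightarrow>\<^sub>M prob_algebra borel"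
proof -
  note [measurable] = Q
  have [measurable]: "(\<lambda>(a::'a, y::'x). (x, a, y)) \<in> borel \<Otimes>\<^sub>M borel \<rightarrow>\<^sub>M borel"
    by (subst borel_prod) (auto simp: split_beta' intro!: borel_measurable_continuous_onI continuous_intros)
  show ?thesis by measurable
qed

lemma stage_joint_kernel':
  assumes "\<mu> \<in> prob_on UNIV"
  shows "(\<lambda>a. distr (Q x a) borel (\<lambda>y. (x, a, y))) \<in> \<mu> \<rightarrow>\<^sub>M subprob_algebra borel"
  using measurable_prob_algebraD[OF stage_joint_kernel] prob_onD[OF assms] by (simp cong: measurable_cong_sets)

lemma stage_joint_prob_on:
  assumes "\<mu> \<in> prob_on UNIV"
  shows "stage_joint Q x \<mu> \<in> prob_on UNIV"
proof -
  interpret prob_space \<mu> using prob_onD[OF assms] by simp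
  note K = stage_joint_kernel'[OF assms, of x]
  have "prob_space (stage_joint Q x \<mu>)"
    unfolding stage_joint_def
  proof (rule prob_space_bind[OF _ K])
    show "AE a in \<mu>. prob_space (distr (Q x a) borel (\<lambda>y. (x, a, y)))"
      using prob_onD(1)[OF Q_prob] triple_measurable by (auto intro!: AE_I2 prob_space.prob_space_distr)
  qed
  moreover have "sets (stage_joint Q x \<mu>) = sets borel"
    unfolding stage_joint_def by (rule sets_bind[OF sets_kernel[OF K] not_empty])
  ultimately show ?thesis by (simp add: prob_on_UNIV_iff)
qed

lemma integral_stage_joint:
  fixes f :: "'x \<times> 'a \<times> 'x \<Rightarrow> real"
  assumes \<mu>: "\<mu> \<in> prob_on UNIV" and f[measurable]: "f \<in> borel_measurable borel" and b: "\<And>z. \<bar>f z\<bar> \<le> B"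
  shows "(\<integral>z. f z \<partial>stage_joint Q x \<mu>) = (\<integral>a. \<integral>y. f (x, a, y) \<partial>Q x a \<partial>\<mu>)"
proof -
  interpret prob_space \<mu> using prob_onD[OF \<mu>] by simp
  note K = stage_joint_kernel'[OF \<mu>, of x]
  have "emeasure (Q x a) (space (Q x a)) \<le> ennreal 1" for a
    using prob_space.emeasure_space_1[OF prob_onD(1)[OF Q_prob]] by simp
  then have "(\<integral>z. f z \<partial>stage_joint Q x \<mu>) = (\<integral>a. \<integral>z. f z \<partial>distr (Q x a) borel (\<lambda>y. (x, a, y)) \<partial>\<mu>)"
    unfolding stage_joint_def
    by (intro integral_bind[OF f _ K, where B=B and B'=1]) (auto simp: b emeasure_distr triple_measurable finite_measure_axioms)
  also have "\<dots> = (\<integral>a. \<integral>y. f (x, a, y) \<partial>Q x a \<partial>\<mu>)"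
    by (intro Bochner_Integration.integral_cong refl integral_distr) (auto simp: triple_measurable)
  finally show ?thesis .
qed

lemma stage_law_eq_distr:
  assumes \<mu>: "\<mu> \<in> prob_on UNIV" and h: "(\<lambda>(x, a, y). h x a y) \<in> borel_measurable borel"
  shows "stage_law Q h x \<mu> = distr (stage_joint Q x \<mu>) borel (\<lambda>(x, a, y). h x a y)"
proof -
  interpret prob_space \<mu> using prob_onD[OF \<mu>] by simp
  note K = stage_joint_kernel'[OF \<mu>, of x]
  have "distr (stage_joint Q x \<mu>) borel (\<lambda>(x, a, y). h x a y)
      = \<mu> \<bind> (\<lambda>a. distr (distr (Q x a) borel (\<lambda>y. (x, a, y))) borel (\<lambda>(x, a, y). h x a y))"
    unfolding stage_joint_def by (rule distr_bind[OF K not_empty h])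
  also have "\<dots> = stage_law Q h x \<mu>"
    unfolding stage_law_def
    by (subst distr_distr[OF h]) (auto simp: triple_measurable o_def)
  finally show ?thesis ..
qed

text \<open>
  The integrand moves with the state and the action, so that weak convergence of the kernels is
  combined with uniform continuity of the integrand.
\<close>

lemma continuous_kernel_integral:
  fixes f :: "'x \<times> 'a \<times> 'x \<Rightarrow> real"
  assumes u: "uniformly_continuous_on UNIV f" and b: "f \<in> bounded_cont"
  shows "continuous_on UNIV (\<lambda>(x, a). \<integral>y. f (x, a, y) \<partial>Q x a)"
  unfolding continuous_on_sequentially
proof (intro allI ballI impI, elim conjE)
  fix zs and z :: "'x \<times> 'a" assume lim: "zs \<longlonglongrightarrow> z"
  define xs as x a where "xs n = fst (zs n)" and "as n = snd (zs n)" and "x = fst z" and "a = snd z" for n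
  have xs: "xs \<longlonglongrightarrow> x" and as: "as \<longlonglongrightarrow> a"
    unfolding xs_def as_def x_def a_def by (intro tendsto_fst tendsto_snd lim)+
  obtain B where B: "\<And>z. \<bar>f z\<bar> \<le> B" using bounded_contD(2)[OF b] by auto
  note [measurable] = bounded_contD(1)[OF b]
  have fm: "(\<lambda>y. f (x, a, y)) \<in> borel_measurable borel" for x a
    by (rule measurable_compose[OF triple_measurable]) measurable
  have int: "integrable (Q x' a') (\<lambda>y. f (x'', a'', y))" for x' a' x'' a''
    by (rule integrable_bounded_prob_on[OF Q_prob fm B])
  have "(\<lambda>n. (\<integral>y. f (xs n, as n, y) \<partial>Q (xs n) (as n)) - (\<integral>y. f (x, a, y) \<partial>Q (xs n) (as n))) \<longlonglongrightarrow> 0"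
  proof (rule LIMSEQ_I)
    fix e :: real assume "e > 0"
    then obtain \<delta> where \<delta>: "\<delta> > 0" "\<And>z z'. dist z z' < \<delta> \<Longrightarrow> dist (f z) (f z') < e / 2"
      using u[unfolded uniformly_continuous_on_def, rule_format, of "e / 2"] by (auto simp: dist_commute)
    have "(\<lambda>n. dist (xs n) x + dist (as n) a) \<longlonglongrightarrow> 0 + 0"
      using xs as by (intro tendsto_add) (simp_all add: tendsto_dist_iff[symmetric])
    then have "\<forall>\<^sub>F n in sequentially. dist (xs n) x + dist (as n) a < \<delta>"
      using \<delta>(1) by (intro order_tendstoD(2)) auto
    then obtain N where N: "\<And>n. n \<ge> N \<Longrightarrow> dist (xs n) x + dist (as n) a < \<delta>"
      by (auto simp: eventually_sequentially)
    show "\<exists>N. \<forall>n\<ge>N. norm ((\<integral>y. f (xs n, as n, y) \<partial>Q (xs n) (as n)) - (\<integral>y. f (x, a, y) \<partial>Q (xs n) (as n)) - 0) < e"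
    proof (intro exI[of _ N] allI impI)
      fix n assume n: "n \<ge> N"
      interpret q: prob_space "Q (xs n) (as n)" using prob_onD[OF Q_prob] by auto
      have le: "\<bar>f (xs n, as n, y) - f (x, a, y)\<bar> \<le> e / 2" for y
      proof -
        have "dist (xs n, as n, y) (x, a, y) \<le> dist (xs n) x + dist (as n, y) (a, y)"
          unfolding dist_Pair_Pair[of "xs n"] by (intro sqrt_sum_squares_le_sum) auto
        also have "dist (as n, y) (a, y) = dist (as n) a" by (simp add: dist_Pair_Pair)
        finally have "dist (xs n, as n, y) (x, a, y) < \<delta>" using N[OF n] by simp
        from \<delta>(2)[OF this] show ?thesis by (simp add: dist_real_def)
      qed
      have "norm ((\<integral>y. f (xs n, as n, y) \<partial>Q (xs n) (as n)) - (\<integral>y. f (x, a, y) \<partial>Q (xs n) (as n)))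
          = norm (\<integral>y. f (xs n, as n, y) - f (x, a, y) \<partial>Q (xs n) (as n))"
        by (subst Bochner_Integration.integral_diff[OF int int]) simp
      also have "\<dots> \<le> (\<integral>y. norm (f (xs n, as n, y) - f (x, a, y)) \<partial>Q (xs n) (as n))"
        by (rule integral_norm_bound)
      also have "\<dots> \<le> (\<integral>y. e / 2 \<partial>Q (xs n) (as n))"
        using le by (intro integral_mono integrable_norm Bochner_Integration.integrable_diff int) auto
      also have "\<dots> = e / 2" by (simp add: q.prob_space[simplified])
      finally show "norm ((\<integral>y. f (xs n, as n, y) \<partial>Q (xs n) (as n)) - (\<integral>y. f (x, a, y) \<partial>Q (xs n) (as n)) - 0) < e"
        using \<open>e > 0\<close> by simp
    qed
  qed
  moreover have "(\<lambda>n. \<integral>y. f (x, a, y) \<partial>Q (xs n) (as n)) \<longlonglongrightarrow> (\<integral>y. f (x, a, y) \<partial>Q x a)"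
  proof -
    have "continuous_on UNIV (\<lambda>y. f (x, a, y))"
      by (intro continuous_on_compose2[OF bounded_contD(3)[OF b]] continuous_intros) auto
    then have "(\<lambda>y. f (x, a, y)) \<in> bounded_cont" by (rule bounded_contI[OF _ B])
    then show ?thesis using Q_weak[OF xs as] by (auto simp: weakly_converges_def)
  qed
  ultimately have "(\<lambda>n. \<integral>y. f (xs n, as n, y) \<partial>Q (xs n) (as n)) \<longlonglongrightarrow> (\<integral>y. f (x, a, y) \<partial>Q x a)"
    by (drule_tac tendsto_add) auto
  then show "((\<lambda>(x, a). \<integral>y. f (x, a, y) \<partial>Q x a) \<circ> zs) \<longlonglongrightarrow> (case z of (x, a) \<Rightarrow> \<integral>y. f (x, a, y) \<partial>Q x a)"
    by (simp add: o_def split_beta xs_def as_def x_def a_def)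
qed

text \<open>
  The inner integral is continuous in state and action, hence converges uniformly over the compact
  set of actions, along with the weak convergence of the action laws.
\<close>

lemma stage_joint_integral_tendsto:
  fixes f :: "'x \<times> 'a \<times> 'x \<Rightarrow> real"
  assumes u: "uniformly_continuous_on UNIV f" and b: "f \<in> bounded_cont"
    and "compact K" and xs: "xs \<longlonglongrightarrow> x" and \<mu>s: "\<And>n. \<mu>s n \<in> prob_on K" and \<mu>: "\<mu> \<in> prob_on UNIV"
    and lim: "weakly_converges \<mu>s \<mu>"
  shows "(\<lambda>n. \<integral>z. f z \<partial>stage_joint Q (xs n) (\<mu>s n)) \<longlonglongrightarrow> (\<integral>z. f z \<partial>stage_joint Q x \<mu>)"
proof -
  define G where "G x a = (\<integral>y. f (x, a, y) \<partial>Q x a)" for x a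
  have contG: "continuous_on UNIV (\<lambda>(x, a). G x a)"
    unfolding G_def by (rule continuous_kernel_integral[OF u b])
  obtain B where B: "\<And>z. \<bar>f z\<bar> \<le> B" using bounded_contD(2)[OF b] by auto
  have fm: "(\<lambda>y. f (x, a, y)) \<in> borel_measurable borel" for x a
    by (rule measurable_compose[OF triple_measurable bounded_contD(1)[OF b]])
  have GB: "\<bar>G x a\<bar> \<le> B" for x a
  proof -
    interpret q: prob_space "Q x a" using prob_onD[OF Q_prob] by auto
    have "norm (G x a) \<le> (\<integral>y. norm (f (x, a, y)) \<partial>Q x a)" unfolding G_def by (rule integral_norm_bound)
    also have "\<dots> \<le> (\<integral>y. B \<partial>Q x a)"
      using B by (intro integral_mono integrable_norm integrable_bounded_prob_on[OF Q_prob fm B]) auto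
    also have "\<dots> = B" by (simp add: q.prob_space[simplified])
    finally show ?thesis by simp
  qed
  have Gx: "G x \<in> bounded_cont" for x
    by (rule bounded_contI[OF _ GB])
       (use continuous_on_compose2[OF contG, of UNIV "\<lambda>a. (x, a)"] in
         \<open>simp add: continuous_on_Pair continuous_on_const continuous_on_id\<close>)
  have int: "integrable (\<mu>s n) (G x)" for n x
    by (rule integrable_bounded_prob_on[OF prob_on_subset_UNIV[OF \<mu>s] bounded_contD(1)[OF Gx] GB])
  have "compact (insert x (range xs) \<times> K)"
    by (intro compact_Times \<open>compact K\<close> compact_range_with_limit xs)
  then have uc: "uniformly_continuous_on (insert x (range xs) \<times> K) (\<lambda>(x, a). G x a)"
    using contG by (intro compact_uniformly_continuous) (auto intro: continuous_on_subset)
  have "(\<lambda>n. (\<integral>a. G (xs n) a \<partial>\<mu>s n) - (\<integral>a. G x a \<partial>\<mu>s n)) \<longlonglongrightarrow> 0"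
  proof (rule LIMSEQ_I)
    fix e :: real assume "e > 0"
    then have "e / 2 > 0" by simp
    then obtain \<delta> where \<delta>: "\<delta> > 0" "\<forall>z\<in>insert x (range xs) \<times> K. \<forall>z'\<in>insert x (range xs) \<times> K.
        dist z' z < \<delta> \<longrightarrow> dist (case z' of (x, a) \<Rightarrow> G x a) (case z of (x, a) \<Rightarrow> G x a) < e / 2"
      using uc unfolding uniformly_continuous_on_def by blast
    have "\<forall>\<^sub>F n in sequentially. dist (xs n) x < \<delta>" using xs \<delta>(1) by (rule tendstoD)
    then obtain N where N: "\<And>n. n \<ge> N \<Longrightarrow> dist (xs n) x < \<delta>" by (auto simp: eventually_sequentially)
    show "\<exists>N. \<forall>n\<ge>N. norm ((\<integral>a. G (xs n) a \<partial>\<mu>s n) - (\<integral>a. G x a \<partial>\<mu>s n) - 0) < e"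
    proof (intro exI[of _ N] allI impI)
      fix n assume n: "n \<ge> N"
      interpret l: prob_space "\<mu>s n" using prob_onD[OF \<mu>s] by auto
      have le: "AE a in \<mu>s n. norm (G (xs n) a - G x a) \<le> e / 2"
        using prob_on_AE[OF \<mu>s[of n]]
      proof eventually_elim
        case (elim a)
        have "dist (xs n, a) (x, a) < \<delta>" using N[OF n] by (simp add: dist_Pair_Pair)
        with \<delta>(2)[rule_format, of "(x, a)" "(xs n, a)"] elim show ?case by (simp add: dist_real_def)
      qed
      have "norm ((\<integral>a. G (xs n) a \<partial>\<mu>s n) - (\<integral>a. G x a \<partial>\<mu>s n)) = norm (\<integral>a. G (xs n) a - G x a \<partial>\<mu>s n)"
        by (subst Bochner_Integration.integral_diff[OF int int]) simp
      also have "\<dots> \<le> (\<integral>a. norm (G (xs n) a - G x a) \<partial>\<mu>s n)" by (rule integral_norm_bound)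
      also have "\<dots> \<le> (\<integral>a. e / 2 \<partial>\<mu>s n)"
        using le by (intro integral_mono_AE integrable_norm Bochner_Integration.integrable_diff int) auto
      also have "\<dots> = e / 2" by (simp add: l.prob_space)
      finally show "norm ((\<integral>a. G (xs n) a \<partial>\<mu>s n) - (\<integral>a. G x a \<partial>\<mu>s n) - 0) < e" using \<open>e > 0\<close> by simp
    qed
  qed
  moreover have "(\<lambda>n. \<integral>a. G x a \<partial>\<mu>s n) \<longlonglongrightarrow> (\<integral>a. G x a \<partial>\<mu>)"
    using lim Gx by (auto simp: weakly_converges_def)
  ultimately have "(\<lambda>n. \<integral>a. G (xs n) a \<partial>\<mu>s n) \<longlonglongrightarrow> (\<integral>a. G x a \<partial>\<mu>)"
    by (drule_tac tendsto_add) auto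
  then show ?thesis
    unfolding G_def
    by (simp add: integral_stage_joint[OF prob_on_subset_UNIV[OF \<mu>s] bounded_contD(1)[OF b] B]
      integral_stage_joint[OF \<mu> bounded_contD(1)[OF b] B])
qed

end

text \<open>
  A stage of the control problem with a fixed lower semicontinuous cost \<open>h\<close>, which later contains
  the discounted value of the next stage.
\<close>

locale control_stage = weak_kernel Q for Q :: "'x::polish_space \<Rightarrow> 'a::polish_space \<Rightarrow> 'x measure" +
  fixes \<A> :: "'x \<Rightarrow> 'a set" and \<sigma> :: "'x \<Rightarrow> real measure \<Rightarrow> ereal"
    and h :: "'x \<Rightarrow> 'a \<Rightarrow> 'x \<Rightarrow> real" and c :: real
  assumes A_ne: "\<And>x. \<A> x \<noteq> {}" and A_closed: "\<And>x. closed (\<A> x)"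
    and A_compact: "compact (\<Union>x. \<A> x)" and A_uhc: "upper_hemicontinuous_corr \<A>"
    and \<sigma>_risk: "\<And>x. risk_measure (\<sigma> x)" and \<sigma>_normalized: "\<And>x. \<sigma> x (return borel 0) = 0"
    and \<sigma>_lsc: "\<And>K \<mu>s \<mu>0 xs x0. compact K \<Longrightarrow> (\<And>n. \<mu>s n \<in> prob_on K) \<Longrightarrow>
      \<mu>0 \<in> prob_on K \<Longrightarrow> weakly_converges \<mu>s \<mu>0 \<Longrightarrow> xs \<longlonglongrightarrow> x0 \<Longrightarrow>
      liminf (\<lambda>n. \<sigma> (xs n) (\<mu>s n)) \<ge> \<sigma> x0 \<mu>0"
    and h_lsc: "\<And>r. open {(x, a, y). r < h x a y}" and h_bound: "\<And>x a y. \<bar>h x a y\<bar> \<le> c"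
begin

lemma h_measurable: "(\<lambda>(x, a, y). h x a y) \<in> borel_measurable borel"
proof (subst borel_measurable_iff_greater, intro allI)
  fix r
  have "{w \<in> space borel. r < (case w of (x, a, y) \<Rightarrow> h x a y)} = {(x, a, y). r < h x a y}" by auto
  then show "{w \<in> space borel. r < (case w of (x, a, y) \<Rightarrow> h x a y)} \<in> sets borel"
    using borel_open[OF h_lsc[of r]] by simp
qed

lemma stage_law_prob_on:
  assumes "\<mu> \<in> prob_on UNIV"
  shows "stage_law Q h x \<mu> \<in> prob_on {-c..c}"
  unfolding stage_law_eq_distr[OF assms h_measurable]
  by (rule distr_prob_on[OF stage_joint_prob_on[OF assms] h_measurable])
     (use h_bound in \<open>auto simp: abs_le_iff minus_le_iff\<close>)

definition stage_risk :: "'x \<Rightarrow> 'a measure \<Rightarrow> real" where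
  "stage_risk x \<mu> = real_of_ereal (\<sigma> x (stage_law Q h x \<mu>))"

lemma stage_risk_ereal:
  assumes "\<mu> \<in> prob_on UNIV"
  shows "ereal (stage_risk x \<mu>) = \<sigma> x (stage_law Q h x \<mu>)" "\<bar>stage_risk x \<mu>\<bar> \<le> c"
proof -
  note on = stage_law_prob_on[OF assms, of x]
  show eq: "ereal (stage_risk x \<mu>) = \<sigma> x (stage_law Q h x \<mu>)"
    unfolding stage_risk_def by (rule ereal_real') (rule risk_finite[OF \<sigma>_risk prob_bddI[OF on]])
  show "\<bar>stage_risk x \<mu>\<bar> \<le> c"
    using risk_bounds[OF \<sigma>_risk on, of x] by (simp add: \<sigma>_normalized eq[symmetric] abs_le_iff minus_le_iff)
qed

text \<open>
  The law of a lower semicontinuous cost need not depend continuously on the law of its arguments,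
  but every limit point of the laws is stochastically larger than the law at the limit. Monotonicity
  of the risk measure then transfers its lower semicontinuity.
\<close>

lemma stage_risk_lsc:
  assumes xs: "xs \<longlonglongrightarrow> x" and \<mu>s: "\<And>n. \<mu>s n \<in> prob_on (\<Union>x. \<A> x)" and \<mu>: "\<mu> \<in> prob_on UNIV"
    and lim: "weakly_converges \<mu>s \<mu>"
  shows "ereal (stage_risk x \<mu>) \<le> liminf (\<lambda>n. ereal (stage_risk (xs n) (\<mu>s n)))"
proof -
  define L where "L n = stage_law Q h (xs n) (\<mu>s n)" for n
  define L0 where "L0 = stage_law Q h x \<mu>"
  note \<mu>sU = prob_on_subset_UNIV[OF \<mu>s]
  have L_on: "L n \<in> prob_on {-c..c}" for n unfolding L_def by (rule stage_law_prob_on[OF \<mu>sU])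
  have L0_on: "L0 \<in> prob_on {-c..c}" unfolding L0_def by (rule stage_law_prob_on[OF \<mu>])
  have above: "\<forall>\<^sub>F n in sequentially. t < measure (L n) {r<..}" if "t < measure L0 {r<..}" for t r
  proof -
    define V where "V = {(x, a, y). r < h x a y}"
    have V: "open V" unfolding V_def by (rule h_lsc)
    have eq: "measure (stage_law Q h x' \<nu>) {r<..} = measure (stage_joint Q x' \<nu>) V"
      if "\<nu> \<in> prob_on UNIV" for x' \<nu>
    proof -
      have "(\<lambda>(x, a, y). h x a y) -` {r<..} \<inter> space (stage_joint Q x' \<nu>) = V"
        using prob_onD[OF stage_joint_prob_on[OF that]] by (auto simp: V_def)
      moreover have "(\<lambda>(x, a, y). h x a y) \<in> stage_joint Q x' \<nu> \<rightarrow>\<^sub>M borel"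
        using h_measurable prob_onD[OF stage_joint_prob_on[OF that]] by (simp cong: measurable_cong_sets)
      ultimately show ?thesis
        unfolding stage_law_eq_distr[OF that h_measurable] by (subst measure_distr) auto
    qed
    have "\<forall>\<^sub>F n in sequentially. t < measure (stage_joint Q (xs n) (\<mu>s n)) V"
    proof (rule portmanteau_open[OF V stage_joint_prob_on[OF \<mu>] stage_joint_prob_on[OF \<mu>sU]])
      show "(\<lambda>n. \<integral>z. open_ramp V k z \<partial>stage_joint Q (xs n) (\<mu>s n)) \<longlonglongrightarrow> (\<integral>z. open_ramp V k z \<partial>stage_joint Q x \<mu>)" for k
        by (rule stage_joint_integral_tendsto[OF open_ramp_uniformly_continuous open_ramp_bounded_cont
              A_compact xs \<mu>s \<mu> lim])
      show "t < measure (stage_joint Q x \<mu>) V" using that by (simp add: L0_def eq[OF \<mu>])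
    qed
    then show ?thesis by (simp add: L_def eq[OF \<mu>sU])
  qed
  obtain r where r: "strict_mono (r::nat \<Rightarrow> nat)"
    "((\<lambda>n. \<sigma> (xs n) (L n)) \<circ> r) \<longlonglongrightarrow> liminf (\<lambda>n. \<sigma> (xs n) (L n))"
    using liminf_subseq_lim by blast
  obtain q \<nu> where q: "strict_mono (q::nat \<Rightarrow> nat)" and \<nu>: "\<nu> \<in> prob_on {-c..c}"
    and \<nu>lim: "weakly_converges ((L \<circ> r) \<circ> q) \<nu>"
    using prob_on_compact_weak_compact[of "{-c..c}" "L \<circ> r"] L_on by auto
  have rq: "strict_mono (r \<circ> q)" using r(1) q by (rule strict_mono_o)
  have "\<sigma> x L0 \<le> \<sigma> x \<nu>"
  proof (rule risk_mono[OF \<sigma>_risk prob_bddI[OF L0_on] prob_bddI[OF \<nu>]])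
    fix s :: real
    note \<nu>U = prob_on_subset_UNIV[OF \<nu>] and L0U = prob_on_subset_UNIV[OF L0_on] and LU = prob_on_subset_UNIV[OF L_on]
    interpret \<nu>: real_distribution \<nu> by (rule prob_on_real_distribution[OF \<nu>U])
    interpret L0: real_distribution L0 by (rule prob_on_real_distribution[OF L0U])
    have key: "measure \<nu> {..<s'} + measure L0 {s'<..} \<le> 1" for s'
    proof (rule ccontr)
      assume "\<not> ?thesis"
      then have "1 - measure L0 {s'<..} < measure \<nu> {..<s'}" by simp
      then obtain t where t: "1 - measure L0 {s'<..} < t" "t < measure \<nu> {..<s'}" using dense by blast
      have "\<forall>\<^sub>F n in sequentially. t < measure (((L \<circ> r) \<circ> q) n) {..<s'}"
      proof (rule portmanteau_open[OF _ \<nu>U _ _ t(2)])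
        show "((L \<circ> r) \<circ> q) n \<in> prob_on UNIV" for n using LU by simp
        show "(\<lambda>n. \<integral>z. open_ramp {..<s'} k z \<partial>((L \<circ> r) \<circ> q) n) \<longlonglongrightarrow> (\<integral>z. open_ramp {..<s'} k z \<partial>\<nu>)" for k
          using \<nu>lim open_ramp_bounded_cont by (auto simp: weakly_converges_def)
      qed simp
      moreover have "\<forall>\<^sub>F n in sequentially. 1 - t < measure (((L \<circ> r) \<circ> q) n) {s'<..}"
      proof -
        have "1 - t < measure L0 {s'<..}" using t(1) by simp
        from above[OF this] have "\<forall>\<^sub>F n in sequentially. 1 - t < measure (L ((r \<circ> q) n)) {s'<..}"
          using filterlim_subseq[OF rq] by (rule eventually_compose_filterlim)
        then show ?thesis by simp
      qed
      ultimately have "\<forall>\<^sub>F n in sequentially. False"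
      proof eventually_elim
        case (elim n)
        let ?m = "((L \<circ> r) \<circ> q) n"
        have m: "?m \<in> prob_on UNIV" using LU by simp
        interpret m: prob_space ?m using prob_onD[OF m] by simp
        have "measure ?m {..<s'} + measure ?m {s'<..} = measure ?m ({..<s'} \<union> {s'<..})"
          using prob_onD[OF m] by (intro m.finite_measure_Union[symmetric]) auto
        also have "\<dots> \<le> 1" by (rule m.prob_le_1)
        finally show False using elim by simp
      qed
      then show False by simp
    qed
    have le: "measure \<nu> {..s} \<le> measure L0 {..s'}" if "s < s'" for s'
    proof -
      have "measure \<nu> {..s} \<le> measure \<nu> {..<s'}" using that by (intro \<nu>.finite_measure_mono) auto
      also have "\<dots> \<le> 1 - measure L0 {s'<..}" using key[of s'] by simp
      also have "\<dots> = measure L0 {..s'}"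
      proof -
        have "space L0 - {s'<..} = {..s'}" by auto
        then show ?thesis using L0.prob_compl[of "{s'<..}"] by simp
      qed
      finally show ?thesis .
    qed
    show "measure \<nu> {..s} \<le> measure L0 {..s}"
    proof (rule tendsto_lowerbound)
      show "(cdf L0 \<longlongrightarrow> measure L0 {..s}) (at_right s)"
        using L0.cdf_is_right_cont[of s] by (simp add: continuous_within cdf_def)
      show "\<forall>\<^sub>F s' in at_right s. measure \<nu> {..s} \<le> cdf L0 s'"
        using le by (auto simp: eventually_at_filter cdf_def)
    qed simp
  qed
  also have "\<dots> \<le> liminf (\<lambda>n. \<sigma> ((xs \<circ> (r \<circ> q)) n) ((L \<circ> r \<circ> q) n))"
    using L_on by (intro \<sigma>_lsc[of "{-c..c}"] \<nu> \<nu>lim LIMSEQ_subseq_LIMSEQ[OF xs rq]) auto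
  also have "\<dots> = liminf (\<lambda>n. \<sigma> (xs n) (L n))"
    using LIMSEQ_subseq_LIMSEQ[OF r(2) q] by (intro lim_imp_Liminf) (auto simp: o_def)
  finally show ?thesis
    by (simp add: stage_risk_ereal(1)[OF \<mu>] stage_risk_ereal(1)[OF \<mu>sU] L_def L0_def)
qed

lemma A_borel: "\<A> x \<in> sets borel" and A_union_borel: "(\<Union>x. \<A> x) \<in> sets borel"
  using A_closed A_compact by (auto intro: borel_closed compact_imp_closed)

lemma prob_on_A_union: "\<mu> \<in> prob_on (\<A> x) \<Longrightarrow> \<mu> \<in> prob_on (\<Union>x. \<A> x)"
  by (erule prob_on_mono) (auto intro: A_union_borel)

text \<open>
  By upper hemicontinuity the laws are eventually concentrated on each closed neighbourhood of
  \<open>\<A> x\<close>, and so is the limit.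
\<close>

lemma action_laws_closed_graph:
  assumes xs: "xs \<longlonglongrightarrow> x" and \<mu>s: "\<And>n. \<mu>s n \<in> prob_on (\<A> (xs n))" and \<mu>: "\<mu> \<in> prob_on UNIV"
    and lim: "weakly_converges \<mu>s \<mu>"
  shows "\<mu> \<in> prob_on (\<A> x)"
proof (rule prob_onI_AE[OF \<mu> A_borel])
  have "\<mu> \<in> prob_on {a. infdist a (\<A> x) \<le> 1 / real (Suc m)}" for m
  proof (rule weak_limit_on_closed[OF _ \<mu> _ lim])
    show cl: "closed {a. infdist a (\<A> x) \<le> 1 / real (Suc m)}"
      by (intro closed_Collect_le continuous_intros)
    have "open {a. infdist a (\<A> x) < 1 / real (Suc m)}"
      by (intro open_Collect_less continuous_intros)
    moreover have "\<A> x \<subseteq> {a. infdist a (\<A> x) < 1 / real (Suc m)}" by auto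
    ultimately obtain W where W: "open W" "x \<in> W" "\<forall>z\<in>W. \<A> z \<subseteq> {a. infdist a (\<A> x) < 1 / real (Suc m)}"
      using A_uhc unfolding upper_hemicontinuous_corr_def by metis
    have "\<forall>\<^sub>F n in sequentially. xs n \<in> W" using xs W(1,2) by (rule topological_tendstoD)
    then show "\<forall>\<^sub>F n in sequentially. \<mu>s n \<in> prob_on {a. infdist a (\<A> x) \<le> 1 / real (Suc m)}"
    proof eventually_elim
      case (elim n)
      then have "\<A> (xs n) \<subseteq> {a. infdist a (\<A> x) \<le> 1 / real (Suc m)}" using W(3) by force
      from prob_on_mono[OF \<mu>s this borel_closed[OF cl]] show ?case .
    qed
  qed
  then have "AE a in \<mu>. \<forall>m. infdist a (\<A> x) \<le> 1 / real (Suc m)"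
    using prob_on_AE by (subst AE_all_countable) fastforce
  then show "AE a in \<mu>. a \<in> \<A> x"
  proof eventually_elim
    case (elim a)
    have "infdist a (\<A> x) \<le> 0"
      using elim LIMSEQ_Suc[OF lim_1_over_n] by (intro LIMSEQ_le_const[of "\<lambda>n. 1 / real (Suc n)"]) auto
    then show ?case using in_closed_iff_infdist_zero[OF A_closed A_ne, of a x] infdist_nonneg[of a "\<A> x"] by simp
  qed
qed

text \<open>
  Unit masses reduce this to the closed graph of the action laws.
\<close>

lemma action_graph_closed: "closed {(x, a). a \<in> \<A> x}"
  unfolding closed_sequential_limits
proof (intro allI impI, elim conjE)
  fix zs and z :: "'x \<times> 'a" assume zs: "\<forall>n. zs n \<in> {(x, a). a \<in> \<A> x}" and lim: "zs \<longlonglongrightarrow> z"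
  have "return borel (snd z) \<in> prob_on (\<A> (fst z))"
  proof (rule action_laws_closed_graph[OF tendsto_fst[OF lim]])
    show "return borel (snd (zs n)) \<in> prob_on (\<A> (fst (zs n)))" for n
      using zs[rule_format, of n] by (intro return_prob_on A_borel) (auto simp: split_beta)
    show "weakly_converges (\<lambda>n. return borel (snd (zs n))) (return borel (snd z))"
      unfolding weakly_converges_def
    proof
      fix f :: "'a \<Rightarrow> real" assume f: "f \<in> bounded_cont"
      have "(\<lambda>n. f (snd (zs n))) \<longlonglongrightarrow> f (snd z)"
        by (rule continuous_on_tendsto_compose[OF bounded_contD(3)[OF f] tendsto_snd[OF lim]]) auto
      then show "(\<lambda>n. \<integral>a. f a \<partial>return borel (snd (zs n))) \<longlonglongrightarrow> (\<integral>a. f a \<partial>return borel (snd z))"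
        using bounded_contD(1)[OF f] by (simp add: integral_return)
    qed
  qed (auto intro: return_prob_on)
  then show "z \<in> {(x, a). a \<in> \<A> x}"
    using A_borel by (auto simp: prob_on_def split_beta indicator_def split: if_splits)
qed

text \<open>
  The first criterion is the stage risk; the further ones are the integrals against a determining
  family. They single out one minimiser for each state, and their measurability is the
  measurability of the policy.
\<close>

lemma optimal_stage_policy:
  obtains p where "p \<in> borel \<rightarrow>\<^sub>M borel_of (weak_topology UNIV)" "p \<in> borel \<rightarrow>\<^sub>M prob_algebra borel"
    "\<And>x. p x \<in> prob_on (\<A> x)"
    "\<And>x \<mu>. \<mu> \<in> prob_on (\<A> x) \<Longrightarrow> stage_risk x (p x) \<le> stage_risk x \<mu>"
    "\<And>r. closed {x. stage_risk x (p x) \<le> r}"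
proof -
  obtain f :: "nat \<Rightarrow> 'a \<Rightarrow> real" where f: "\<And>i. f i \<in> bounded_cont" "\<And>i x. \<bar>f i x\<bar> \<le> 1" and
    fmeas: "\<And>N (\<kappa>::'x \<Rightarrow> 'a measure). \<lbrakk>\<And>w. w \<in> space N \<Longrightarrow> \<kappa> w \<in> prob_on UNIV;
        \<And>i. (\<lambda>w. \<integral>x. f i x \<partial>\<kappa> w) \<in> borel_measurable N\<rbrakk> \<Longrightarrow> \<kappa> \<in> N \<rightarrow>\<^sub>M prob_algebra borel"
    using countable_determining_family by metis
  define \<phi> where "\<phi> i x \<mu> = (case i of 0 \<Rightarrow> stage_risk x \<mu> | Suc j \<Rightarrow> \<integral>a. f j a \<partial>\<mu>)" for i x \<mu>
  have fb: "\<bar>\<integral>a. f j a \<partial>\<mu>\<bar> \<le> 1" if "\<mu> \<in> prob_on UNIV" for j \<mu>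
  proof -
    interpret prob_space \<mu> using prob_onD[OF that] by simp
    have "norm (\<integral>a. f j a \<partial>\<mu>) \<le> (\<integral>a. norm (f j a) \<partial>\<mu>)" by (rule integral_norm_bound)
    also have "\<dots> \<le> (\<integral>a. 1 \<partial>\<mu>)"
      using f(2) by (intro integral_mono integrable_norm integrable_bounded_prob_on[OF that bounded_contD(1)[OF f(1)] f(2)]) auto
    finally show ?thesis by (simp add: prob_space)
  qed
  have "\<exists>d. (\<forall>x. d x \<in> prob_on (\<A> x)) \<and> (\<forall>x. \<forall>l\<in>prob_on (\<A> x). \<phi> 0 x (d x) \<le> \<phi> 0 x l) \<and>
    (\<forall>i. (\<lambda>x. \<phi> i x (d x)) \<in> borel_measurable borel) \<and> (\<forall>r. closed {x. \<phi> 0 x (d x) \<le> r})"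
  proof (rule lexicographic_minimal_selection[of "\<lambda>x. prob_on (\<A> x)" "- max c 1" \<phi>])
    fix x
    obtain a where "a \<in> \<A> x" using A_ne[of x] by auto
    then show "prob_on (\<A> x) \<noteq> {}" using return_prob_on[OF _ A_borel] by blast
  next
    fix i x l assume l: "l \<in> prob_on (\<A> x)"
    show "- max c 1 \<le> \<phi> i x l"
    proof (cases i)
      case 0
      then show ?thesis using stage_risk_ereal(2)[OF prob_on_subset_UNIV[OF l], of x] by (simp add: \<phi>_def)
    next
      case (Suc j)
      then show ?thesis using fb[OF prob_on_subset_UNIV[OF l], of j] by (simp add: \<phi>_def)
    qed
  next
    fix xs x ls assume xs: "xs \<longlonglongrightarrow> x" and ls: "\<And>n. ls n \<in> prob_on (\<A> (xs n))"
    obtain r l where r: "strict_mono (r::nat \<Rightarrow> nat)" and l: "l \<in> prob_on (\<Union>x. \<A> x)"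
      and lim: "weakly_converges (ls \<circ> r) l"
      by (rule prob_on_compact_weak_compact[OF A_compact prob_on_A_union[OF ls]])
    have xr: "(xs \<circ> r) \<longlonglongrightarrow> x" using xs r by (rule LIMSEQ_subseq_LIMSEQ)
    have "l \<in> prob_on (\<A> x)"
      by (rule action_laws_closed_graph[OF xr _ prob_on_subset_UNIV[OF l] lim]) (use ls in auto)
    moreover have "ereal (\<phi> i x l) \<le> liminf (\<lambda>n. ereal (\<phi> i (xs (r n)) (ls (r n))))" for i
    proof (cases i)
      case 0
      then show ?thesis
        using stage_risk_lsc[OF xr _ prob_on_subset_UNIV[OF l] lim] prob_on_A_union[OF ls] by (simp add: \<phi>_def)
    next
      case (Suc j)
      have "(\<lambda>n. ereal (\<integral>a. f j a \<partial>ls (r n))) \<longlonglongrightarrow> ereal (\<integral>a. f j a \<partial>l)"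
        using lim f(1) by (auto simp: weakly_converges_def)
      from lim_imp_Liminf[OF _ this] show ?thesis by (simp add: Suc \<phi>_def)
    qed
    ultimately show "\<exists>r l. strict_mono (r::nat \<Rightarrow> nat) \<and> l \<in> prob_on (\<A> x) \<and>
        (\<forall>i. ereal (\<phi> i x l) \<le> liminf (\<lambda>n. ereal (\<phi> i (xs (r n)) (ls (r n)))))"
      using r by blast
  next
    fix d assume "\<And>x. d x \<in> prob_on (\<A> x)" "\<And>x l. l \<in> prob_on (\<A> x) \<Longrightarrow> \<phi> 0 x (d x) \<le> \<phi> 0 x l"
      "\<And>i. (\<lambda>x. \<phi> i x (d x)) \<in> borel_measurable borel" "\<And>r. closed {x. \<phi> 0 x (d x) \<le> r}"
    then show ?thesis by (intro exI[of _ d]) blast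
  qed
  then obtain d where d: "\<And>x. d x \<in> prob_on (\<A> x)" "\<And>x l. l \<in> prob_on (\<A> x) \<Longrightarrow> \<phi> 0 x (d x) \<le> \<phi> 0 x l"
    "\<And>i. (\<lambda>x. \<phi> i x (d x)) \<in> borel_measurable borel" "\<And>r. closed {x. \<phi> 0 x (d x) \<le> r}" by blast
  have dp: "d \<in> borel \<rightarrow>\<^sub>M prob_algebra borel"
  proof (rule fmeas)
    show "(\<lambda>w. \<integral>x. f i x \<partial>d w) \<in> borel_measurable borel" for i
      using d(3)[of "Suc i"] by (simp add: \<phi>_def)
  qed (rule prob_on_subset_UNIV[OF d(1)])
  have "d \<in> borel \<rightarrow>\<^sub>M borel_of (weak_topology UNIV)"
    by (rule kernel_measurable_weak_topology[OF A_compact _ _ dp prob_on_A_union[OF d(1)]]) auto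
  then show thesis
    using that[of d] d dp by (simp add: \<phi>_def)
qed

end

section \<open>Dynamic programming over a finite horizon\<close>

lemma open_greater_add:
  fixes f g :: "'z::topological_space \<Rightarrow> real"
  assumes "\<And>r. open {z. r < f z}" "\<And>r. open {z. r < g z}"
  shows "open {z. r < f z + g z}"
proof -
  have "{z. r < f z + g z} = (\<Union>s. {z. s < f z} \<inter> {z. r - s < g z})"
  proof (intro set_eqI iffI)
    fix z assume "z \<in> {z. r < f z + g z}"
    then have "r - g z < f z" by simp
    then obtain s where "r - g z < s" "s < f z" using dense by blast
    then show "z \<in> (\<Union>s. {z. s < f z} \<inter> {z. r - s < g z})" by (intro UN_I[of s]) auto
  qed auto
  also have "open \<dots>" using assms by (intro open_UN ballI open_Int)
  finally show ?thesis .
qed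

lemma open_greater_of_lower_semicont:
  assumes "lower_semicont f"
  shows "open {z. r < f z}"
proof (subst open_subopen, intro ballI)
  fix z assume "z \<in> {z. r < f z}"
  then have "r < f z" by simp
  then have "ereal r < Liminf (at z) (\<lambda>w. ereal (f w))"
    using assms less_le_trans[of "ereal r" "ereal (f z)"] by (auto simp: lower_semicont_def)
  then have "\<forall>\<^sub>F w in at z. ereal r < ereal (f w)" by (rule less_LiminfD)
  then have "\<forall>\<^sub>F w in nhds z. r < f w"
    using \<open>r < f z\<close> by (auto simp: eventually_at_filter elim!: eventually_mono)
  then show "\<exists>T. open T \<and> z \<in> T \<and> T \<subseteq> {z. r < f z}"
    by (auto simp: eventually_nhds)
qed

locale control_problem = prob_space M for M :: "'w measure" +
  fixes F G :: "nat \<Rightarrow> 'w measure"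
    and \<sigma>0 :: "real measure \<Rightarrow> ereal"
    and \<sigma> :: "nat \<Rightarrow> 'x::polish_space \<Rightarrow> real measure \<Rightarrow> ereal"
    and \<A> :: "nat \<Rightarrow> 'x \<Rightarrow> 'a::polish_space set"
    and P :: "nat \<Rightarrow> 'x \<Rightarrow> 'a \<Rightarrow> 'x measure" and \<xi>1 :: "'x measure"
    and C :: "nat \<Rightarrow> 'x \<Rightarrow> 'a \<Rightarrow> 'x \<Rightarrow> real"
    and \<gamma> b :: real
  assumes filtrations: "filtration (space M) F" "filtration (space M) G"
      "\<And>t. sets (F t) \<subseteq> sets (G t)" "\<And>t. sets (G t) \<subseteq> sets M"
    and risk0: "risk_measure \<sigma>0"
    and risk: "\<And>t x. t \<ge> 1 \<Longrightarrow> risk_measure (\<sigma> t x)"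
    and risk_measurable: "\<And>t K. t \<ge> 1 \<Longrightarrow> compact K \<Longrightarrow>
      (\<lambda>(x, \<mu>). \<sigma> t x \<mu>) \<in> borel_measurable (borel \<Otimes>\<^sub>M borel_of (weak_topology K))"
    and actions: "\<And>t x. t \<ge> 1 \<Longrightarrow> \<A> t x \<noteq> {}" "\<And>t x. t \<ge> 1 \<Longrightarrow> closed (\<A> t x)"
    and kernel: "\<And>t x a. t \<ge> 1 \<Longrightarrow> P t x a \<in> prob_on UNIV"
      "\<And>t B. t \<ge> 1 \<Longrightarrow> B \<in> sets borel \<Longrightarrow> (\<lambda>(x, a). measure (P t x a) B) \<in> borel_measurable borel"
    and cost0: "C 0 = (\<lambda>_ _ _. 0)"
    and discount: "0 \<le> \<gamma>" "\<gamma> < 1"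
    and normalized: "\<And>t x. t \<ge> 1 \<Longrightarrow> \<sigma> t x (return borel 0) = 0"
    and kernel_weak: "\<And>t xs x0 as a0. t \<ge> 1 \<Longrightarrow> xs \<longlonglongrightarrow> x0 \<Longrightarrow> as \<longlonglongrightarrow> a0 \<Longrightarrow>
      weakly_converges (\<lambda>n. P t (xs n) (as n)) (P t x0 a0)"
    and actions_compact: "\<And>t. t \<ge> 1 \<Longrightarrow> compact (\<Union>x. \<A> t x)"
    and actions_uhc: "\<And>t. t \<ge> 1 \<Longrightarrow> upper_hemicontinuous_corr (\<A> t)"
    and risk_lsc: "\<And>t K \<mu>s \<mu>0 xs x0. t \<ge> 1 \<Longrightarrow> compact K \<Longrightarrow> (\<And>n. \<mu>s n \<in> prob_on K) \<Longrightarrow>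
      \<mu>0 \<in> prob_on K \<Longrightarrow> weakly_converges \<mu>s \<mu>0 \<Longrightarrow> xs \<longlonglongrightarrow> x0 \<Longrightarrow>
      liminf (\<lambda>n. \<sigma> t (xs n) (\<mu>s n)) \<ge> \<sigma> t x0 \<mu>0"
    and cost_lsc: "\<And>t. t \<ge> 1 \<Longrightarrow> lower_semicont (\<lambda>(x, a, y). C t x a y)"
    and b_pos: "b > 0" and cost_bound: "\<And>t x a y. t \<ge> 1 \<Longrightarrow> \<bar>C t x a y\<bar> \<le> b"
begin

definition bound :: real where "bound = b / (1 - \<gamma>)"

lemma bound_eq: "b + \<gamma> * bound = bound" and bound_nonneg: "0 \<le> bound"
  using discount b_pos by (auto simp: bound_def field_simps)

lemma kernel_measurable:
  assumes "t \<ge> 1"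
  shows "(\<lambda>(x, a). P t x a) \<in> borel \<Otimes>\<^sub>M borel \<rightarrow>\<^sub>M prob_algebra borel"
proof (intro measurable_prob_algebraI measurable_subprob_algebra)
  fix B :: "'x set" assume B: "B \<in> sets borel"
  have "(\<lambda>z. ennreal (measure (case z of (x, a) \<Rightarrow> P t x a) B)) \<in> borel_measurable (borel \<Otimes>\<^sub>M borel)"
    using kernel(2)[OF assms B] by (simp add: borel_prod split_beta')
  moreover have "emeasure (case z of (x, a) \<Rightarrow> P t x a) B = ennreal (measure (case z of (x, a) \<Rightarrow> P t x a) B)" for z
  proof -
    interpret p: prob_space "P t (fst z) (snd z)" using prob_onD(1)[OF kernel(1)[OF assms]] .
    show ?thesis by (simp add: split_beta p.emeasure_eq_measure)
  qed
  ultimately show "(\<lambda>z. emeasure (case z of (x, a) \<Rightarrow> P t x a) B) \<in> borel_measurable (borel \<Otimes>\<^sub>M borel)"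
    by simp
qed (use prob_onD[OF kernel(1)[OF assms]] in \<open>auto intro: prob_space_imp_subprob_space\<close>)

text \<open>
  Terminal values for one stage. The bound is the fixed point of \<open>z \<mapsto> b + \<gamma> z\<close>, so that
  adding the stage cost to a discounted admissible value preserves it.
\<close>

definition admissible :: "('x \<Rightarrow> real) \<Rightarrow> bool" where
  "admissible w \<longleftrightarrow> (\<forall>r. open {x. r < w x}) \<and> (\<forall>x. \<bar>w x\<bar> \<le> bound)"

abbreviation stage_cost :: "nat \<Rightarrow> ('x \<Rightarrow> real) \<Rightarrow> 'x \<Rightarrow> 'a \<Rightarrow> 'x \<Rightarrow> real" where
  "stage_cost t w x a y \<equiv> C t x a y + \<gamma> * w y"

lemma stage:
  assumes "t \<ge> 1" "admissible w"
  shows "control_stage (P t) (\<A> t) (\<sigma> t) (stage_cost t w) bound"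
proof
  show "(\<lambda>(x, a). P t x a) \<in> borel \<Otimes>\<^sub>M borel \<rightarrow>\<^sub>M prob_algebra borel" by (rule kernel_measurable[OF assms(1)])
next
  fix r
  have "open {z :: 'x \<times> 'a \<times> 'x. s < \<gamma> * w (snd (snd z))}" for s
  proof (cases "\<gamma> = 0")
    case False
    then have "{z :: 'x \<times> 'a \<times> 'x. s < \<gamma> * w (snd (snd z))} = (\<lambda>z. snd (snd z)) -` {x. s / \<gamma> < w x}"
      using discount(1) by (auto simp: field_simps)
    moreover have "open {x. s / \<gamma> < w x}" using assms(2) by (auto simp: admissible_def)
    moreover have "open ((\<lambda>z. snd (snd z)) -` {x. s / \<gamma> < w x} :: ('x \<times> 'a \<times> 'x) set)"
      using \<open>open {x. s / \<gamma> < w x}\<close> by (rule open_vimage) (intro continuous_intros)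
    ultimately show ?thesis by (simp only:)
  qed simp
  then have "open {z. r < (case z of (x, a, y) \<Rightarrow> C t x a y) + \<gamma> * w (snd (snd z))}"
    by (rule open_greater_add[OF open_greater_of_lower_semicont[OF cost_lsc[OF assms(1)]]])
  then show "open {(x, a, y). r < stage_cost t w x a y}" by (simp add: split_beta')
next
  fix x a y
  have "\<bar>\<gamma> * w y\<bar> \<le> \<gamma> * bound"
    using assms(2) discount(1) by (auto simp: admissible_def abs_mult intro: mult_left_mono)
  then show "\<bar>stage_cost t w x a y\<bar> \<le> bound"
    using cost_bound[OF assms(1), of x a y] bound_eq by (intro abs_leI) (auto simp: abs_le_iff)
qed (use assms(1) actions actions_compact actions_uhc risk normalized risk_lsc kernel_weak in auto)

abbreviation Bellman :: "nat \<Rightarrow> ('x \<Rightarrow> real) \<Rightarrow> 'x \<Rightarrow> 'a measure \<Rightarrow> real" where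
  "Bellman t w \<equiv> control_stage.stage_risk (P t) (\<sigma> t) (stage_cost t w)"

definition optimal_policy :: "nat \<Rightarrow> ('x \<Rightarrow> real) \<Rightarrow> ('x \<Rightarrow> 'a measure) \<Rightarrow> bool" where
  "optimal_policy t w p \<longleftrightarrow> p \<in> borel \<rightarrow>\<^sub>M borel_of (weak_topology UNIV) \<and> p \<in> borel \<rightarrow>\<^sub>M prob_algebra borel \<and>
    (\<forall>x. p x \<in> prob_on (\<A> t x)) \<and> (\<forall>x. \<forall>\<mu>\<in>prob_on (\<A> t x). Bellman t w x (p x) \<le> Bellman t w x \<mu>) \<and>
    admissible (\<lambda>x. Bellman t w x (p x))"

definition policy :: "nat \<Rightarrow> ('x \<Rightarrow> real) \<Rightarrow> 'x \<Rightarrow> 'a measure" where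
  "policy t w = (SOME p. optimal_policy t w p)"

lemma policy_optimal:
  assumes "t \<ge> 1" "admissible w"
  shows "optimal_policy t w (policy t w)"
proof -
  interpret control_stage "P t" "\<A> t" "\<sigma> t" "stage_cost t w" bound by (rule stage[OF assms])
  obtain p where p: "p \<in> borel \<rightarrow>\<^sub>M borel_of (weak_topology UNIV)" "p \<in> borel \<rightarrow>\<^sub>M prob_algebra borel"
    "\<And>x. p x \<in> prob_on (\<A> t x)" "\<And>x \<mu>. \<mu> \<in> prob_on (\<A> t x) \<Longrightarrow> stage_risk x (p x) \<le> stage_risk x \<mu>"
    "\<And>r. closed {x. stage_risk x (p x) \<le> r}" using optimal_stage_policy by blast
  have "open {x. r < stage_risk x (p x)}" for r
    using p(5)[of r] by (simp add: closed_def Collect_neg_eq[symmetric] not_le)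
  then have "optimal_policy t w p"
    using p stage_risk_ereal(2)[OF prob_on_subset_UNIV[OF p(3)]]
    by (auto simp: optimal_policy_def admissible_def)
  then show ?thesis unfolding policy_def by (rule someI[of "optimal_policy t w"])
qed

text \<open>
  Recursion on the number \<open>n\<close> of remaining stages, while the current time \<open>t\<close> increases.
\<close>

primrec val :: "nat \<Rightarrow> nat \<Rightarrow> 'x \<Rightarrow> real" where
  "val 0 = (\<lambda>t x. 0)"
| "val (Suc n) = (\<lambda>t x. Bellman t (val n (Suc t)) x (policy t (val n (Suc t)) x))"

lemma val_admissible: "t \<ge> 1 \<Longrightarrow> admissible (val n t)"
proof (induction n arbitrary: t)
  case 0
  then show ?case using bound_nonneg by (simp add: admissible_def)
next
  case (Suc n)
  then show ?case using policy_optimal[of t "val n (Suc t)"] by (simp add: optimal_policy_def)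
qed

lemma val_measurable: "t \<ge> 1 \<Longrightarrow> val n t \<in> borel_measurable borel"
  using val_admissible[of t n]
  by (auto simp: borel_measurable_iff_greater admissible_def)

text \<open>
  Beyond the horizon the truncated subtraction yields 0, and the policy continues with minimisers
  for the terminal value 0.
\<close>

definition horizon_policy :: "nat \<Rightarrow> nat \<Rightarrow> 'x \<Rightarrow> 'a measure" where
  "horizon_policy T t = policy t (val (T - t) (Suc t))"

lemma horizon_policy_optimal: "t \<ge> 1 \<Longrightarrow> optimal_policy t (val (T - t) (Suc t)) (horizon_policy T t)"
  unfolding horizon_policy_def by (rule policy_optimal) (auto intro: val_admissible)

lemma horizon_policy_markov: "horizon_policy T \<in> markov_policies \<A>"
  using horizon_policy_optimal[of _ T] by (auto simp: markov_policies_def optimal_policy_def prob_on_def)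

lemma space_FG: "space (F t) = space M" "space (G t) = space M"
  using filtrations(1,2) by (auto simp: filtration_def)

abbreviation "U \<equiv> joint_filtration F G"

lemma space_U: "space (U t) = space M"
  by (simp add: joint_filtration_def space_FG space_measure_of_conv)

lemma sets_U: "sets (U t) = sigma_sets (space M) (sets (G (t - 1)) \<union> sets (F t))"
  unfolding joint_filtration_def
  using sets.sets_into_space[of _ "G (t - 1)"] sets.sets_into_space[of _ "F t"]
  by (subst sets_measure_of) (auto simp: space_FG)

lemma F_U: "sets (F t) \<subseteq> sets (U t)" by (auto simp: sets_U)

lemma U_G: "sets (U t) \<subseteq> sets (G t)"
proof -
  have "sets (G (t - 1)) \<subseteq> sets (G t)"
    using filtrations(2) by (auto simp: filtration_def)
  then show ?thesis
    unfolding sets_U using filtrations(3)[of t] sets.sigma_sets_subset[of "sets (G (t - 1)) \<union> sets (F t)" "G t"]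
    by (simp add: space_FG)
qed

lemma sub_U: "prob_subalgebra M (U t)" and sub_G: "prob_subalgebra M (G t)"
  using U_G[of t] filtrations(4)[of t] prob_space_axioms
  by (auto simp: prob_subalgebra_def prob_subalgebra_axioms_def subalgebra_def space_U space_FG)

lemma law_prob_on:
  fixes W :: "'w \<Rightarrow> real"
  assumes W: "W \<in> borel_measurable M" and B: "\<And>\<omega>. \<omega> \<in> space M \<Longrightarrow> \<bar>W \<omega>\<bar> \<le> B"
  shows "distr M borel W \<in> prob_on {-B..B}"
proof (rule prob_onI_AE)
  show "distr M borel W \<in> prob_on UNIV"
    unfolding prob_on_UNIV_iff using prob_space_distr[OF W] by simp
  show "AE y in distr M borel W. y \<in> {-B..B}"
  proof (subst AE_distr_iff[OF W])
    show "AE \<omega> in M. W \<omega> \<in> {-B..B}" using B by (intro AE_I2) (auto simp: abs_le_iff minus_le_iff)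
  qed simp
qed simp

lemma law_risk_shift:
  assumes Y: "Y \<in> borel_measurable M" "\<And>\<omega>. \<omega> \<in> space M \<Longrightarrow> \<bar>Y \<omega>\<bar> \<le> B"
    and Z: "Z \<in> borel_measurable M" "\<And>\<omega>. \<omega> \<in> space M \<Longrightarrow> \<bar>Z \<omega>\<bar> \<le> B"
    and le: "AE \<omega> in M. Y \<omega> \<le> Z \<omega> + c"
  shows "\<sigma>0 (distr M borel Y) \<le> \<sigma>0 (distr M borel Z) + ereal c"
proof (rule risk_shift_mono[OF risk0])
  show "distr M borel Y \<in> prob_bdd" "distr M borel Z \<in> prob_bdd"
    using prob_bddI[OF law_prob_on] Y Z by blast+
  fix r
  have "measure M (Z -` {..r} \<inter> space M) \<le> measure M (Y -` {..r + c} \<inter> space M)"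
    using le Y(1) by (intro finite_measure_mono_AE) (auto elim: eventually_mono)
  then show "measure (distr M borel Z) {..r} \<le> measure (distr M borel Y) {..r + c}"
    using Y(1) Z(1) by (simp add: measure_distr)
qed

context
  fixes X :: "nat \<Rightarrow> 'w \<Rightarrow> 'x" and A :: "nat \<Rightarrow> 'w \<Rightarrow> 'a"
  assumes cp: "controlled_process M F G \<A> P \<xi>1 X A"
begin

lemma X_U: "t \<ge> 1 \<Longrightarrow> X t \<in> U t \<rightarrow>\<^sub>M borel"
  using cp F_U[of t] by (auto simp: controlled_process_def measurable_def space_U space_FG)

lemma A_G: "t \<ge> 1 \<Longrightarrow> A t \<in> G t \<rightarrow>\<^sub>M borel"
  using cp by (auto simp: controlled_process_def)

lemma X_M: "t \<ge> 1 \<Longrightarrow> X t \<in> M \<rightarrow>\<^sub>M borel"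
  using X_U[of t] measurable_from_subalg[OF prob_subalgebra.sub[OF sub_U]] by blast

lemma A_M: "t \<ge> 1 \<Longrightarrow> A t \<in> M \<rightarrow>\<^sub>M borel"
  using A_G[of t] measurable_from_subalg[OF prob_subalgebra.sub[OF sub_G]] by blast

lemma process_measurable:
  assumes "t \<ge> 1" "(\<lambda>(x, a, y). h x a y) \<in> borel_measurable borel"
  shows "(\<lambda>\<omega>. h (X t \<omega>) (A t \<omega>) (X (Suc t) \<omega>) :: real) \<in> borel_measurable M"
proof -
  note [measurable] = X_M[OF assms(1)] A_M[OF assms(1)] X_M[of "Suc t", simplified]
  have "(\<lambda>\<omega>. (X t \<omega>, A t \<omega>, X (Suc t) \<omega>)) \<in> M \<rightarrow>\<^sub>M borel"
    by (subst borel_prod[symmetric], subst borel_prod[symmetric]) measurable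
  from measurable_compose[OF this assms(2)] show ?thesis by simp
qed

abbreviation "Z \<equiv> cost_process C X A"

text \<open>
  The value 0 beyond the horizon makes the recursion of the dynamic risk measure uniform in \<open>t\<close>.
\<close>

definition risk_to_go :: "nat \<Rightarrow> nat \<Rightarrow> 'w \<Rightarrow> real" where
  "risk_to_go t T \<omega> = (if t \<le> T then real_of_ereal (dyn_risk M F G \<sigma> \<gamma> X Z t T (X t \<omega>) \<omega>) else 0)"

definition cost_to_go :: "nat \<Rightarrow> nat \<Rightarrow> 'w \<Rightarrow> real" where
  "cost_to_go t T \<omega> = Z t \<omega> + \<gamma> * risk_to_go (Suc t) T \<omega>"

lemma dyn_risk_cost_to_go:
  assumes "t \<le> T"
  shows "dyn_risk M F G \<sigma> \<gamma> X Z t T x \<omega> = \<sigma> t x (cond_distr M (U t) (cost_to_go t T) \<omega>)"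
proof -
  have "(if t < T then (\<lambda>\<omega>'. Z t \<omega>' + \<gamma> * real_of_ereal (dyn_risk M F G \<sigma> \<gamma> X Z (Suc t) T (X (Suc t) \<omega>') \<omega>'))
      else Z t) = cost_to_go t T"
    using assms by (auto simp: cost_to_go_def risk_to_go_def fun_eq_iff)
  then show ?thesis by (subst dyn_risk.simps) simp
qed

lemma cost_to_go_bounded:
  assumes "1 \<le> t" "risk_to_go (Suc t) T \<in> borel_measurable M"
    "\<forall>\<omega>\<in>space M. \<bar>risk_to_go (Suc t) T \<omega>\<bar> \<le> bound"
  shows "cost_to_go t T \<in> borel_measurable M" "\<And>\<omega>. \<omega> \<in> space M \<Longrightarrow> \<bar>cost_to_go t T \<omega>\<bar> \<le> bound"
proof -
  have "(\<lambda>(x, a, y). C t x a y) \<in> borel_measurable borel"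
  proof (subst borel_measurable_iff_greater, intro allI)
    fix r
    show "{w \<in> space borel. r < (case w of (x, a, y) \<Rightarrow> C t x a y)} \<in> sets borel"
      using open_greater_of_lower_semicont[OF cost_lsc[OF assms(1)], of r] by simp
  qed
  from process_measurable[OF assms(1) this] have "Z t \<in> borel_measurable M"
    by (simp add: cost_process_def[abs_def])
  then show "cost_to_go t T \<in> borel_measurable M"
    using assms(2) by (auto simp: cost_to_go_def[abs_def])
  fix \<omega> assume "\<omega> \<in> space M"
  then have "\<bar>\<gamma> * risk_to_go (Suc t) T \<omega>\<bar> \<le> \<gamma> * bound"
    using assms(3) discount(1) by (auto simp: abs_mult intro: mult_left_mono)
  then show "\<bar>cost_to_go t T \<omega>\<bar> \<le> bound"
    using cost_bound[OF assms(1), of "X t \<omega>" "A t \<omega>" "X (Suc t) \<omega>"] bound_eq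
    unfolding cost_to_go_def cost_process_def by linarith
qed

lemma risk_to_go_bounded:
  assumes "1 \<le> t"
  shows "risk_to_go t T \<in> borel_measurable M \<and> (\<forall>\<omega>\<in>space M. \<bar>risk_to_go t T \<omega>\<bar> \<le> bound)"
  using assms
proof (induction "Suc T - t" arbitrary: t)
  case 0
  then show ?case using bound_nonneg by (simp add: risk_to_go_def[abs_def])
next
  case (Suc n)
  then have t: "1 \<le> t" "t \<le> T" and n: "n = Suc T - Suc t" by auto
  from Suc(1)[OF n] have IH: "risk_to_go (Suc t) T \<in> borel_measurable M"
    "\<forall>\<omega>\<in>space M. \<bar>risk_to_go (Suc t) T \<omega>\<bar> \<le> bound" by auto
  note W = cost_to_go_bounded[OF t(1) IH]
  interpret u: prob_subalgebra M "U t" by (rule sub_U)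
  have "AE \<omega> in M. \<bar>cost_to_go t T \<omega>\<bar> \<le> bound" using W(2) by (intro AE_I2)
  note cd = u.cond_distr_regular[OF W(1) this]
  let ?\<kappa> = "cond_distr M (U t) (cost_to_go t T)"
  have "?\<kappa> \<in> U t \<rightarrow>\<^sub>M borel_of (weak_topology {-bound..bound})"
    using cd(1) cd(2) by (intro kernel_measurable_weak_topology[of "{-bound..bound}"])
      (auto simp: u.cond_law_def space_U)
  then have "(\<lambda>\<omega>. (X t \<omega>, ?\<kappa> \<omega>)) \<in> U t \<rightarrow>\<^sub>M borel \<Otimes>\<^sub>M borel_of (weak_topology {-bound..bound})"
    using X_U[OF t(1)] by simp
  from measurable_compose[OF this risk_measurable[OF t(1), of "{-bound..bound}"]]
  have "(\<lambda>\<omega>. \<sigma> t (X t \<omega>) (?\<kappa> \<omega>)) \<in> borel_measurable (U t)" by simp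
  then have "(\<lambda>\<omega>. real_of_ereal (\<sigma> t (X t \<omega>) (?\<kappa> \<omega>))) \<in> borel_measurable M"
    by (intro borel_measurable_real_of_ereal measurable_from_subalg[OF u.sub])
  moreover have "\<bar>real_of_ereal (\<sigma> t (X t \<omega>) (?\<kappa> \<omega>))\<bar> \<le> bound" if "\<omega> \<in> space M" for \<omega>
    using risk_bounds[OF risk[OF t(1)] cd(2)[OF that], of "X t \<omega>"] normalized[OF t(1), of "X t \<omega>"]
      risk_finite[OF risk[OF t(1)] prob_bddI[OF cd(2)[OF that]], of "X t \<omega>"]
    by (cases "\<sigma> t (X t \<omega>) (?\<kappa> \<omega>)") (auto simp: abs_le_iff minus_le_iff)
  ultimately show ?case
    using t by (simp add: risk_to_go_def[abs_def] dyn_risk_cost_to_go)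
qed

lemma cost_to_go_regular:
  assumes "1 \<le> t"
  shows "cost_to_go t T \<in> borel_measurable M" "\<And>\<omega>. \<omega> \<in> space M \<Longrightarrow> \<bar>cost_to_go t T \<omega>\<bar> \<le> bound"
  using cost_to_go_bounded[OF assms, of T] risk_to_go_bounded[of "Suc t" T] by auto

lemma cond_cost_to_go:
  assumes "1 \<le> t" "\<omega> \<in> space M"
  shows "cond_distr M (U t) (cost_to_go t T) \<omega> \<in> prob_on {-bound..bound}"
  using cost_to_go_regular[OF assms(1)] assms(2)
  by (intro prob_subalgebra.cond_distr_regular(2)[OF sub_U]) auto

lemma risk_to_go_eq:
  assumes "1 \<le> t" "t \<le> T" "\<omega> \<in> space M"
  shows "ereal (risk_to_go t T \<omega>) = \<sigma> t (X t \<omega>) (cond_distr M (U t) (cost_to_go t T) \<omega>)"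
  using risk_finite[OF risk[OF assms(1)] prob_bddI[OF cond_cost_to_go[OF assms(1,3)]]] assms(2)
  by (simp add: risk_to_go_def dyn_risk_cost_to_go ereal_real')

text \<open>
  One backward step: the risk of the cost to go compares with the stage risk of the conditional
  law of the action.
\<close>

lemma stage_comparison:
  assumes t: "1 \<le> t" "t \<le> T" and w: "admissible w" and \<kappa>: "prob_subalgebra.cond_law M (U t) (A t) \<kappa>"
  shows "(AE \<omega> in M. w (X (Suc t) \<omega>) \<le> risk_to_go (Suc t) T \<omega>) \<Longrightarrow>
      AE \<omega> in M. Bellman t w (X t \<omega>) (\<kappa> \<omega>) \<le> risk_to_go t T \<omega>"
    and "(AE \<omega> in M. risk_to_go (Suc t) T \<omega> \<le> w (X (Suc t) \<omega>)) \<Longrightarrow>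
      AE \<omega> in M. risk_to_go t T \<omega> \<le> Bellman t w (X t \<omega>) (\<kappa> \<omega>)"
proof -
  interpret u: prob_subalgebra M "U t" by (rule sub_U)
  interpret g: prob_subalgebra M "G t" by (rule sub_G)
  interpret s: control_stage "P t" "\<A> t" "\<sigma> t" "stage_cost t w" bound by (rule stage[OF t(1) w])
  define H where "H \<omega> = stage_cost t w (X t \<omega>) (A t \<omega>) (X (Suc t) \<omega>)" for \<omega>
  define \<eta> where "\<eta> \<omega> = stage_law (P t) (stage_cost t w) (X t \<omega>) (\<kappa> \<omega>)" for \<omega>
  have \<kappa>U: "\<kappa> \<omega> \<in> prob_on UNIV" if "\<omega> \<in> space M" for \<omega>
    using u.kernel_prob_on[OF _ that] \<kappa> by (auto simp: u.cond_law_def)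
  have Hm: "H \<in> borel_measurable M"
    unfolding H_def by (rule process_measurable[OF t(1) s.h_measurable])
  have "g.cond_law (X (Suc t)) (\<lambda>\<omega>. P t (X t \<omega>) (A t \<omega>))"
    unfolding g.cond_law_def
  proof (intro conjI ballI)
    have "X t \<in> G t \<rightarrow>\<^sub>M borel"
      using X_U[OF t(1)] U_G[of t] by (auto simp: measurable_def space_U space_FG)
    then have "(\<lambda>\<omega>. (X t \<omega>, A t \<omega>)) \<in> G t \<rightarrow>\<^sub>M borel \<Otimes>\<^sub>M borel"
      using A_G[OF t(1)] by simp
    from measurable_compose[OF this kernel_measurable[OF t(1)]]
    show "(\<lambda>\<omega>. P t (X t \<omega>) (A t \<omega>)) \<in> G t \<rightarrow>\<^sub>M prob_algebra borel" by simp
    show "AE \<omega> in M. cond_probability M (G t) {\<omega>' \<in> space M. X (Suc t) \<omega>' \<in> B} \<omega> = measure (P t (X t \<omega>) (A t \<omega>)) B"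
      if "B \<in> sets borel" for B
      using cp t(1) that by (auto simp: controlled_process_def)
  qed
  then have cl: "u.cond_law H \<eta>"
    unfolding H_def \<eta>_def stage_law_def
    using X_M[of "Suc t"]
    by (intro u.cond_law_two_stage[OF sub_G U_G X_U[OF t(1)] A_G[OF t(1)] _ \<kappa> kernel_measurable[OF t(1)] _ s.h_measurable]) auto
  have \<eta>B: "\<forall>\<omega>\<in>space M. \<eta> \<omega> \<in> prob_on {-bound..bound}"
    unfolding \<eta>_def using s.stage_law_prob_on[OF \<kappa>U] by blast
  have \<eta>risk: "\<sigma> t (X t \<omega>) (\<eta> \<omega>) = ereal (Bellman t w (X t \<omega>) (\<kappa> \<omega>))" if "\<omega> \<in> space M" for \<omega>
    unfolding \<eta>_def using s.stage_risk_ereal(1)[OF \<kappa>U[OF that]] by simp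
  have WB: "AE \<omega> in M. \<bar>cost_to_go t T \<omega>\<bar> \<le> bound"
    using cost_to_go_regular(2)[OF t(1)] by (intro AE_I2)
  note shift = u.cond_distr_risk_shift[OF cost_to_go_regular(1)[OF t(1)] WB Hm cl \<eta>B, where c=0]
  show "AE \<omega> in M. Bellman t w (X t \<omega>) (\<kappa> \<omega>) \<le> risk_to_go t T \<omega>"
    if le: "AE \<omega> in M. w (X (Suc t) \<omega>) \<le> risk_to_go (Suc t) T \<omega>"
  proof -
    have "AE \<omega> in M. H \<omega> \<le> cost_to_go t T \<omega> + 0"
      using le by eventually_elim
        (use discount(1) in \<open>auto simp: H_def cost_to_go_def cost_process_def intro: mult_left_mono\<close>)
    from shift(2)[OF this] AE_space show ?thesis
    proof eventually_elim
      case (elim \<omega>)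
      then have "\<sigma> t (X t \<omega>) (\<eta> \<omega>) \<le> \<sigma> t (X t \<omega>) (cond_distr M (U t) (cost_to_go t T) \<omega>) + ereal 0"
        using risk[OF t(1)] by blast
      then show ?case using elim(2) by (simp add: \<eta>risk risk_to_go_eq[OF t, symmetric])
    qed
  qed
  show "AE \<omega> in M. risk_to_go t T \<omega> \<le> Bellman t w (X t \<omega>) (\<kappa> \<omega>)"
    if le: "AE \<omega> in M. risk_to_go (Suc t) T \<omega> \<le> w (X (Suc t) \<omega>)"
  proof -
    have "AE \<omega> in M. cost_to_go t T \<omega> \<le> H \<omega> + 0"
      using le by eventually_elim
        (use discount(1) in \<open>auto simp: H_def cost_to_go_def cost_process_def intro: mult_left_mono\<close>)
    from shift(1)[OF this] AE_space show ?thesis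
    proof eventually_elim
      case (elim \<omega>)
      then have "\<sigma> t (X t \<omega>) (cond_distr M (U t) (cost_to_go t T) \<omega>) \<le> \<sigma> t (X t \<omega>) (\<eta> \<omega>) + ereal 0"
        using risk[OF t(1)] by blast
      then show ?case using elim(2) by (simp add: \<eta>risk risk_to_go_eq[OF t, symmetric])
    qed
  qed
qed

text \<open>
  The graph of the action correspondence is closed, hence measurable, and freezing the state turns
  \<open>A t \<omega> \<in> \<A> t (X t \<omega>)\<close> into a statement on the conditional law.
\<close>

lemma action_law_exists:
  assumes t: "1 \<le> t"
  obtains \<kappa> where "prob_subalgebra.cond_law M (U t) (A t) \<kappa>" "AE \<omega> in M. \<kappa> \<omega> \<in> prob_on (\<A> t (X t \<omega>))"
proof -
  interpret u: prob_subalgebra M "U t" by (rule sub_U)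
  have "admissible (\<lambda>_. 0)" using bound_nonneg by (simp add: admissible_def)
  interpret s: control_stage "P t" "\<A> t" "\<sigma> t" "stage_cost t (\<lambda>_. 0)" bound by (rule stage[OF t \<open>admissible (\<lambda>_. 0)\<close>])
  have "AE \<omega> in M. \<forall>t\<ge>1. A t \<omega> \<in> \<A> t (X t \<omega>)" using cp by (auto simp: controlled_process_def)
  then have AX: "AE \<omega> in M. A t \<omega> \<in> \<A> t (X t \<omega>)" by eventually_elim (use t in auto)
  then have AK: "AE \<omega> in M. A t \<omega> \<in> (\<Union>x. \<A> t x)" by eventually_elim auto
  obtain \<kappa> where \<kappa>: "u.cond_law (A t) \<kappa>" "\<And>\<omega>. \<omega> \<in> space M \<Longrightarrow> \<kappa> \<omega> \<in> prob_on (\<Union>x. \<A> t x)"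
    using u.cond_law_compact_exists[OF A_M[OF t] actions_compact[OF t] AK] by blast
  have graph: "{(x, a). a \<in> \<A> t x} \<in> sets (borel \<Otimes>\<^sub>M borel)"
    by (subst borel_prod) (rule borel_closed[OF s.action_graph_closed])
  have f: "(\<lambda>(\<omega>, a). indicator (- {(x, a). a \<in> \<A> t x}) (X t \<omega>, a) :: ennreal) \<in> borel_measurable (U t \<Otimes>\<^sub>M borel)"
  proof -
    note [measurable] = X_U[OF t]
    have "(\<lambda>z. (X t (fst z), snd z)) \<in> U t \<Otimes>\<^sub>M borel \<rightarrow>\<^sub>M borel \<Otimes>\<^sub>M borel" by measurable
    from measurable_compose[OF this borel_measurable_indicator[OF sets.compl_sets[OF graph]]]
    show ?thesis by (simp add: split_beta' space_pair_measure Compl_eq_Diff_UNIV)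
  qed
  have "(\<integral>\<^sup>+\<omega>. \<integral>\<^sup>+a. indicator (- {(x, a). a \<in> \<A> t x}) (X t \<omega>, a) \<partial>\<kappa> \<omega> \<partial>M)
      = (\<integral>\<^sup>+\<omega>. indicator (- {(x, a). a \<in> \<A> t x}) (X t \<omega>, A t \<omega>) \<partial>M)"
    by (rule u.cond_law_freeze[OF A_M[OF t] \<kappa>(1) f, symmetric])
  also have "\<dots> = (\<integral>\<^sup>+\<omega>. 0 \<partial>M)"
    using AX by (intro nn_integral_cong_AE) (auto elim: eventually_mono)
  finally have 0: "(\<integral>\<^sup>+\<omega>. \<integral>\<^sup>+a. indicator (- {(x, a). a \<in> \<A> t x}) (X t \<omega>, a) \<partial>\<kappa> \<omega> \<partial>M) = 0" by simp
  have \<kappa>P: "\<kappa> \<in> U t \<rightarrow>\<^sub>M subprob_algebra borel"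
    using \<kappa>(1) by (auto simp: u.cond_law_def intro: measurable_prob_algebraD)
  have "(\<lambda>\<omega>. \<integral>\<^sup>+a. indicator (- {(x, a). a \<in> \<A> t x}) (X t \<omega>, a) \<partial>\<kappa> \<omega>) \<in> borel_measurable M"
    by (rule measurable_from_subalg[OF u.sub nn_integral_measurable_subprob_algebra2[OF f \<kappa>P]])
  from nn_integral_0_iff_AE[OF this] 0
  have "AE \<omega> in M. (\<integral>\<^sup>+a. indicator (- {(x, a). a \<in> \<A> t x}) (X t \<omega>, a) \<partial>\<kappa> \<omega>) = 0" by simp
  then have "AE \<omega> in M. \<kappa> \<omega> \<in> prob_on (\<A> t (X t \<omega>))"
    using AE_space
  proof eventually_elim
    case (elim \<omega>)
    note on = prob_on_subset_UNIV[OF \<kappa>(2)[OF elim(2)]]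
    have "- \<A> t (X t \<omega>) \<in> sets (\<kappa> \<omega>)" using prob_onD[OF on] s.A_borel[of "X t \<omega>"] by simp
    have "emeasure (\<kappa> \<omega>) (- \<A> t (X t \<omega>)) = (\<integral>\<^sup>+a. indicator (- {(x, a). a \<in> \<A> t x}) (X t \<omega>, a) \<partial>\<kappa> \<omega>)"
      by (subst nn_integral_indicator[OF \<open>- \<A> t (X t \<omega>) \<in> sets (\<kappa> \<omega>)\<close>, symmetric])
         (auto intro!: nn_integral_cong simp: indicator_def)
    then have "- \<A> t (X t \<omega>) \<in> null_sets (\<kappa> \<omega>)"
      using elim(1) \<open>- \<A> t (X t \<omega>) \<in> sets (\<kappa> \<omega>)\<close> by (simp add: null_sets_def)
    from AE_not_in[OF this] show ?case by (intro prob_onI_AE[OF on s.A_borel]) simp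
  qed
  with \<kappa>(1) show thesis by (rule that)
qed

text \<open>
  Arbitrary history-dependent actions enter only through their conditional law, which is one of
  the laws over which the value function minimises.
\<close>

lemma risk_to_go_ge_val:
  assumes "1 \<le> t"
  shows "AE \<omega> in M. val (Suc T - t) t (X t \<omega>) \<le> risk_to_go t T \<omega>"
  using assms
proof (induction "Suc T - t" arbitrary: t)
  case 0
  then have "Suc T - t = 0" "\<not> t \<le> T" by auto
  then show ?case by (simp add: risk_to_go_def)
next
  case (Suc n)
  then have t: "1 \<le> t" "t \<le> T" and n: "n = Suc T - Suc t" "n = T - t" "Suc T - t = Suc n" by auto
  have adm: "admissible (val n (Suc t))" by (rule val_admissible) simp
  obtain \<kappa> where \<kappa>: "prob_subalgebra.cond_law M (U t) (A t) \<kappa>" "AE \<omega> in M. \<kappa> \<omega> \<in> prob_on (\<A> t (X t \<omega>))"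
    by (rule action_law_exists[OF t(1)])
  have "AE \<omega> in M. val n (Suc t) (X (Suc t) \<omega>) \<le> risk_to_go (Suc t) T \<omega>"
    using Suc(1)[OF n(1)] n by simp
  from stage_comparison(1)[OF t adm \<kappa>(1) this] \<kappa>(2)
  have "AE \<omega> in M. val (Suc n) t (X t \<omega>) \<le> risk_to_go t T \<omega>"
  proof eventually_elim
    case (elim \<omega>)
    have "val (Suc n) t (X t \<omega>) \<le> Bellman t (val n (Suc t)) (X t \<omega>) (\<kappa> \<omega>)"
      using policy_optimal[OF t(1) adm] elim(2) by (simp add: optimal_policy_def)
    then show ?case using elim(1) by simp
  qed
  then show ?case using n by simp
qed

lemma risk_to_go_le_val:
  assumes fp: "follows_policy M F G (horizon_policy T) X A" and "1 \<le> t"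
  shows "AE \<omega> in M. risk_to_go t T \<omega> \<le> val (Suc T - t) t (X t \<omega>)"
  using assms(2)
proof (induction "Suc T - t" arbitrary: t)
  case 0
  then have "Suc T - t = 0" "\<not> t \<le> T" by auto
  then show ?case by (simp add: risk_to_go_def)
next
  case (Suc n)
  then have t: "1 \<le> t" "t \<le> T" and n: "n = Suc T - Suc t" "n = T - t" "Suc T - t = Suc n" by auto
  have adm: "admissible (val n (Suc t))" by (rule val_admissible) simp
  interpret u: prob_subalgebra M "U t" by (rule sub_U)
  have "u.cond_law (A t) (\<lambda>\<omega>. horizon_policy T t (X t \<omega>))"
    unfolding u.cond_law_def
  proof (intro conjI ballI)
    show "(\<lambda>\<omega>. horizon_policy T t (X t \<omega>)) \<in> U t \<rightarrow>\<^sub>M prob_algebra borel"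
      using horizon_policy_optimal[OF t(1), of T] X_U[OF t(1)]
      by (auto simp: optimal_policy_def intro: measurable_compose)
    fix B :: "'a set" assume "B \<in> sets borel"
    with fp t(1) have "AE \<omega> in M.
        cond_probability M (U t) {\<omega>'\<in>space M. A t \<omega>' \<in> B} \<omega>
          = cond_probability M (vimage_algebra (space M) (X t) borel) {\<omega>'\<in>space M. A t \<omega>' \<in> B} \<omega> \<and>
        cond_probability M (vimage_algebra (space M) (X t) borel) {\<omega>'\<in>space M. A t \<omega>' \<in> B} \<omega>
          = measure (horizon_policy T t (X t \<omega>)) B"
      unfolding follows_policy_def by blast
    then show "AE \<omega> in M. cond_probability M (U t) {\<omega>'\<in>space M. A t \<omega>' \<in> B} \<omega>
        = measure (horizon_policy T t (X t \<omega>)) B" by eventually_elim simp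
  qed
  moreover have "AE \<omega> in M. risk_to_go (Suc t) T \<omega> \<le> val n (Suc t) (X (Suc t) \<omega>)"
    using Suc(1)[OF n(1)] n by simp
  ultimately have "AE \<omega> in M. risk_to_go t T \<omega> \<le> Bellman t (val n (Suc t)) (X t \<omega>) (horizon_policy T t (X t \<omega>))"
    by (rule stage_comparison(2)[OF t adm])
  then show ?case using n by (simp add: horizon_policy_def)
qed

text \<open>
  Extending the horizon changes the last cost to go by at most \<open>\<gamma>\<close> times the bound, and each
  backward step contracts the difference by \<open>\<gamma>\<close>.
\<close>

lemma risk_to_go_truncation:
  assumes "T \<le> T'" "1 \<le> t" "t \<le> Suc T"
  shows "AE \<omega> in M. \<bar>risk_to_go t T' \<omega> - risk_to_go t T \<omega>\<bar> \<le> \<gamma> ^ (Suc T - t) * bound"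
  using assms(2,3)
proof (induction "Suc T - t" arbitrary: t)
  case 0
  then have "t = Suc T" by simp
  then show ?case using risk_to_go_bounded[of "Suc T" T'] by (auto simp: risk_to_go_def[of _ T] intro!: AE_I2)
next
  case (Suc n)
  then have t: "1 \<le> t" "t \<le> T" "t \<le> T'" and n: "n = Suc T - Suc t" "Suc T - t = Suc n" using assms(1) by auto
  interpret u: prob_subalgebra M "U t" by (rule sub_U)
  define e where "e = \<gamma> ^ Suc n * bound"
  have "AE \<omega> in M. \<bar>risk_to_go (Suc t) T' \<omega> - risk_to_go (Suc t) T \<omega>\<bar> \<le> \<gamma> ^ n * bound"
    using Suc(1)[OF n(1)] t n by simp
  then have diff: "AE \<omega> in M. \<bar>cost_to_go t T' \<omega> - cost_to_go t T \<omega>\<bar> \<le> e"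
  proof eventually_elim
    case (elim \<omega>)
    have "\<bar>cost_to_go t T' \<omega> - cost_to_go t T \<omega>\<bar> = \<gamma> * \<bar>risk_to_go (Suc t) T' \<omega> - risk_to_go (Suc t) T \<omega>\<bar>"
      using discount(1) by (simp add: cost_to_go_def abs_mult right_diff_distrib[symmetric])
    also have "\<dots> \<le> \<gamma> * (\<gamma> ^ n * bound)" using elim discount(1) by (rule mult_left_mono)
    finally show ?case by (simp add: e_def)
  qed
  have half: "AE \<omega> in M. risk_to_go t S \<omega> \<le> risk_to_go t S' \<omega> + e"
    if S: "t \<le> S" "t \<le> S'" and le: "AE \<omega> in M. cost_to_go t S \<omega> \<le> cost_to_go t S' \<omega> + e" for S S'
  proof -
    have WB: "AE \<omega> in M. \<bar>cost_to_go t S \<omega>\<bar> \<le> bound" for S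
      using cost_to_go_regular(2)[OF t(1)] by (intro AE_I2)
    note W = cost_to_go_regular(1)[OF t(1)]
    note cd = u.cond_distr_regular[OF W WB]
    have "\<forall>\<omega>\<in>space M. cond_distr M (U t) (cost_to_go t S') \<omega> \<in> prob_on {-bound..bound}" for S'
      using cd(2) by blast
    from u.cond_distr_risk_shift(1)[OF W WB W cd(1) this le] AE_space
    show ?thesis
    proof eventually_elim
      case (elim \<omega>)
      then have "\<sigma> t (X t \<omega>) (cond_distr M (U t) (cost_to_go t S) \<omega>)
          \<le> \<sigma> t (X t \<omega>) (cond_distr M (U t) (cost_to_go t S') \<omega>) + ereal e"
        using risk[OF t(1)] by blast
      then show ?case
        using elim(2) by (simp add: risk_to_go_eq[OF t(1) S(1), symmetric] risk_to_go_eq[OF t(1) S(2), symmetric])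
    qed
  qed
  have "AE \<omega> in M. risk_to_go t T' \<omega> \<le> risk_to_go t T \<omega> + e"
    by (rule half[OF t(3,2)]) (use diff in \<open>eventually_elim, linarith\<close>)
  moreover have "AE \<omega> in M. risk_to_go t T \<omega> \<le> risk_to_go t T' \<omega> + e"
    by (rule half[OF t(2,3)]) (use diff in \<open>eventually_elim, linarith\<close>)
  ultimately have "AE \<omega> in M. \<bar>risk_to_go t T' \<omega> - risk_to_go t T \<omega>\<bar> \<le> e" by eventually_elim linarith
  then show ?case using n by (simp add: e_def)
qed

definition total_risk :: "nat \<Rightarrow> real" where
  "total_risk T = real_of_ereal (dyn_risk0 M F G \<sigma> \<gamma> X Z \<sigma>0 T)"

lemma discounted_regular:
  "(\<lambda>\<omega>. \<gamma> * risk_to_go 1 T \<omega>) \<in> borel_measurable M"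
  "\<And>\<omega>. \<omega> \<in> space M \<Longrightarrow> \<bar>\<gamma> * risk_to_go 1 T \<omega>\<bar> \<le> bound"
proof -
  show "(\<lambda>\<omega>. \<gamma> * risk_to_go 1 T \<omega>) \<in> borel_measurable M"
    using risk_to_go_bounded[of 1 T] by (intro borel_measurable_times) auto
  fix \<omega> assume "\<omega> \<in> space M"
  then have "\<bar>risk_to_go 1 T \<omega>\<bar> \<le> bound" using risk_to_go_bounded[of 1 T] by simp
  then have "\<gamma> * \<bar>risk_to_go 1 T \<omega>\<bar> \<le> 1 * bound" using discount by (intro mult_mono) auto
  then show "\<bar>\<gamma> * risk_to_go 1 T \<omega>\<bar> \<le> bound" using discount(1) by (simp add: abs_mult)
qed

lemma dyn_risk0_eq:
  assumes "T \<ge> 1"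
  shows "dyn_risk0 M F G \<sigma> \<gamma> X Z \<sigma>0 T = \<sigma>0 (distr M borel (\<lambda>\<omega>. \<gamma> * risk_to_go 1 T \<omega>))"
    "dyn_risk0 M F G \<sigma> \<gamma> X Z \<sigma>0 T = ereal (total_risk T)"
proof -
  show eq: "dyn_risk0 M F G \<sigma> \<gamma> X Z \<sigma>0 T = \<sigma>0 (distr M borel (\<lambda>\<omega>. \<gamma> * risk_to_go 1 T \<omega>))"
    using assms by (simp add: dyn_risk0_def cost_process_def cost0 risk_to_go_def)
  have "distr M borel (\<lambda>\<omega>. \<gamma> * risk_to_go 1 T \<omega>) \<in> prob_on {-bound..bound}"
    using law_prob_on[OF discounted_regular] .
  from risk_finite[OF risk0 prob_bddI[OF this]]
  show "dyn_risk0 M F G \<sigma> \<gamma> X Z \<sigma>0 T = ereal (total_risk T)"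
    by (simp add: total_risk_def eq ereal_real')
qed

lemma total_risk_eq: "T \<ge> 1 \<Longrightarrow> ereal (total_risk T) = \<sigma>0 (distr M borel (\<lambda>\<omega>. \<gamma> * risk_to_go 1 T \<omega>))"
  using dyn_risk0_eq[of T] by simp

lemma total_risk_truncation:
  assumes "1 \<le> T" "T \<le> T'"
  shows "\<bar>total_risk T' - total_risk T\<bar> \<le> \<gamma> ^ T * bound"
proof -
  have "AE \<omega> in M. \<bar>risk_to_go 1 T' \<omega> - risk_to_go 1 T \<omega>\<bar> \<le> \<gamma> ^ T * bound"
    using risk_to_go_truncation[OF assms(2), of 1] by simp
  then have diff: "AE \<omega> in M. \<bar>\<gamma> * risk_to_go 1 T' \<omega> - \<gamma> * risk_to_go 1 T \<omega>\<bar> \<le> \<gamma> ^ T * bound"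
  proof eventually_elim
    case (elim \<omega>)
    have "\<gamma> * \<bar>risk_to_go 1 T' \<omega> - risk_to_go 1 T \<omega>\<bar> \<le> 1 * (\<gamma> ^ T * bound)"
      using elim discount by (intro mult_mono) auto
    then show ?case using discount(1) by (simp add: abs_mult right_diff_distrib[symmetric])
  qed
  have "total_risk S \<le> total_risk S' + \<gamma> ^ T * bound"
    if "1 \<le> S" "1 \<le> S'" "AE \<omega> in M. \<gamma> * risk_to_go 1 S \<omega> \<le> \<gamma> * risk_to_go 1 S' \<omega> + \<gamma> ^ T * bound" for S S'
    using law_risk_shift[OF discounted_regular discounted_regular that(3)]
    unfolding total_risk_eq[OF that(1), symmetric] total_risk_eq[OF that(2), symmetric] by simp
  note shift = this
  have "AE \<omega> in M. \<gamma> * risk_to_go 1 T' \<omega> \<le> \<gamma> * risk_to_go 1 T \<omega> + \<gamma> ^ T * bound"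
    using diff by eventually_elim linarith
  moreover have "AE \<omega> in M. \<gamma> * risk_to_go 1 T \<omega> \<le> \<gamma> * risk_to_go 1 T' \<omega> + \<gamma> ^ T * bound"
    using diff by eventually_elim linarith
  ultimately show ?thesis using shift[of T' T] shift[of T T'] assms by linarith
qed

lemma total_risk_converges:
  obtains \<rho> where "dyn_risk0_inf M F G \<sigma> \<gamma> X Z \<sigma>0 = ereal \<rho>" "\<And>T. 1 \<le> T \<Longrightarrow> \<bar>\<rho> - total_risk T\<bar> \<le> \<gamma> ^ T * bound"
proof -
  have pow: "(\<lambda>T. \<gamma> ^ T * bound) \<longlonglongrightarrow> 0"
    using discount by (intro tendsto_mult_left_zero LIMSEQ_power_zero) simp
  have "Cauchy total_risk"
  proof (rule metric_CauchyI)
    fix e :: real assume "e > 0"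
    have "\<forall>\<^sub>F T in sequentially. \<gamma> ^ T * bound < e / 2"
      using pow \<open>e > 0\<close> by (intro order_tendstoD(2)) auto
    then obtain N where N: "\<And>T. T \<ge> N \<Longrightarrow> \<gamma> ^ T * bound < e / 2" by (auto simp: eventually_sequentially)
    have near: "dist (total_risk T) (total_risk (Suc N)) < e / 2" if "T \<ge> Suc N" for T
      using total_risk_truncation[OF _ that] N[of "Suc N"] by (simp add: dist_real_def)
    show "\<exists>N. \<forall>m\<ge>N. \<forall>n\<ge>N. dist (total_risk m) (total_risk n) < e"
    proof (intro exI[of _ "Suc N"] allI impI)
      fix m n assume "Suc N \<le> m" "Suc N \<le> n"
      then show "dist (total_risk m) (total_risk n) < e"
        by (intro dist_triangle_half_l[OF near near])
    qed
  qed
  then obtain \<rho> where \<rho>: "total_risk \<longlonglongrightarrow> \<rho>" using real_Cauchy_convergent by (auto simp: convergent_def)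
  have "(\<lambda>T. dyn_risk0 M F G \<sigma> \<gamma> X Z \<sigma>0 T) \<longlonglongrightarrow> ereal \<rho>"
  proof (rule Lim_transform_eventually)
    show "(\<lambda>T. ereal (total_risk T)) \<longlonglongrightarrow> ereal \<rho>" using \<rho> by simp
    show "\<forall>\<^sub>F T in sequentially. ereal (total_risk T) = dyn_risk0 M F G \<sigma> \<gamma> X Z \<sigma>0 T"
      using eventually_ge_at_top[of 1] by eventually_elim (simp add: dyn_risk0_eq(2))
  qed
  then have "dyn_risk0_inf M F G \<sigma> \<gamma> X Z \<sigma>0 = ereal \<rho>"
    unfolding dyn_risk0_inf_def by (rule limI)
  moreover have "\<bar>\<rho> - total_risk T\<bar> \<le> \<gamma> ^ T * bound" if "1 \<le> T" for T
  proof (rule LIMSEQ_le_const2)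
    show "(\<lambda>T'. \<bar>total_risk T' - total_risk T\<bar>) \<longlonglongrightarrow> \<bar>\<rho> - total_risk T\<bar>"
      using \<rho> by (intro tendsto_intros)
    show "\<exists>N. \<forall>T'\<ge>N. \<bar>total_risk T' - total_risk T\<bar> \<le> \<gamma> ^ T * bound"
      using total_risk_truncation[OF that] by blast
  qed
  ultimately show thesis by (rule that)
qed

lemma initial_value_law:
  "distr M borel (\<lambda>\<omega>. \<gamma> * val T 1 (X 1 \<omega>)) = distr \<xi>1 borel (\<lambda>x. \<gamma> * val T 1 x)"
proof -
  have "distr \<xi>1 borel (\<lambda>x. \<gamma> * val T 1 x) = distr (distr M borel (X 1)) borel (\<lambda>x. \<gamma> * val T 1 x)"
    using cp by (simp add: controlled_process_def)
  also have "\<dots> = distr M borel ((\<lambda>x. \<gamma> * val T 1 x) \<circ> X 1)"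
    using val_measurable[of 1 T] X_M[of 1] by (intro distr_distr) auto
  finally show ?thesis by (simp add: o_def)
qed

text \<open>
  The value at time 1 is a function of the initial state, whose law \<open>\<xi>1\<close> is common to all
  processes. The risk of this law separates an arbitrary process from one that follows the policy.
\<close>

lemma total_risk_vs_initial_value:
  assumes "1 \<le> T"
  shows "\<sigma>0 (distr \<xi>1 borel (\<lambda>x. \<gamma> * val T 1 x)) \<le> ereal (total_risk T)"
    and "follows_policy M F G (horizon_policy T) X A \<Longrightarrow>
      ereal (total_risk T) \<le> \<sigma>0 (distr \<xi>1 borel (\<lambda>x. \<gamma> * val T 1 x))"
proof -
  have vm: "(\<lambda>\<omega>. \<gamma> * val T 1 (X 1 \<omega>)) \<in> borel_measurable M"
    using measurable_compose[OF X_M val_measurable, of 1 1 T] by simp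
  have vb: "\<bar>\<gamma> * val T 1 (X 1 \<omega>)\<bar> \<le> bound" for \<omega>
  proof -
    have "\<bar>val T 1 (X 1 \<omega>)\<bar> \<le> bound" using val_admissible[of 1 T] by (simp add: admissible_def)
    then have "\<gamma> * \<bar>val T 1 (X 1 \<omega>)\<bar> \<le> 1 * bound" using discount by (intro mult_mono) auto
    then show ?thesis using discount(1) by (simp add: abs_mult)
  qed
  have "AE \<omega> in M. \<gamma> * val T 1 (X 1 \<omega>) \<le> \<gamma> * risk_to_go 1 T \<omega> + 0"
    using risk_to_go_ge_val[of 1 T, simplified] by eventually_elim (simp add: mult_left_mono discount(1))
  from law_risk_shift[OF vm vb discounted_regular this]
  show "\<sigma>0 (distr \<xi>1 borel (\<lambda>x. \<gamma> * val T 1 x)) \<le> ereal (total_risk T)"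
    unfolding initial_value_law total_risk_eq[OF assms] zero_ereal_def[symmetric] by simp
  assume "follows_policy M F G (horizon_policy T) X A"
  from risk_to_go_le_val[OF this, of 1, simplified]
  have "AE \<omega> in M. \<gamma> * risk_to_go 1 T \<omega> \<le> \<gamma> * val T 1 (X 1 \<omega>) + 0"
    by eventually_elim (simp add: mult_left_mono discount(1))
  from law_risk_shift[OF discounted_regular vm vb this]
  show "ereal (total_risk T) \<le> \<sigma>0 (distr \<xi>1 borel (\<lambda>x. \<gamma> * val T 1 x))"
    unfolding initial_value_law total_risk_eq[OF assms] zero_ereal_def[symmetric] by simp
qed

end

end

section \<open>Markov policies suffice\<close>

theorem proposition5p7:
  fixes M :: "'w measure" and F G :: "nat \<Rightarrow> 'w measure"
    and \<sigma>0 :: "real measure \<Rightarrow> ereal"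
    and \<sigma> :: "nat \<Rightarrow> 'x::polish_space \<Rightarrow> real measure \<Rightarrow> ereal"
    and bd :: "nat \<Rightarrow> real"
    and \<A> :: "nat \<Rightarrow> 'x \<Rightarrow> 'a::polish_space set"
    and P :: "nat \<Rightarrow> 'x \<Rightarrow> 'a \<Rightarrow> 'x measure" and \<xi>1 :: "'x measure"
    and \<Psi> :: "((nat \<Rightarrow> 'w \<Rightarrow> 'x) \<times> (nat \<Rightarrow> 'w \<Rightarrow> 'a)) set"
    and Xp :: "(nat \<Rightarrow> 'x \<Rightarrow> 'a measure) \<Rightarrow> nat \<Rightarrow> 'w \<Rightarrow> 'x"
    and Ap :: "(nat \<Rightarrow> 'x \<Rightarrow> 'a measure) \<Rightarrow> nat \<Rightarrow> 'w \<Rightarrow> 'a"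
    and C :: "nat \<Rightarrow> 'x \<Rightarrow> 'a \<Rightarrow> 'x \<Rightarrow> real"
    and \<gamma> b :: real
    and X :: "nat \<Rightarrow> 'w \<Rightarrow> 'x" and A :: "nat \<Rightarrow> 'w \<Rightarrow> 'a"
  assumes M: "prob_space M" "complete_measure M" "atomless M"
    and filtrations: "filtration (space M) F" "filtration (space M) G"
      "\<And>t. sets (F t) \<subseteq> sets (G t)" "\<And>t. sets (G t) \<subseteq> sets M"
      "null_sets M \<subseteq> sets (F 1)"
      "sets (F 0) = {{}, space M}" "sets (G 0) = {{}, space M}"
    and risk0: "risk_measure \<sigma>0"
    and risk: "\<And>t x. t \<ge> 1 \<Longrightarrow> risk_measure (\<sigma> t x)"
    and risk_measurable: "\<And>t K. t \<ge> 1 \<Longrightarrow> compact K \<Longrightarrow>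
      (\<lambda>(x, \<mu>). \<sigma> t x \<mu>) \<in> borel_measurable (borel \<Otimes>\<^sub>M borel_of (weak_topology K))"
    and risk_bounded: "\<And>t. t \<ge> 1 \<Longrightarrow> bd t \<ge> 0"
      "\<And>t x. t \<ge> 1 \<Longrightarrow> \<bar>\<sigma> t x (return borel 0)\<bar> \<le> ereal (bd t)"
    and actions: "\<And>t x. t \<ge> 1 \<Longrightarrow> \<A> t x \<noteq> {}" "\<And>t x. t \<ge> 1 \<Longrightarrow> closed (\<A> t x)"
      "\<And>t. t \<ge> 1 \<Longrightarrow> weakly_measurable_corr (\<A> t)"
    and kernel: "\<And>t x a. t \<ge> 1 \<Longrightarrow> P t x a \<in> prob_on UNIV"
      "\<And>t B. t \<ge> 1 \<Longrightarrow> B \<in> sets borel \<Longrightarrow> (\<lambda>(x, a). measure (P t x a) B) \<in> borel_measurable borel"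
    and initial: "\<xi>1 \<in> prob_on UNIV"
    and \<Psi>: "\<And>X' A'. (X', A') \<in> \<Psi> \<Longrightarrow> controlled_process M F G \<A> P \<xi>1 X' A'"
    and policies: "\<And>p. p \<in> markov_policies \<A> \<Longrightarrow>
      (Xp p, Ap p) \<in> \<Psi> \<and> follows_policy M F G p (Xp p) (Ap p)"
    and costs: "C 0 = (\<lambda>_ _ _. 0)"
      "\<And>t. t \<ge> 1 \<Longrightarrow> (\<lambda>(x, a, y). C t x a y) \<in> borel_measurable borel"
    and discount: "0 \<le> \<gamma>" "\<gamma> < 1"
    and normalized: "\<And>t x. t \<ge> 1 \<Longrightarrow> \<sigma> t x (return borel 0) = 0"
    and i: "\<And>t xs x0 as a0. t \<ge> 1 \<Longrightarrow> xs \<longlonglongrightarrow> x0 \<Longrightarrow> as \<longlonglongrightarrow> a0 \<Longrightarrow>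
      weakly_converges (\<lambda>n. P t (xs n) (as n)) (P t x0 a0)"
    and ii: "\<And>t. t \<ge> 1 \<Longrightarrow> compact (\<Union>x. \<A> t x)"
      "\<And>t. t \<ge> 1 \<Longrightarrow> upper_hemicontinuous_corr (\<A> t)"
    and iii: "\<And>t K \<mu>s \<mu>0 xs x0. t \<ge> 1 \<Longrightarrow> compact K \<Longrightarrow> (\<And>n. \<mu>s n \<in> prob_on K) \<Longrightarrow>
      \<mu>0 \<in> prob_on K \<Longrightarrow> weakly_converges \<mu>s \<mu>0 \<Longrightarrow> xs \<longlonglongrightarrow> x0 \<Longrightarrow>
      liminf (\<lambda>n. \<sigma> t (xs n) (\<mu>s n)) \<ge> \<sigma> t x0 \<mu>0"
    and iv: "\<And>t. t \<ge> 1 \<Longrightarrow> lower_semicont (\<lambda>(x, a, y). C t x a y)"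
      "b > 0" "\<And>t x a y. t \<ge> 1 \<Longrightarrow> \<bar>C t x a y\<bar> \<le> b"
    and in_\<Psi>: "(X, A) \<in> \<Psi>"
  shows "(INF p\<in>markov_policies \<A>.
            dyn_risk0_inf M F G \<sigma> \<gamma> (Xp p) (cost_process C (Xp p) (Ap p)) \<sigma>0)
         \<le> dyn_risk0_inf M F G \<sigma> \<gamma> X (cost_process C X A) \<sigma>0"
proof -
  interpret prob_space M by (rule M(1))
  interpret control_problem M F G \<sigma>0 \<sigma> \<A> P \<xi>1 C \<gamma> b
    by (intro control_problem.intro control_problem_axioms.intro M(1))
      (fact filtrations risk0 risk risk_measurable actions kernel costs(1) discount normalized i ii iii iv)+
  let ?V = "\<lambda>p. dyn_risk0_inf M F G \<sigma> \<gamma> (Xp p) (cost_process C (Xp p) (Ap p)) \<sigma>0"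
  have cp: "controlled_process M F G \<A> P \<xi>1 X A" by (rule \<Psi>[OF in_\<Psi>])
  obtain \<rho> where \<rho>: "dyn_risk0_inf M F G \<sigma> \<gamma> X (cost_process C X A) \<sigma>0 = ereal \<rho>"
    and \<rho>_near: "\<And>T. 1 \<le> T \<Longrightarrow> \<bar>\<rho> - total_risk X A T\<bar> \<le> \<gamma> ^ T * bound"
    using total_risk_converges[OF cp] by blast
  have le: "(INF p\<in>markov_policies \<A>. ?V p) \<le> ereal (\<rho> + 2 * (\<gamma> ^ T * bound))" if T: "1 \<le> T" for T
  proof -
    define p where "p = horizon_policy T"
    have p: "p \<in> markov_policies \<A>" unfolding p_def by (rule horizon_policy_markov)
    have q: "(Xp p, Ap p) \<in> \<Psi>" "follows_policy M F G p (Xp p) (Ap p)" using policies[OF p] by simp_all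
    have cp': "controlled_process M F G \<A> P \<xi>1 (Xp p) (Ap p)" by (rule \<Psi>[OF q(1)])
    have fp: "follows_policy M F G (horizon_policy T) (Xp p) (Ap p)" using q(2) by (simp only: p_def[symmetric])
    obtain \<rho>' where \<rho>': "?V p = ereal \<rho>'" "\<bar>\<rho>' - total_risk (Xp p) (Ap p) T\<bar> \<le> \<gamma> ^ T * bound"
      using total_risk_converges[OF cp'] T by blast
    have "ereal (total_risk (Xp p) (Ap p) T) \<le> ereal (total_risk X A T)"
      using total_risk_vs_initial_value(2)[OF cp' T fp]
        total_risk_vs_initial_value(1)[OF cp T] by (rule order_trans)
    then have "total_risk (Xp p) (Ap p) T \<le> total_risk X A T" by simp
    with \<rho>'(2) \<rho>_near[OF T] have "\<rho>' \<le> \<rho> + 2 * (\<gamma> ^ T * bound)" by linarith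
    then have "?V p \<le> ereal (\<rho> + 2 * (\<gamma> ^ T * bound))" by (simp add: \<rho>'(1))
    then show ?thesis by (rule order_trans[OF INF_lower[OF p]])
  qed
  have "(\<lambda>T. \<rho> + 2 * (\<gamma> ^ T * bound)) \<longlonglongrightarrow> \<rho> + 2 * (0 * bound)"
    using discount by (intro tendsto_intros LIMSEQ_power_zero) simp
  then have "(\<lambda>T. ereal (\<rho> + 2 * (\<gamma> ^ T * bound))) \<longlonglongrightarrow> ereal \<rho>" by simp
  then have "(INF p\<in>markov_policies \<A>. ?V p) \<le> ereal \<rho>"
    by (rule LIMSEQ_le_const) (use le in \<open>intro exI[of _ 1] allI impI\<close>)
  then show ?thesis by (simp add: \<rho>)
qed

end
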